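(* Let $a>0$, $b\in\mathbb{R}\setminus\{0,-a\}$, $\mu>0$ and $I_1,I_2,I_3>0$. The reduced nonholonomic vector field on $T^*S^2$ of the rubber rolling of a balanced, dynamically asymmetric sphere $S_b$ over the sphere $S_a$ has an invariant measure whose density with respect to the Liouville measure of $T^*S^2$ is the determinant of the reduced Legendre transform to the power $p=\frac12\left(\frac ba-1\right)$, i.e. the measure $$\big(\det G(\gamma)\big)^{\frac12(\frac ba-1)}\;\omega_{can}\wedge\omega_{can}$$ is invariant under the flow.
   Context: $S_a$ is the sphere of radius $a$ centred at the origin of $\mathbb{R}^3$. The moving sphere $S_b$ has radius $|b|$ ($b>0$: external rolling; $b<0$: one sphere contains the other), mass $\mu$, center of mass at its geometric center, and inertia matrix $A=\mathrm{diag}(I_1,I_2,I_3)$ in the body frame. Configurations are $(q,R)\in S_a\times SO(3)$ ($q$ contact point, $R$ attitude matrix). Body and space angular velocities are defined by $R^{-1}\dot R=[\Omega]$, $\dot RR^{-1}=[\omega]$, $[v]w=v\times w$. The Lagrangian is $T=\frac12[\mu(1+b/a)^2|\dot q|^2+(A\Omega,\Omega)]$; the no-slip and no-twist constraints are $(1+\frac ba)\dot q=\frac ba\,\omega\times q$, $\omega\cdot q=0$; the dynamics is given by the Lagrange–d'Alembert principle. Everything is invariant under $S\cdot(q,R)=(Sq,SR)$, $S\in SO(3)$, with quotient map $(q,R)\mapsto\gamma=R^{-1}q/a\in S^2$ (unit sphere), so the motion of $\gamma$ is a closed second-order system on $S^2$, i.e. a vector field on $TS^2$. It is transported to $T^*S^2$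 by the reduced Legendre transform $p_\gamma=G(\gamma)\dot\gamma$, where, identifying $T^*_\gamma S^2$ with $T_\gamma S^2=\gamma^\perp$ by the Euclidean inner product, $$G(\gamma)v=\Big(1+\frac ba\Big)^2\big[\mu b^2v+A(\gamma\times v)\times\gamma\big],\quad v\in\gamma^\perp,$$ which is the Legendre transform of the compressed Lagrangian $T_{red}=\frac12(1+\frac ba)^2[\mu b^2|\dot\gamma|^2+(A(\gamma\times\dot\gamma),\gamma\times\dot\gamma)]$. $\det G(\gamma)$ is the determinant of this linear map of $\gamma^\perp$, and $\omega_{can}$ is the canonical symplectic form of $T^*S^2$. *)

theory Defs
  imports "HOL-Analysis.Analysis"
begin

unbundle cross3_syntax

section \<open>Lagrange--d'Alembert dynamics\<close>

text \<open>
  The principle in differential form. The configuration manifold is embedded in the Euclidean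
  space \<open>'a\<close>; \<open>D x\<close> is the space of virtual displacements at \<open>x\<close> (tangent to the configuration
  manifold and admissible for the constraints). Along the curve \<open>x\<close> with velocity \<open>v\<close>,
  \<open>(d/dt \<partial>L/\<partial>v - \<partial>L/\<partial>x) \<cdot> \<delta> = 0\<close> for every \<open>\<delta>\<close> in \<open>D (x t)\<close>. As \<open>\<delta>\<close> is tangent to the
  configuration manifold, this depends only on the values of \<open>L\<close> on its tangent bundle.
\<close>

definition lagrange_dalembert ::
  "('a::euclidean_space \<Rightarrow> 'a \<Rightarrow> real) \<Rightarrow> ('a \<Rightarrow> 'a set) \<Rightarrow> real set
    \<Rightarrow> (real \<Rightarrow> 'a) \<Rightarrow> (real \<Rightarrow> 'a) \<Rightarrow> bool" where
  "lagrange_dalembert L D J x v \<longleftrightarrow>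
    (\<forall>t\<in>J. \<forall>\<delta>\<in>D (x t).
      ((\<lambda>s. frechet_derivative (L (x s)) (at (v s)) \<delta>) has_real_derivative
        frechet_derivative (\<lambda>y. L y (v t)) (at (x t)) \<delta>) (at t))"


section \<open>Rubber rolling of a sphere over a sphere\<close>

definition hat :: "real^3 \<Rightarrow> real^3^3" where
  "hat w = matrix (\<lambda>u. w \<times> u)"

text \<open>
  Inverse of \<^const>\<open>hat\<close> on skew-symmetric matrices, extended to all matrices through the
  skew-symmetric part.
\<close>

definition vee :: "real^3^3 \<Rightarrow> real^3" where
  "vee M = (1/2) *\<^sub>R vector [M$3$2 - M$2$3, M$1$3 - M$3$1, M$2$1 - M$1$2]"

lemma vee_hat: "vee (hat w) = w"
  by (simp add: vee_def hat_def matrix_def cross3_def vec_eq_iff forall_3 axis_def)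

definition diag3 :: "real \<Rightarrow> real \<Rightarrow> real \<Rightarrow> real^3^3" where
  "diag3 I\<^sub>1 I\<^sub>2 I\<^sub>3 = (\<chi> i j. if i = j then (vector [I\<^sub>1, I\<^sub>2, I\<^sub>3] :: real^3) $ i else 0)"

type_synonym config = "(real^3) \<times> (real^3^3)"

definition config_space :: "real \<Rightarrow> config set" where
  "config_space a = {(q, R). q \<in> sphere 0 a \<and> rotation_matrix R}"

text \<open>
  On the tangent bundle \<open>transpose R ** V = hat \<Omega>\<close> with \<open>\<Omega>\<close> the body angular velocity, so this is
  the given Lagrangian there.
\<close>

definition rolling_lagrangian :: "real \<Rightarrow> real \<Rightarrow> real \<Rightarrow> real^3^3 \<Rightarrow> config \<Rightarrow> config \<Rightarrow> real" where
  "rolling_lagrangian a b \<mu> A = (\<lambda>(q, R) (u, V).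
     let \<Omega> = vee (transpose R ** V)
     in (1/2) * (\<mu> * (1 + b/a)^2 * (norm u)^2 + (A *v \<Omega>) \<bullet> \<Omega>))"

text \<open>
  Velocities satisfying the no-slip and no-twist constraints; \<open>V = hat \<omega> ** R\<close> says that \<open>\<omega>\<close> is
  the space angular velocity. For \<open>b \<noteq> -a\<close> they are automatically tangent to
  \<^const>\<open>config_space\<close>.
\<close>

definition rubber_distribution :: "real \<Rightarrow> real \<Rightarrow> config \<Rightarrow> config set" where
  "rubber_distribution a b = (\<lambda>(q, R).
     {(u, V). \<exists>\<omega>. V = hat \<omega> ** R \<and> (1 + b/a) *\<^sub>R u = (b/a) *\<^sub>R (\<omega> \<times> q) \<and> \<omega> \<bullet> q = 0})"

definition rubber_motion ::
  "real \<Rightarrow> real \<Rightarrow> real \<Rightarrow> real^3^3 \<Rightarrow> real set \<Rightarrow> (real \<Rightarrow> config) \<Rightarrow> (real \<Rightarrow> config) \<Rightarrow> bool" where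
  "rubber_motion a b \<mu> A J x v \<longleftrightarrow>
     open J \<and> is_interval J \<and>
     (\<forall>t\<in>J. x t \<in> config_space a) \<and>
     (\<forall>t\<in>J. (x has_vector_derivative v t) (at t)) \<and>
     (\<exists>w. continuous_on J w \<and> (\<forall>t\<in>J. (v has_vector_derivative w t) (at t))) \<and>
     (\<forall>t\<in>J. v t \<in> rubber_distribution a b (x t)) \<and>
     lagrange_dalembert (rolling_lagrangian a b \<mu> A) (rubber_distribution a b) J x v"


section \<open>Reduction to the cotangent bundle of the unit sphere\<close>

type_synonym phase = "(real^3) \<times> (real^3)"

text \<open>Cotangent spaces are identified with tangent planes by the Euclidean inner product.\<close>

definition cotangent_sphere :: "phase set" where
  "cotangent_sphere = {(\<gamma>, p). norm \<gamma> = 1 \<and> \<gamma> \<bullet> p = 0}"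

definition reduced_legendre ::
  "real \<Rightarrow> real \<Rightarrow> real \<Rightarrow> real^3^3 \<Rightarrow> real^3 \<Rightarrow> real^3 \<Rightarrow> real^3" where
  "reduced_legendre a b \<mu> A \<gamma> v =
     (1 + b/a)^2 *\<^sub>R ((\<mu> * b^2) *\<^sub>R v + (A *v (\<gamma> \<times> v)) \<times> \<gamma>)"

definition reduced_position :: "real \<Rightarrow> config \<Rightarrow> real^3" where
  "reduced_position a = (\<lambda>(q, R). (1/a) *\<^sub>R (matrix_inv R *v q))"

definition reduced_curve ::
  "real \<Rightarrow> real \<Rightarrow> real \<Rightarrow> real^3^3 \<Rightarrow> (real \<Rightarrow> config) \<Rightarrow> real \<Rightarrow> phase" where
  "reduced_curve a b \<mu> A x t =
     (let \<gamma> = \<lambda>s. reduced_position a (x s)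
      in (\<gamma> t, reduced_legendre a b \<mu> A (\<gamma> t) (vector_derivative \<gamma> (at t))))"

definition reduced_field :: "real \<Rightarrow> real \<Rightarrow> real \<Rightarrow> real^3^3 \<Rightarrow> phase \<Rightarrow> phase" where
  "reduced_field a b \<mu> A z =
     (THE w. \<exists>J x v. rubber_motion a b \<mu> A J x v \<and> 0 \<in> J \<and>
        reduced_curve a b \<mu> A x 0 = z \<and>
        (reduced_curve a b \<mu> A x has_vector_derivative w) (at 0))"


section \<open>Invariant measures of vector fields\<close>

text \<open>The (possibly only locally defined) flow at time \<open>t\<close> of \<open>X\<close> on \<open>N\<close>, as a relation.\<close>

definition flow :: "'a::real_normed_vector set \<Rightarrow> ('a \<Rightarrow> 'a) \<Rightarrow> real \<Rightarrow> 'a rel" where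
  "flow N X t = {(z\<^sub>0, z\<^sub>1). \<exists>J z. open J \<and> is_interval J \<and> 0 \<in> J \<and> t \<in> J \<and>
     (\<forall>s\<in>J. z s \<in> N \<and> (z has_vector_derivative X (z s)) (at s)) \<and> z 0 = z\<^sub>0 \<and> z t = z\<^sub>1}"

definition flow_invariant ::
  "'a::real_normed_vector set \<Rightarrow> ('a \<Rightarrow> 'a) \<Rightarrow> 'a measure \<Rightarrow> bool" where
  "flow_invariant N X M \<longleftrightarrow>
     (\<forall>t. \<forall>E\<in>sets M. E \<subseteq> Domain (flow N X t) \<longrightarrow>
        flow N X t `` E \<in> sets M \<and> emeasure M (flow N X t `` E) = emeasure M E)"


section \<open>The Liouville measure\<close>

text \<open>
  \<open>d\<gamma> \<and> dp\<close>, restricted to \<^const>\<open>cotangent_sphere\<close>. It is the canonical form since the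
  tautological one-form is the restriction of \<open>p \<cdot> d\<gamma>\<close>.
\<close>

definition omega_can :: "phase \<Rightarrow> phase \<Rightarrow> real" where
  "omega_can = (\<lambda>(u, \<alpha>) (v, \<beta>). u \<bullet> \<beta> - v \<bullet> \<alpha>)"

definition wedge ::
  "('a \<Rightarrow> 'a \<Rightarrow> real) \<Rightarrow> ('a \<Rightarrow> 'a \<Rightarrow> real) \<Rightarrow> 'a \<Rightarrow> 'a \<Rightarrow> 'a \<Rightarrow> 'a \<Rightarrow> real" where
  "wedge \<alpha> \<beta> u\<^sub>1 u\<^sub>2 u\<^sub>3 u\<^sub>4 =
     \<alpha> u\<^sub>1 u\<^sub>2 * \<beta> u\<^sub>3 u\<^sub>4 - \<alpha> u\<^sub>1 u\<^sub>3 * \<beta> u\<^sub>2 u\<^sub>4 + \<alpha> u\<^sub>1 u\<^sub>4 * \<beta> u\<^sub>2 u\<^sub>3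
     + \<alpha> u\<^sub>2 u\<^sub>3 * \<beta> u\<^sub>1 u\<^sub>4 - \<alpha> u\<^sub>2 u\<^sub>4 * \<beta> u\<^sub>1 u\<^sub>3 + \<alpha> u\<^sub>3 u\<^sub>4 * \<beta> u\<^sub>1 u\<^sub>2"

definition stereographic :: "real^2 \<Rightarrow> real^3" where
  "stereographic x =
     (1 / (1 + (norm x)^2)) *\<^sub>R vector [2 * x$1, 2 * x$2, (norm x)^2 - 1]"

definition bundle_chart :: "(real^2) \<times> (real^2) \<Rightarrow> phase" where
  "bundle_chart = (\<lambda>(x, y). (stereographic x, frechet_derivative stereographic (at x) y))"

text \<open>
  The measure on \<^const>\<open>cotangent_sphere\<close> defined by a 4-form \<open>\<eta>\<close>, in the coordinates
  \<^const>\<open>bundle_chart\<close>. These parametrize diffeomorphically all of \<^const>\<open>cotangent_sphere\<close>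
  except one cotangent plane, a submanifold of codimension two and hence a null set. By the
  transformation rule for forms the result does not depend on the chart.
\<close>

definition volume_measure ::
  "(phase \<Rightarrow> phase \<Rightarrow> phase \<Rightarrow> phase \<Rightarrow> phase \<Rightarrow> real) \<Rightarrow> phase measure" where
  "volume_measure \<eta> =
     distr
       (density lborel (\<lambda>w.
          let d = frechet_derivative bundle_chart (at w)
          in ennreal \<bar>\<eta> (bundle_chart w)
               (d (axis 1 1, 0)) (d (axis 2 1, 0)) (d (0, axis 1 1)) (d (0, axis 2 1))\<bar>))
       (restrict_space borel cotangent_sphere) bundle_chart"

text \<open>
  Determinant of an endomorphism \<open>L\<close> of the plane orthogonal to the unit vector \<open>\<gamma>\<close>: the
  determinant of the map of \<open>\<real>\<^sup>3\<close> that is \<open>L\<close> on that plane and fixes \<open>\<gamma>\<close>.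
\<close>

definition plane_det :: "real^3 \<Rightarrow> (real^3 \<Rightarrow> real^3) \<Rightarrow> real" where
  "plane_det \<gamma> L = det (matrix (\<lambda>w. L (w - (\<gamma> \<bullet> w) *\<^sub>R \<gamma>) + (\<gamma> \<bullet> w) *\<^sub>R \<gamma>))"

lemma plane_det_orthonormal_basis:
  fixes e\<^sub>1 e\<^sub>2 \<gamma> :: "real^3"
  assumes L: "linear L"
    and n: "norm e\<^sub>1 = 1" "norm e\<^sub>2 = 1" "norm \<gamma> = 1"
    and o: "e\<^sub>1 \<bullet> e\<^sub>2 = 0" "\<gamma> \<bullet> e\<^sub>1 = 0" "\<gamma> \<bullet> e\<^sub>2 = 0"
  shows "plane_det \<gamma> L = (e\<^sub>1 \<bullet> L e\<^sub>1) * (e\<^sub>2 \<bullet> L e\<^sub>2) - (e\<^sub>1 \<bullet> L e\<^sub>2) * (e\<^sub>2 \<bullet> L e\<^sub>1)"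
proof -
  define f where "f = (\<lambda>w. L (w - (\<gamma> \<bullet> w) *\<^sub>R \<gamma>) + (\<gamma> \<bullet> w) *\<^sub>R \<gamma>)"
  define P :: "real^3^3" where "P = vector [e\<^sub>1, e\<^sub>2, \<gamma>]"
  have rows: "P $ 1 = e\<^sub>1" "P $ 2 = e\<^sub>2" "P $ 3 = \<gamma>" by (simp_all add: P_def)
  have dots: "e\<^sub>1 \<bullet> e\<^sub>1 = 1" "e\<^sub>2 \<bullet> e\<^sub>2 = 1" "\<gamma> \<bullet> \<gamma> = 1" "e\<^sub>2 \<bullet> e\<^sub>1 = 0" "e\<^sub>1 \<bullet> \<gamma> = 0" "e\<^sub>2 \<bullet> \<gamma> = 0"
    using n o by (simp_all add: norm_eq_1 inner_commute)
  have lin: "linear f"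
    unfolding f_def
    by (rule linearI)
      (simp_all add: linear_diff[OF L] linear_add[OF L] linear_scale[OF L] algebra_simps inner_add_right)
  have entry: "(P ** (matrix f ** transpose P)) $ i $ j = P $ i \<bullet> f (P $ j)" for i j
  proof -
    have "(P ** (matrix f ** transpose P)) $ i $ j = P $ i \<bullet> (matrix f *v (P $ j))"
      by (simp add: inner_vec_def matrix_matrix_mult_def matrix_vector_mult_def transpose_def)
    then show ?thesis by (simp add: matrix_works lin)
  qed
  have orth: "P ** transpose P = mat 1"
    by (simp add: vec_eq_iff forall_3 matrix_matrix_mult_def transpose_def mat_def rows)
       (use dots o in \<open>simp add: inner_vec_def\<close>)
  have "det P * det (transpose P) = 1"
    using arg_cong[OF orth, of det] by (simp add: det_mul)
  then have "det (P ** (matrix f ** transpose P)) = det (matrix f)"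
    by (simp add: det_mul)
  moreover have "f e\<^sub>1 = L e\<^sub>1" "f e\<^sub>2 = L e\<^sub>2" "f \<gamma> = \<gamma>"
    using o dots linear_0[OF L] by (simp_all add: f_def)
  ultimately show ?thesis
    unfolding plane_det_def f_def[symmetric]
    by (simp add: det_3 entry rows dots o)
qed

end

theory Submission
  imports Defs
begin

text \<open>
  Let \<open>k = 1 + b/a\<close>, \<open>J = A + \<mu> b\<^sup>2\<close>, \<open>B = J\<^sup>-\<^sup>1\<close> and let \<open>\<Omega>\<close> be the body angular velocity. In the body
  frame the rolling equations are \<open>\<gamma>' = \<gamma> \<times> \<Omega> / k\<close>, \<open>\<Omega> \<bullet> \<gamma> = 0\<close> and \<open>J \<Omega>' + \<Omega> \<times> J \<Omega>\<close> parallel to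
  \<open>\<gamma>\<close>, and the Legendre transform is \<open>p = k \<gamma> \<times> J \<Omega>\<close>. In the momentum \<open>K = J \<Omega>\<close> this flow extends to
  an open subset of \<open>\<real>\<^sup>3 \<times> \<real>\<^sup>3\<close>, with first integrals \<open>\<bar>\<gamma>\<bar>\<close> and \<open>\<gamma> \<bullet> B K\<close>, and there a computation of the
  divergence shows that \<open>(\<gamma> \<bullet> B \<gamma>) powr (k/2) d\<gamma> dK\<close> is invariant. Slicing along \<open>\<bar>\<gamma>\<bar> = 1\<close> and
  \<open>\<gamma> \<bullet> B K = 0\<close> costs one power of \<open>\<gamma> \<bullet> B \<gamma>\<close>, which leaves the exponent
  \<open>k/2 - 1 = (b/a - 1)/2\<close>; and \<open>det G\<close> is a constant multiple of \<open>\<gamma> \<bullet> B \<gamma>\<close>.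
\<close>

section \<open>Continuously differentiable maps\<close>

text \<open>A divergence on the four-dimensional phase space would call for charts. In the flat
  space of pairs \<open>(\<gamma>, K)\<close> it is the trace of a derivative, and the stereographic
  chart is left only the comparison of measures. The extension has room for this: \<open>p\<close>
  sees \<open>K\<close> only modulo \<gamma>, so the radial part of the motion of \<open>K\<close>
  can be spent on conserving spin. A third integral, the energy of the twist-free part of
  \<open>K\<close>, makes the joint level sets compact, and the flow is therefore complete.

  The obstacle is Liouville's theorem, whose usual proof differentiates the flow in its initial
  value. Here explicit Euler steps replace the flow: each multiplies the weighted volume of a
  compact set by at least 1 - \<epsilon>h, compactness carries this lower bound to the limit, and
  time reversal turns the inequality into an equality.

  The lost power of \<open>D\<close> (that is, of \<gamma> \<bullet> B \<gamma>) is a Jacobian. The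
  direction of \<open>K\<close> forgotten by \<open>p\<close> is \<gamma>, along which spin grows at
  rate \<open>D\<close>, so passing from \<open>K\<close> to \<open>p\<close> and spin costs a
  factor 1/D.\<close>

definition C1_on :: "'a::euclidean_space set \<Rightarrow> ('a \<Rightarrow> 'b::euclidean_space) \<Rightarrow> bool" where
  "C1_on U f \<longleftrightarrow> (\<exists>f'. (\<forall>x\<in>U. (f has_derivative f' x) (at x)) \<and> (\<forall>v. continuous_on U (\<lambda>x. f' x v)))"

lemma C1_onI:
  assumes "\<And>x. x \<in> U \<Longrightarrow> (f has_derivative f' x) (at x)" and "\<And>v. continuous_on U (\<lambda>x. f' x v)"
  shows "C1_on U f"
  using assms unfolding C1_on_def by blast

lemma C1_onE:
  assumes "C1_on U f"
  obtains f' where "\<And>x. x \<in> U \<Longrightarrow> (f has_derivative f' x) (at x)" and "\<And>v. continuous_on U (\<lambda>x. f' x v)"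
  using assms unfolding C1_on_def by blast

lemma C1_on_continuous_on: "C1_on U f \<Longrightarrow> continuous_on U f"
  by (meson C1_on_def has_derivative_continuous_on has_derivative_at_withinI)

lemma C1_on_const: "C1_on U (\<lambda>x. c)"
  by (rule C1_onI[where f'="\<lambda>x v. 0"]) auto

lemma C1_on_id: "C1_on U (\<lambda>x. x)"
  by (rule C1_onI[where f'="\<lambda>x v. v"]) auto

lemma C1_on_add:
  assumes "C1_on U f" "C1_on U g"
  shows "C1_on U (\<lambda>x. f x + g x)"
proof -
  obtain f' where f: "\<And>x. x \<in> U \<Longrightarrow> (f has_derivative f' x) (at x)" "\<And>v. continuous_on U (\<lambda>x. f' x v)"
    using C1_onE[OF assms(1)] by blast
  obtain g' where g: "\<And>x. x \<in> U \<Longrightarrow> (g has_derivative g' x) (at x)" "\<And>v. continuous_on U (\<lambda>x. g' x v)"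
    using C1_onE[OF assms(2)] by blast
  show ?thesis
    by (rule C1_onI[where f'="\<lambda>x v. f' x v + g' x v"])
      (auto intro!: has_derivative_add continuous_on_add f g)
qed

lemma C1_on_linear:
  assumes "bounded_linear l" "C1_on U f"
  shows "C1_on U (\<lambda>x. l (f x))"
proof -
  obtain f' where f: "\<And>x. x \<in> U \<Longrightarrow> (f has_derivative f' x) (at x)" "\<And>v. continuous_on U (\<lambda>x. f' x v)"
    using C1_onE[OF assms(2)] by blast
  show ?thesis
    by (rule C1_onI[where f'="\<lambda>x v. l (f' x v)"])
      (auto intro!: bounded_linear.has_derivative[OF assms(1)] bounded_linear.continuous_on[OF assms(1)] f)
qed

lemma C1_on_bilinear:
  assumes "bounded_bilinear prd" "C1_on U f" "C1_on U g"
  shows "C1_on U (\<lambda>x. prd (f x) (g x))"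
proof -
  obtain f' where f: "\<And>x. x \<in> U \<Longrightarrow> (f has_derivative f' x) (at x)" "\<And>v. continuous_on U (\<lambda>x. f' x v)"
    using C1_onE[OF assms(2)] by blast
  obtain g' where g: "\<And>x. x \<in> U \<Longrightarrow> (g has_derivative g' x) (at x)" "\<And>v. continuous_on U (\<lambda>x. g' x v)"
    using C1_onE[OF assms(3)] by blast
  note c = C1_on_continuous_on[OF assms(2)] C1_on_continuous_on[OF assms(3)]
  show ?thesis
    by (rule C1_onI[where f'="\<lambda>x v. prd (f x) (g' x v) + prd (f' x v) (g x)"])
      (auto intro!: bounded_bilinear.FDERIV[OF assms(1)] continuous_on_add
        bounded_bilinear.continuous_on[OF assms(1)] f g c)
qed

lemma C1_on_minus: "C1_on U f \<Longrightarrow> C1_on U (\<lambda>x. - f x)"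
  by (rule C1_on_linear[OF bounded_linear_minus[OF bounded_linear_ident]])

lemma C1_on_diff: "C1_on U f \<Longrightarrow> C1_on U g \<Longrightarrow> C1_on U (\<lambda>x. f x - g x)"
  using C1_on_add[OF _ C1_on_minus, of U f g] by simp

lemma C1_on_Pair:
  assumes "C1_on U f" "C1_on U g"
  shows "C1_on U (\<lambda>x. (f x, g x))"
proof -
  have "C1_on U (\<lambda>x. (f x, 0) + (0, g x))"
    by (intro C1_on_add C1_on_linear[OF _ assms(1)] C1_on_linear[OF _ assms(2)]
        bounded_linear_Pair bounded_linear_ident bounded_linear_zero)
  then show ?thesis by simp
qed

lemma C1_on_compose:
  assumes "C1_on U f" "C1_on V g" and sub: "\<And>x. x \<in> U \<Longrightarrow> f x \<in> V"
  shows "C1_on U (\<lambda>x. g (f x))"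
proof -
  obtain f' where f: "\<And>x. x \<in> U \<Longrightarrow> (f has_derivative f' x) (at x)" "\<And>v. continuous_on U (\<lambda>x. f' x v)"
    using C1_onE[OF assms(1)] by blast
  obtain g' where g: "\<And>x. x \<in> V \<Longrightarrow> (g has_derivative g' x) (at x)" "\<And>v. continuous_on V (\<lambda>x. g' x v)"
    using C1_onE[OF assms(2)] by blast
  note cf = C1_on_continuous_on[OF assms(1)]
  \<comment> \<open>The direction \<open>f' x v\<close> moves with \<open>x\<close>, whereas
    continuity of \<open>g'\<close> is known one fixed direction at a time; expanding in the basis
    leaves finitely many fixed directions.\<close>
  have lin: "g' (f x) w = (\<Sum>b\<in>Basis. (w \<bullet> b) *\<^sub>R g' (f x) b)" if "x \<in> U" for x w
  proof -
    have l: "linear (g' (f x))" using g(1)[OF sub[OF that]] has_derivative_linear by blast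
    have "g' (f x) w = g' (f x) (\<Sum>b\<in>Basis. (w \<bullet> b) *\<^sub>R b)" by (simp add: euclidean_representation)
    then show ?thesis by (simp add: linear_sum[OF l] linear_cmul[OF l] o_def)
  qed
  show ?thesis
  proof (rule C1_onI[where f'="\<lambda>x v. g' (f x) (f' x v)"])
    show "((\<lambda>x. g (f x)) has_derivative (\<lambda>v. g' (f x) (f' x v))) (at x)" if "x \<in> U" for x
      by (rule has_derivative_compose[OF f(1)[OF that] g(1)[OF sub[OF that]]])
    show "continuous_on U (\<lambda>x. g' (f x) (f' x v))" for v
    proof -
      have "continuous_on U (\<lambda>x. (\<Sum>b\<in>Basis. (f' x v \<bullet> b) *\<^sub>R g' (f x) b))"
        by (intro continuous_intros f continuous_on_compose2[OF g(2) cf]) (use sub in auto)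
      then show ?thesis by (rule continuous_on_eq) (simp add: lin)
    qed
  qed
qed

lemma C1_on_inverse:
  fixes f :: "'a::euclidean_space \<Rightarrow> real"
  assumes "C1_on U f" and "\<And>x. x \<in> U \<Longrightarrow> f x \<noteq> 0"
  shows "C1_on U (\<lambda>x. inverse (f x))"
proof (rule C1_on_compose[OF assms(1), where V="- {0}"])
  show "C1_on (- {0::real}) inverse"
    by (rule C1_onI[where f'="\<lambda>x v. - (inverse x * v * inverse x)"])
      (auto intro!: continuous_intros has_derivative_inverse')
qed (use assms in auto)

lemma bounded_bilinear_cross3: "bounded_bilinear (\<times>)"
  using bilinear_cross bilinear_conv_bounded_bilinear by blast

lemmas C1_on_intros = C1_on_const C1_on_id C1_on_add C1_on_diff C1_on_minus C1_on_Pair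
  C1_on_bilinear[OF bounded_bilinear_scaleR] C1_on_bilinear[OF bounded_bilinear_mult]
  C1_on_bilinear[OF bounded_bilinear_inner] C1_on_bilinear[OF bounded_bilinear_cross3]
  C1_on_linear[OF bounded_linear_fst] C1_on_linear[OF bounded_linear_snd]

text \<open>A closed ball inside \<open>U\<close> is compact, so the derivative is bounded there
  through its values on the basis, and convex, so the mean value inequality applies.\<close>

lemma C1_on_local_lipschitz:
  fixes f :: "'a::euclidean_space \<Rightarrow> 'b::euclidean_space"
  assumes "open U" "C1_on U f"
  shows "local_lipschitz T U (\<lambda>_. f)"
proof (rule local_lipschitzI)
  fix t x assume "x \<in> U"
  obtain f' where f: "\<And>x. x \<in> U \<Longrightarrow> (f has_derivative f' x) (at x)" "\<And>v. continuous_on U (\<lambda>x. f' x v)"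
    using C1_onE[OF assms(2)] by blast
  obtain u where u: "u > 0" "cball x u \<subseteq> U" using assms(1) \<open>x \<in> U\<close> open_contains_cball by blast
  have "continuous_on (cball x u) (\<lambda>y. \<Sum>b\<in>Basis. norm (f' y b))"
    using f(2) u(2) by (intro continuous_intros) (meson continuous_on_subset)
  then have "bounded ((\<lambda>y. \<Sum>b\<in>Basis. norm (f' y b)) ` cball x u)"
    using compact_cball compact_continuous_image compact_imp_bounded by blast
  then obtain B where "\<forall>r\<in>(\<lambda>y. \<Sum>b\<in>Basis. norm (f' y b)) ` cball x u. norm r \<le> B"
    unfolding bounded_iff by blast
  then have B: "\<bar>\<Sum>b\<in>Basis. norm (f' y b)\<bar> \<le> B" if "y \<in> cball x u" for y
    using that unfolding real_norm_def by (rule bspec[OF _ imageI])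
  have B0: "B \<ge> 0" using order_trans[OF abs_ge_zero B[of x]] u(1) by simp
  have on: "onorm (f' y) \<le> B" if y: "y \<in> cball x u" for y
  proof (rule onorm_bound[OF B0])
    fix v
    have l: "linear (f' y)" using f(1) u(2) y has_derivative_linear by blast
    have "f' y v = f' y (\<Sum>b\<in>Basis. (v \<bullet> b) *\<^sub>R b)" by (simp add: euclidean_representation)
    also have "\<dots> = (\<Sum>b\<in>Basis. (v \<bullet> b) *\<^sub>R f' y b)" by (simp add: linear_sum[OF l] linear_cmul[OF l] o_def)
    also have "norm \<dots> \<le> (\<Sum>b\<in>Basis. norm (f' y b) * norm v)"
      by (rule sum_norm_le) (simp add: Basis_le_norm mult.commute mult_right_mono)
    also have "\<dots> \<le> B * norm v"
      using B[OF y] by (simp add: sum_distrib_right[symmetric] mult_right_mono)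
    finally show "norm (f' y v) \<le> B * norm v" .
  qed
  have "B-lipschitz_on (cball x u) f"
  proof (rule lipschitz_onI[OF _ B0])
    fix y z assume "y \<in> cball x u" "z \<in> cball x u"
    then show "dist (f y) (f z) \<le> B * dist y z"
      unfolding dist_norm using f(1) u(2) on
      by (intro differentiable_bound[OF convex_cball[of x u]]) (auto intro!: has_derivative_at_withinI[OF f(1)])
  qed
  then show "\<exists>u>0. \<exists>L. \<forall>t\<in>cball t u \<inter> T. L-lipschitz_on (cball x u \<inter> U) f"
    using u(1) lipschitz_on_subset by (metis inf_le1)
qed

text \<open>\<open>C\<close> may fail to be convex, so the mean value inequality yields local
  constants; compactness merges them into one.\<close>

lemma C1_on_lipschitz_compact:
  fixes f :: "'a::euclidean_space \<Rightarrow> 'b::euclidean_space"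
  assumes "open U" "C1_on U f" "compact C" "C \<subseteq> U"
  obtains L where "L-lipschitz_on C f"
proof -
  have "local_lipschitz {0::real} C (\<lambda>_. f)"
    using local_lipschitz_subset[OF C1_on_local_lipschitz[OF assms(1,2)]] assms(4) by blast
  from local_lipschitz_compact_implies_lipschitz[OF this assms(3) compact_sing] that
  show ?thesis by auto
qed

lemma has_vector_derivative_reflect:
  assumes "(f has_vector_derivative d) (at (- s))"
  shows "((\<lambda>s. f (- s)) has_vector_derivative - d) (at s)"
proof -
  have "(uminus has_vector_derivative - 1) (at s)"
    using has_vector_derivative_minus[OF has_vector_derivative_id] by simp
  then show ?thesis using vector_diff_chain_at[of uminus "-1" s f d] assms by (simp add: o_def)
qed

section \<open>Ordinary differential equations with Lipschitz right-hand side\<close>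

lemma gronwall_lipschitz_nonneg:
  fixes x y :: "real \<Rightarrow> 'a::real_inner"
  assumes L: "L-lipschitz_on C X" and t: "0 \<le> t"
    and x: "\<And>s. s \<in> {0..t} \<Longrightarrow> x s \<in> C \<and> (x has_vector_derivative X (x s)) (at s)"
    and y: "\<And>s. s \<in> {0..t} \<Longrightarrow> y s \<in> C \<and> (y has_vector_derivative X (y s)) (at s)"
  shows "norm (x t - y t) \<le> exp (L * t) * norm (x 0 - y 0)"
proof -
  \<comment> \<open>The square of the distance is differentiable even where the two curves meet; the
    factor \<open>exp (- 2 L s)\<close> offsets its maximal growth rate \<open>2 L\<close>.\<close>
  define f where "f s = exp (- (2 * L * s)) * ((x s - y s) \<bullet> (x s - y s))" for s
  have "\<exists>d. (f has_real_derivative d) (at s) \<and> d \<le> 0" if s: "0 \<le> s" "s \<le> t" for s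
  proof -
    have x': "(x has_derivative (\<lambda>h. h *\<^sub>R X (x s))) (at s)" "x s \<in> C"
      and y': "(y has_derivative (\<lambda>h. h *\<^sub>R X (y s))) (at s)" "y s \<in> C"
      using x[of s] y[of s] s by (auto simp: has_vector_derivative_def)
    have "(x s - y s) \<bullet> (X (x s) - X (y s)) \<le> norm (x s - y s) * norm (X (x s) - X (y s))"
      by (rule norm_cauchy_schwarz)
    also have "\<dots> \<le> norm (x s - y s) * (L * norm (x s - y s))"
      using lipschitz_on_normD[OF L x'(2) y'(2)] by (intro mult_left_mono) auto
    finally have le: "(x s - y s) \<bullet> (X (x s) - X (y s)) \<le> L * ((x s - y s) \<bullet> (x s - y s))"
      by (simp add: power2_norm_eq_inner[symmetric] power2_eq_square algebra_simps)
    let ?d = "2 * exp (- (2 * L * s)) * ((x s - y s) \<bullet> (X (x s) - X (y s)) - L * ((x s - y s) \<bullet> (x s - y s)))"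
    have "(f has_derivative (\<lambda>h. h * ?d)) (at s)"
      unfolding f_def
      by (rule derivative_eq_intros x'(1) y'(1) refl)+
        (auto simp: algebra_simps inner_commute inner_diff_left inner_diff_right)
    then have "(f has_real_derivative ?d) (at s)"
      by (rule has_derivative_imp_has_field_derivative) (rule refl)
    moreover have "?d \<le> 0" using le by (intro mult_nonneg_nonpos) auto
    ultimately show ?thesis by blast
  qed
  then have "f t \<le> f 0" by (rule DERIV_nonpos_imp_nonincreasing[OF t])
  then have "exp (2 * L * t) * f t \<le> exp (2 * L * t) * f 0" by (intro mult_left_mono) auto
  moreover have "exp (2 * L * t) * f t = (norm (x t - y t))\<^sup>2"
    by (simp add: f_def power2_norm_eq_inner mult.assoc[symmetric] exp_add[symmetric])
  moreover have "f 0 = (norm (x 0 - y 0))\<^sup>2" by (simp add: f_def power2_norm_eq_inner)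
  ultimately have "(norm (x t - y t))\<^sup>2 \<le> exp (2 * L * t) * (norm (x 0 - y 0))\<^sup>2" by simp
  also have "exp (2 * L * t) = (exp (L * t))\<^sup>2"
    using exp_double[of "L * t"] by (simp add: mult.assoc)
  also have "(exp (L * t))\<^sup>2 * (norm (x 0 - y 0))\<^sup>2 = (exp (L * t) * norm (x 0 - y 0))\<^sup>2"
    by (rule power_mult_distrib[symmetric])
  finally show ?thesis by (rule power2_le_imp_le) simp
qed

lemma gronwall_lipschitz:
  fixes x y :: "real \<Rightarrow> 'a::real_inner"
  assumes L: "L-lipschitz_on C X"
    and x: "\<And>s. s \<in> closed_segment 0 t \<Longrightarrow> x s \<in> C \<and> (x has_vector_derivative X (x s)) (at s)"
    and y: "\<And>s. s \<in> closed_segment 0 t \<Longrightarrow> y s \<in> C \<and> (y has_vector_derivative X (y s)) (at s)"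
  shows "norm (x t - y t) \<le> exp (L * \<bar>t\<bar>) * norm (x 0 - y 0)"
proof (cases "t \<ge> 0")
  case True
  then show ?thesis
    using gronwall_lipschitz_nonneg[OF L True, of x y] x y by (simp add: closed_segment_eq_real_ivl)
next
  case False
  have seg: "- s \<in> closed_segment 0 t" if "s \<in> {0..- t}" for s
    using that False by (auto simp: closed_segment_eq_real_ivl)
  have "norm (x (- (- t)) - y (- (- t))) \<le> exp (L * (- t)) * norm (x (- 0) - y (- 0))"
  proof (rule gronwall_lipschitz_nonneg[of L C "\<lambda>z. - X z"])
    show "L-lipschitz_on C (\<lambda>z. - X z)" using L by simp
    show "x (- s) \<in> C \<and> ((\<lambda>s. x (- s)) has_vector_derivative - X (x (- s))) (at s)" if "s \<in> {0..- t}" for s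
      using x[OF seg[OF that]] has_vector_derivative_reflect[of x] by blast
    show "y (- s) \<in> C \<and> ((\<lambda>s. y (- s)) has_vector_derivative - X (y (- s))) (at s)" if "s \<in> {0..- t}" for s
      using y[OF seg[OF that]] has_vector_derivative_reflect[of y] by blast
  qed (use False in auto)
  then show ?thesis using False by simp
qed

text \<open>Over the segment from 0 to \<open>t\<close> both curves sweep out one compact subset of
  \<open>U\<close>, on which \<open>X\<close> has a Lipschitz constant; Gronwall with equal initial
  values gives distance 0.\<close>

lemma C1_flow_unique:
  fixes x y :: "real \<Rightarrow> 'a::euclidean_space"
  assumes "open U" "C1_on U X" "is_interval J" "0 \<in> J" "t \<in> J"
    and x: "\<And>s. s \<in> J \<Longrightarrow> x s \<in> U \<and> (x has_vector_derivative X (x s)) (at s)"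
    and y: "\<And>s. s \<in> J \<Longrightarrow> y s \<in> U \<and> (y has_vector_derivative X (y s)) (at s)"
    and "x 0 = y 0"
  shows "x t = y t"
proof -
  let ?S = "closed_segment 0 t"
  have SJ: "?S \<subseteq> J" using closed_segment_subset[OF assms(4,5) is_interval_convex[OF assms(3)]] .
  have "continuous_on ?S x" "continuous_on ?S y"
    by (rule continuous_at_imp_continuous_on, use SJ x y has_vector_derivative_continuous in blast)+
  then have "compact (x ` ?S \<union> y ` ?S)"
    by (intro compact_Un compact_continuous_image) auto
  moreover have "x ` ?S \<union> y ` ?S \<subseteq> U" using SJ x y by auto
  ultimately obtain L where "L-lipschitz_on (x ` ?S \<union> y ` ?S) X"
    by (rule C1_on_lipschitz_compact[OF assms(1,2)])
  then have "norm (x t - y t) \<le> exp (L * \<bar>t\<bar>) * norm (x 0 - y 0)"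
    by (rule gronwall_lipschitz) (use SJ x y in auto)
  then show ?thesis using \<open>x 0 = y 0\<close> by simp
qed

text \<open>Integrating \<open>exp (a \<bar>s\<bar>)\<close> gains the factor \<open>1 / a\<close>.
  With \<open>a\<close> twice the Lipschitz constant this gain is what makes Picard iteration a
  contraction with factor 1/2 on the whole line.\<close>

lemma exp_primitive_bound:
  fixes G :: "real \<Rightarrow> 'a::euclidean_space"
  assumes G: "\<And>s. (G has_vector_derivative g s) (at s)" and g: "\<And>s. norm (g s) \<le> C * exp (a * \<bar>s\<bar>)"
    and "a > 0" "C \<ge> 0"
  shows "norm (G t - G 0) \<le> C / a * exp (a * \<bar>t\<bar>)"
proof -
  have pos: "norm (G t - G 0) \<le> C / a * exp (a * t)"
    if t: "t \<ge> 0" and G: "\<And>s. (G has_vector_derivative g s) (at s)" and g: "\<And>s. norm (g s) \<le> C * exp (a * \<bar>s\<bar>)"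
    for G g :: "real \<Rightarrow> 'a" and t
  proof (cases "t = 0")
    case False
    have "norm (G t - G 0) \<le> C / a * exp (a * t) - C / a * exp (a * 0)"
    proof (rule differentiable_bound_general[where f'=g and \<phi>'="\<lambda>s. C * exp (a * s)"])
      show "continuous_on {0..t} G"
        by (meson G continuous_at_imp_continuous_on has_vector_derivative_continuous)
      show "norm (g s) \<le> C * exp (a * s)" if "0 < s" "s < t" for s using g[of s] that by simp
      show "((\<lambda>t. C / a * exp (a * t)) has_vector_derivative C * exp (a * s)) (at s)" for s
        using \<open>a > 0\<close>
        by (auto intro!: derivative_eq_intros simp: has_real_derivative_iff_has_vector_derivative[symmetric])
    qed (use False t \<open>a > 0\<close> in \<open>auto intro!: continuous_intros G\<close>)
    moreover have "C / a \<ge> 0" using assms by simp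
    ultimately show ?thesis by simp
  qed (use assms in auto)
  show ?thesis
  proof (cases "t \<ge> 0")
    case True
    then show ?thesis using pos[OF True G g] by simp
  next
    case False
    have "((\<lambda>s. G (- s)) has_vector_derivative - g (- s)) (at s)" for s
      by (rule has_vector_derivative_reflect[OF G])
    moreover have "norm (- g (- s)) \<le> C * exp (a * \<bar>s\<bar>)" for s using g[of "- s"] by simp
    ultimately have "norm (G (- (- t)) - G (- 0)) \<le> C / a * exp (a * (- t))"
      using False by (intro pos) auto
    then show ?thesis using False by simp
  qed
qed

text \<open>Picard iteration contracts in the weighted norm \<open>sup exp (-2 L \<bar>t\<bar>) \<bar>x t - x 0\<bar>\<close>, so it yields
  solutions on the whole line at once.\<close>

lemma picard_global:
  fixes X :: "'a::euclidean_space \<Rightarrow> 'a"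
  assumes "L-lipschitz_on UNIV X"
  obtains x where "x 0 = z" "\<And>t. (x has_vector_derivative X (x t)) (at t)"
proof -
  \<comment> \<open>Adding 1 makes the constant positive, so that \<open>2 * M\<close> can serve as
    a rate and as a divisor.\<close>
  define M where "M = L + 1"
  have M: "M-lipschitz_on UNIV X" "M > 0"
    using lipschitz_on_mono[OF assms, of UNIV M] lipschitz_on_nonneg[OF assms] by (auto simp: M_def)
  have cX: "continuous_on UNIV X" using M(1) lipschitz_on_continuous_on by blast
  define w where "w t = exp (2 * M * \<bar>t\<bar>)" for t :: real
  have w0: "w t > 0" for t by (simp add: w_def)
  \<comment> \<open>The unknown \<open>f\<close> is the rescaled displacement
    \<open>(x - z) / w\<close>. It ranges over bounded continuous functions, a complete
    space.\<close>
  define g where "g f s = X (z + w s *\<^sub>R apply_bcontfun f s)" for f :: "real \<Rightarrow>\<^sub>C 'a" and s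
  define G where "G f t = (LBINT s=0..ereal t. g f s)" for f t
  have cg: "continuous_on UNIV (g f)" for f
    unfolding g_def w_def by (intro continuous_on_compose2[OF cX] continuous_intros) auto
  have G': "(G f has_vector_derivative g f t) (at t)" for f t
  proof -
    \<comment> \<open>The interval contains 0 and has \<open>t\<close> in its interior, so the
      one-sided fundamental theorem yields a derivative at \<open>t\<close> proper.\<close>
    let ?n = "\<bar>t\<bar> + 1"
    have "(G f has_vector_derivative g f t) (at t within {- ?n..?n})"
      unfolding G_def using continuous_on_subset[OF cg] interval_integral_FTC2[of "- ?n" 0 ?n "g f" t]
      by (auto simp: zero_ereal_def)
    moreover have "at t within {- ?n..?n} = at t"
      by (rule at_within_interior) (auto simp: interior_atLeastAtMost_real)
    ultimately show ?thesis by simp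
  qed
  have G0: "G f 0 = 0" for f by (simp add: G_def zero_ereal_def)
  have gb: "norm (g f s) \<le> (norm (X z) + M * norm f) * exp (2 * M * \<bar>s\<bar>)" for f s
  proof -
    have "norm (g f s) \<le> norm (X z) + norm (g f s - X z)"
      by (metis diff_add_cancel norm_triangle_ineq add.commute)
    also have "norm (g f s - X z) \<le> M * norm (w s *\<^sub>R apply_bcontfun f s)"
      using lipschitz_on_normD[OF M(1), of "z + w s *\<^sub>R apply_bcontfun f s" z] by (simp add: g_def)
    also have "\<dots> \<le> M * (w s * norm f)"
      using M(2) w0[of s] norm_bounded[of f s] by (simp add: mult_left_mono)
    also have "norm (X z) \<le> norm (X z) * w s" using M(2) mult_left_mono[of 1 "w s" "norm (X z)"] by (simp add: w_def)
    finally show ?thesis by (simp add: w_def algebra_simps)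
  qed
  define T where "T f = Bcontfun (\<lambda>t. inverse (w t) *\<^sub>R G f t)" for f
  have Tb: "(\<lambda>t. inverse (w t) *\<^sub>R G f t) \<in> bcontfun" for f
  proof (rule bcontfun_normI)
    show "continuous_on UNIV (\<lambda>t. inverse (w t) *\<^sub>R G f t)"
      unfolding w_def
      by (intro continuous_intros continuous_at_imp_continuous_on ballI has_vector_derivative_continuous[OF G']) auto
    fix t
    have "norm (G f t - G f 0) \<le> (norm (X z) + M * norm f) / (2 * M) * exp ((2 * M) * \<bar>t\<bar>)"
      using M(2) by (intro exp_primitive_bound[OF G' gb]) auto
    then have "norm (G f t) \<le> (norm (X z) + M * norm f) / (2 * M) * w t" by (simp add: G0 w_def)
    then show "norm (inverse (w t) *\<^sub>R G f t) \<le> (norm (X z) + M * norm f) / (2 * M)"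
      using w0[of t] by (simp add: field_simps)
  qed
  have Ta: "apply_bcontfun (T f) t = inverse (w t) *\<^sub>R G f t" for f t
    using Tb by (simp add: T_def Bcontfun_inverse)
  have contr: "dist (T f) (T h) \<le> 1/2 * dist f h" for f h
  proof (rule dist_bound)
    fix t
    have "norm (g f s - g h s) \<le> M * dist f h * exp (2 * M * \<bar>s\<bar>)" for s
    proof -
      have "norm (g f s - g h s) \<le> M * norm (w s *\<^sub>R (apply_bcontfun f s - apply_bcontfun h s))"
        using lipschitz_on_normD[OF M(1), of "z + w s *\<^sub>R apply_bcontfun f s" "z + w s *\<^sub>R apply_bcontfun h s"]
        by (simp add: g_def scaleR_diff_right)
      also have "\<dots> \<le> M * (w s * dist f h)"
        using M(2) w0[of s] dist_bounded[of f s h] by (simp add: mult_left_mono dist_norm)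
      finally show ?thesis by (simp add: w_def mult_ac)
    qed
    then have "norm ((G f t - G h t) - (G f 0 - G h 0)) \<le> (M * dist f h) / (2 * M) * exp ((2 * M) * \<bar>t\<bar>)"
      using M(2) by (intro exp_primitive_bound[where g="\<lambda>s. g f s - g h s"] has_vector_derivative_diff G') auto
    then have "norm (G f t - G h t) \<le> 1/2 * dist f h * w t"
      using M(2) by (simp add: G0 w_def[symmetric])
    moreover have "dist (apply_bcontfun (T f) t) (apply_bcontfun (T h) t) = inverse (w t) * norm (G f t - G h t)"
      using w0[of t] by (simp add: Ta dist_norm scaleR_diff_right[symmetric])
    ultimately have "w t * dist (apply_bcontfun (T f) t) (apply_bcontfun (T h) t) \<le> w t * (1/2 * dist f h)"
      using w0[of t] by (simp add: field_simps)
    then show "dist (apply_bcontfun (T f) t) (apply_bcontfun (T h) t) \<le> 1/2 * dist f h"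
      using w0[of t] mult_le_cancel_left_pos by blast
  qed
  obtain f where f: "T f = f" using banach_fix_type[of "1/2" T] contr by auto
  have eq: "z + w t *\<^sub>R apply_bcontfun f t = z + G f t" for t
    using Ta[of f t] w0[of t] by (simp add: f)
  show ?thesis
  proof (rule that[of "\<lambda>t. z + G f t"])
    show "((\<lambda>t. z + G f t) has_vector_derivative X (z + G f t)) (at t)" for t
      using has_vector_derivative_add[OF has_vector_derivative_const G'[of f t], of z]
      by (simp add: g_def eq)
  qed (simp add: G0)
qed

text \<open>Multiplying by a cutoff gives a field on the whole space for which solutions and Euler
  steps exist globally. Near \<open>C\<close> nothing has changed, so curves that stay in
  \<open>C\<close> do not notice the replacement.\<close>

lemma C1_lipschitz_cutoff:
  fixes X :: "'a::euclidean_space \<Rightarrow> 'a"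
  assumes "open U" "C1_on U X" "compact C" "C \<subseteq> U"
  obtains Y L B V where "L-lipschitz_on UNIV Y" "\<And>z. norm (Y z) \<le> B" "open V" "C \<subseteq> V" "V \<subseteq> U"
    "\<And>z. z \<in> V \<Longrightarrow> Y z = X z"
proof (cases "C = {}")
  \<comment> \<open>\<open>infdist\<close> to the empty set is 0 by convention, which would make the
    cutoff below constantly 1; the zero field with empty \<open>V\<close> is used instead.\<close>
  case True
  show ?thesis
  proof (rule that)
    show "0-lipschitz_on UNIV (\<lambda>_::'a. 0::'a)" by (rule lipschitz_on_constant)
    show "norm (0::'a) \<le> 0" by (rule eq_refl[OF norm_zero])
    show "open ({}::'a set)" by (rule open_empty)
    show "C \<subseteq> {}" using True by blast
    show "{} \<subseteq> U" by blast
    show "0 = X z" if "z \<in> {}" for z using that by blast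
  qed
next
  case False
  obtain e where e: "e > 0" "(\<Union>x\<in>C. cball x e) \<subseteq> U"
    using compact_subset_open_imp_cball_epsilon_subset[OF assms(3,1,4)] by metis
  define N where "N = {y. infdist y C \<le> e}"
  have NU: "N \<subseteq> U"
  proof
    fix y assume "y \<in> N"
    obtain x where "x \<in> C" "infdist y C = dist y x"
      by (rule infdist_attains_inf[OF compact_imp_closed[OF assms(3)] False])
    moreover have "infdist y C \<le> e" using \<open>y \<in> N\<close> by (simp add: N_def)
    ultimately have "y \<in> (\<Union>x\<in>C. cball x e)" by (auto simp: dist_commute)
    then show "y \<in> U" using e(2) by blast
  qed
  have cN: "compact N"
    unfolding N_def by (rule compact_infdist_le[OF False assms(3) e(1)])
  obtain L where L: "L-lipschitz_on N X" by (rule C1_on_lipschitz_compact[OF assms(1,2) cN NU])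
  have "bounded (X ` N)"
    by (rule compact_imp_bounded[OF compact_continuous_image[OF lipschitz_on_continuous_on[OF L] cN]])
  then obtain B where B: "B > 0" "\<And>z. z \<in> N \<Longrightarrow> norm (X z) \<le> B"
    unfolding bounded_pos by auto
  \<comment> \<open>Equal to 1 up to distance \<open>e / 2\<close> from \<open>C\<close> and to 0
    from distance \<open>e\<close> on, with slope \<open>2 / e\<close> in between.\<close>
  define c where "c z = max 0 (min 1 (2 - 2 * infdist z C / e))" for z
  have c01: "0 \<le> c z" "c z \<le> 1" for z by (auto simp: c_def)
  have cz: "c z = 0" if "z \<notin> N" for z using that e(1) by (auto simp: c_def N_def field_simps)
  have cl: "\<bar>c y - c z\<bar> \<le> 2 / e * dist y z" for y z
  proof -
    have "\<bar>c y - c z\<bar> \<le> \<bar>2 * infdist y C / e - 2 * infdist z C / e\<bar>" unfolding c_def by linarith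
    also have "2 * infdist y C / e - 2 * infdist z C / e = 2 / e * (infdist y C - infdist z C)"
      by (simp add: right_diff_distrib diff_divide_distrib)
    also have "\<bar>\<dots>\<bar> = 2 / e * \<bar>infdist y C - infdist z C\<bar>"
      using e(1) by (subst abs_mult) simp
    also have "\<dots> \<le> 2 / e * dist y z"
      using e(1) infdist_triangle_abs[of y C z] by (intro mult_left_mono) auto
    finally show ?thesis .
  qed
  have L0: "L \<ge> 0" using L lipschitz_on_nonneg by blast
  let ?Y = "\<lambda>z. c z *\<^sub>R X z"
  let ?M = "2 / e * B + L"
  \<comment> \<open>Only \<open>y\<close> is required to lie in \<open>N\<close>. If
    \<open>z\<close> lies outside, the cut-off field vanishes at \<open>z\<close>, and the Lipschitz
    bound of \<open>c\<close> together with the bound on \<open>X y\<close> suffices.\<close>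
  have one: "norm (?Y y - ?Y z) \<le> ?M * norm (y - z)" if y: "y \<in> N" for y z
  proof (cases "z \<in> N")
    case True
    have "?Y y - ?Y z = (c y - c z) *\<^sub>R X y + c z *\<^sub>R (X y - X z)" by (simp add: algebra_simps)
    then have "norm (?Y y - ?Y z) \<le> \<bar>c y - c z\<bar> * norm (X y) + c z * norm (X y - X z)"
      using norm_triangle_ineq[of "(c y - c z) *\<^sub>R X y" "c z *\<^sub>R (X y - X z)"] c01[of z] by simp
    also have "\<dots> \<le> (2 / e * norm (y - z)) * B + 1 * (L * norm (y - z))"
      using cl[of y z] B y e(1) c01[of z] lipschitz_on_normD[OF L y True]
      by (intro add_mono mult_mono) (auto simp: dist_norm)
    finally show ?thesis by (simp add: algebra_simps)
  next
    case False
    have "norm (?Y y - ?Y z) = \<bar>c y - c z\<bar> * norm (X y)" by (simp add: cz[OF False])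
    also have "\<dots> \<le> (2 / e * norm (y - z)) * B"
      using cl[of y z] B y e(1) by (intro mult_mono) (auto simp: dist_norm)
    also have "\<dots> \<le> ?M * norm (y - z)" using L0 by (simp add: algebra_simps)
    finally show ?thesis .
  qed
  have M0: "?M \<ge> 0" using e(1) B(1) L0 by simp
  show ?thesis
  proof (rule that)
    show "?M-lipschitz_on UNIV ?Y"
    proof (rule lipschitz_onI[OF _ M0])
      fix y z
      show "dist (?Y y) (?Y z) \<le> ?M * dist y z"
      proof (cases "y \<in> N \<or> z \<in> N")
        case True
        then show ?thesis using one[of y z] one[of z y] by (auto simp: dist_norm norm_minus_commute)
      next
        case False
        then show ?thesis using M0 by (simp add: cz)
      qed
    qed
    show "norm (?Y z) \<le> B" for z
    proof (cases "z \<in> N")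
      case True
      then show ?thesis using mult_mono[OF c01(2)[of z] B(2)[OF True]] c01[of z] B(1) by simp
    qed (use B in \<open>simp add: cz\<close>)
    show "open {z. infdist z C < e / 2}"
      by (intro open_Collect_less continuous_intros)
    show "C \<subseteq> {z. infdist z C < e / 2}" using e(1) by (auto simp: infdist_zero)
    show "{z. infdist z C < e / 2} \<subseteq> U" using NU e(1) by (auto simp: N_def)
    show "?Y z = X z" if "z \<in> {z. infdist z C < e / 2}" for z
      using that e(1) by (auto simp: c_def field_simps min_def)
  qed
qed

section \<open>Change of variables for nonnegative integrands\<close>

text \<open>The equivalence \<open>has_measure_differentiable_image\<close> speaks of finite values
  in both directions: a finite integral gives the image that measure, and a finite measure of the
  image makes the integral finite. Hence the two sides are also infinite together, and the formula
  holds in \<open>ennreal\<close>.\<close>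

lemma emeasure_differentiable_image:
  fixes f :: "real^'n::{finite,wellorder} \<Rightarrow> real^'n::_"
  assumes T: "T \<in> sets borel"
    and f': "\<And>x. x \<in> T \<Longrightarrow> (f has_derivative f' x) (at x within T)"
    and inj: "inj_on f T"
    and J: "(\<lambda>x. indicator T x * \<bar>det (matrix (f' x))\<bar>) \<in> borel_measurable borel"
  shows "f ` T \<in> sets lebesgue"
    and "emeasure lebesgue (f ` T) = (\<integral>\<^sup>+x. ennreal (indicator T x * \<bar>det (matrix (f' x))\<bar>) \<partial>lborel)"
proof -
  let ?d = "\<lambda>x. \<bar>det (matrix (f' x))\<bar>"
  have T': "T \<in> sets lebesgue" using T by simp
  show fT: "f ` T \<in> sets lebesgue"
    using T' f' by (intro differentiable_image_in_sets_lebesgue) (auto simp: differentiable_on_def differentiable_def)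
  note eq = has_measure_differentiable_image[OF T' f' inj]
  let ?I = "\<integral>\<^sup>+x. ennreal (indicator T x * ?d x) \<partial>lborel"
  show "emeasure lebesgue (f ` T) = ?I"
  proof (cases "?I = \<infinity>")
    case True
    have "emeasure lebesgue (f ` T) = \<infinity>"
    proof (rule ccontr)
      assume "emeasure lebesgue (f ` T) \<noteq> \<infinity>"
      then have "f ` T \<in> lmeasurable" using fT by (simp add: fmeasurable_def top.not_eq_extremum)
      then have "(?d has_integral measure lebesgue (f ` T)) T" using eq[of "measure lebesgue (f ` T)"] by auto
      then have "integral\<^sup>N lborel (\<lambda>x. ennreal (?d x) * indicator T x) = ennreal (measure lebesgue (f ` T))"
        by (intro nn_integral_has_integral_lebesgue') auto
      moreover have "(\<lambda>x. ennreal (?d x) * indicator T x) = (\<lambda>x. ennreal (indicator T x * ?d x))"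
        by (auto simp: indicator_def)
      ultimately show False using True by simp
    qed
    then show ?thesis using True by simp
  next
    case False
    then obtain r where r: "r \<ge> 0" "?I = ennreal r" by (cases ?I) auto
    have "((\<lambda>x. indicator T x * ?d x) has_integral r) UNIV"
      using r J by (intro nn_integral_has_integral) auto
    then have "((\<lambda>x. if x \<in> T then ?d x else 0) has_integral r) UNIV"
      by (rule has_integral_eq[rotated]) (auto simp: indicator_def)
    then have "(?d has_integral r) T" by (simp add: has_integral_restrict_UNIV)
    then have "f ` T \<in> lmeasurable \<and> measure lebesgue (f ` T) = r" using eq by blast
    then show ?thesis using r by (simp add: emeasure_eq_measure2)
  qed
qed

text \<open>Both sides integrate \<open>g\<close> against a measure: Lebesgue measure on the image,
  and the push-forward of the Jacobian density. The two agree on a Borel set \<open>A\<close> by the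
  image formula for the part of \<open>S\<close> that \<open>f\<close> sends into
  \<open>A\<close>.\<close>

lemma nn_integral_change_of_variables_cart:
  fixes f :: "real^'n::{finite,wellorder} \<Rightarrow> real^'n::_" and g :: "real^'n::_ \<Rightarrow> ennreal"
  assumes S: "S \<in> sets borel"
    and f': "\<And>x. x \<in> S \<Longrightarrow> (f has_derivative f' x) (at x within S)"
    and inj: "inj_on f S"
    and J: "(\<lambda>x. indicator S x * \<bar>det (matrix (f' x))\<bar>) \<in> borel_measurable borel"
    and fS: "f ` S \<in> sets borel"
    and g[measurable]: "g \<in> borel_measurable borel"
  shows "(\<integral>\<^sup>+y. g y * indicator (f ` S) y \<partial>lborel) =
    (\<integral>\<^sup>+x. g (f x) * ennreal (indicator S x * \<bar>det (matrix (f' x))\<bar>) \<partial>lborel)"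
proof -
  let ?d = "\<lambda>x. \<bar>det (matrix (f' x))\<bar>"
  \<comment> \<open>Extension to a Borel map on the whole space; the value 0 off \<open>S\<close> is
    never seen, as the density vanishes there.\<close>
  define F where "F x = (if x \<in> S then f x else 0)" for x
  have [measurable]: "S \<in> sets borel" "f ` S \<in> sets borel" "(\<lambda>x. indicator S x * ?d x) \<in> borel_measurable borel"
    using S fS J by auto
  have cf: "continuous_on S f" by (rule has_derivative_continuous_on[OF f'])
  have F[measurable]: "F \<in> borel_measurable borel"
    unfolding F_def by (rule borel_measurable_continuous_on_if[OF S cf]) auto
  have meq: "density lborel (indicator (f ` S)) =
      distr (density lborel (\<lambda>x. ennreal (indicator S x * ?d x))) borel F" (is "?N1 = ?N2")
  proof (rule measure_eqI)
    show "sets ?N1 = sets ?N2" by simp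
    fix A assume "A \<in> sets ?N1"
    then have A[measurable]: "A \<in> sets borel" by simp
    define T where "T = S \<inter> F -` A"
    have T[measurable]: "T \<in> sets borel" unfolding T_def
      using measurable_sets[OF F A] by (intro sets.Int S) simp
    have TS: "T \<subseteq> S" by (auto simp: T_def)
    have "f ` T = A \<inter> f ` S" by (auto simp: T_def F_def)
    have eqT: "indicator T x * ?d x = indicator T x * (indicator S x * ?d x)" for x
      using TS by (auto simp: indicator_def)
    have JT: "(\<lambda>x. indicator T x * ?d x) \<in> borel_measurable borel"
      unfolding eqT by measurable
    have "emeasure ?N1 A = (\<integral>\<^sup>+x. indicator (f ` S) x * indicator A x \<partial>lborel)"
      by (simp add: emeasure_density)
    also have "\<dots> = (\<integral>\<^sup>+x. indicator (A \<inter> f ` S) x \<partial>lborel)"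
      by (intro nn_integral_cong) (auto simp: indicator_def)
    also have "\<dots> = emeasure lborel (A \<inter> f ` S)" by simp
    also have "\<dots> = emeasure lebesgue (f ` T)" by (simp add: \<open>f ` T = A \<inter> f ` S\<close>)
    also have "\<dots> = (\<integral>\<^sup>+x. ennreal (indicator T x * ?d x) \<partial>lborel)"
    proof (rule emeasure_differentiable_image(2)[OF T _ inj_on_subset[OF inj TS] JT])
      show "(f has_derivative f' x) (at x within T)" if "x \<in> T" for x
        using f'[of x] TS that has_derivative_subset by blast
    qed
    also have "\<dots> = (\<integral>\<^sup>+x. ennreal (indicator S x * ?d x) * indicator (F -` A) x \<partial>lborel)"
      by (intro nn_integral_cong) (auto simp: indicator_def T_def)
    also have "\<dots> = emeasure (density lborel (\<lambda>x. ennreal (indicator S x * ?d x))) (F -` A)"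
      using measurable_sets[OF F A] by (simp add: emeasure_density)
    also have "\<dots> = emeasure ?N2 A" by (simp add: emeasure_distr)
    finally show "emeasure ?N1 A = emeasure ?N2 A" .
  qed
  have "(\<integral>\<^sup>+y. g y * indicator (f ` S) y \<partial>lborel) = integral\<^sup>N ?N1 g"
    by (simp add: nn_integral_density mult.commute)
  also have "\<dots> = (\<integral>\<^sup>+x. ennreal (indicator S x * ?d x) * g (F x) \<partial>lborel)"
    unfolding meq by (simp add: nn_integral_distr nn_integral_density)
  also have "\<dots> = (\<integral>\<^sup>+x. g (f x) * ennreal (indicator S x * ?d x) \<partial>lborel)"
    by (intro nn_integral_cong) (auto simp: F_def indicator_def mult.commute)
  finally show ?thesis .
qed

text \<open>A linear bijection between standard bases identifies a product space such as
  \<open>phase\<close> with a Cartesian power. It transports inner products, Lebesgue measure and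
  traces, which is all that determinants and volumes require.\<close>

lemma basis_isometry_inner:
  fixes L :: "'a::euclidean_space \<Rightarrow> 'b::euclidean_space"
  assumes L: "linear L" "bij_betw L Basis Basis"
  shows "L x \<bullet> L y = x \<bullet> y"
proof -
  have ib: "L x \<bullet> L b = x \<bullet> b" if b: "b \<in> Basis" for x b
  proof -
    have "L x = (\<Sum>c\<in>Basis. (x \<bullet> c) *\<^sub>R L c)"
      using arg_cong[OF euclidean_representation[of x, symmetric], of L]
      by (simp add: linear_sum[OF L(1)] linear_cmul[OF L(1)])
    then have "L x \<bullet> L b = (\<Sum>c\<in>Basis. (x \<bullet> c) * (L c \<bullet> L b))" by (simp add: inner_sum_left)
    also have "\<dots> = (\<Sum>c\<in>Basis. if c = b then x \<bullet> c else 0)"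
    proof (rule sum.cong)
      fix c :: 'a assume c: "c \<in> Basis"
      have "L c \<in> Basis" "L b \<in> Basis" "L c = L b \<longleftrightarrow> c = b"
        using L(2) b c by (auto simp: bij_betw_def inj_on_def)
      then show "(x \<bullet> c) * (L c \<bullet> L b) = (if c = b then x \<bullet> c else 0)" by (simp add: inner_Basis)
    qed simp
    finally show ?thesis using b by simp
  qed
  have "L y = (\<Sum>c\<in>Basis. (y \<bullet> c) *\<^sub>R L c)"
    using arg_cong[OF euclidean_representation[of y, symmetric], of L]
    by (simp add: linear_sum[OF L(1)] linear_cmul[OF L(1)])
  then have "L x \<bullet> L y = (\<Sum>c\<in>Basis. (y \<bullet> c) * (x \<bullet> c))" by (simp add: inner_sum_right ib)
  also have "\<dots> = x \<bullet> y" by (simp add: euclidean_inner[of x y] mult.commute)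
  finally show ?thesis .
qed

lemma basis_isometry_bij:
  fixes L :: "'a::euclidean_space \<Rightarrow> 'b::euclidean_space"
  assumes L: "linear L" "bij_betw L Basis Basis"
  shows "bij L"
proof (rule bijI)
  show "inj L"
    unfolding linear_injective_0[OF L(1)]
    using basis_isometry_inner[OF L] by (metis inner_eq_zero_iff inner_zero_left)
  show "surj L"
  proof (rule surjI)
    fix y
    have "L (\<Sum>b\<in>Basis. (y \<bullet> L b) *\<^sub>R b) = (\<Sum>b\<in>Basis. (y \<bullet> L b) *\<^sub>R L b)"
      by (simp add: linear_sum[OF L(1)] linear_cmul[OF L(1)])
    also have "\<dots> = (\<Sum>c\<in>Basis. (y \<bullet> c) *\<^sub>R c)"
      by (rule sum.reindex_bij_betw[OF L(2)])
    finally show "L (\<Sum>b\<in>Basis. (y \<bullet> L b) *\<^sub>R b) = y" by (simp add: euclidean_representation)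
  qed
qed

text \<open>The preimage of a coordinate box is a coordinate box with the same side lengths, merely
  listed in another order.\<close>

lemma distr_lborel_basis_isometry:
  fixes L :: "'a::euclidean_space \<Rightarrow> 'b::euclidean_space"
  assumes L: "linear L" "bij_betw L Basis Basis"
  shows "distr lborel borel L = lborel"
proof (rule lborel_eqI[symmetric])
  have [measurable]: "L \<in> borel_measurable borel"
    using L(1) by (simp add: borel_measurable_continuous_onI linear_continuous_on linear_linear)
  fix l u :: 'b assume lu: "\<And>b. b \<in> Basis \<Longrightarrow> l \<bullet> b \<le> u \<bullet> b"
  define p where "p y = (\<Sum>b\<in>Basis. (y \<bullet> L b) *\<^sub>R b)" for y :: 'b
  have p: "p y \<bullet> b = y \<bullet> L b" if "b \<in> Basis" for y b using that by (simp add: p_def)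
  have LB: "L ` Basis = Basis" using L(2) by (simp add: bij_betw_def)
  have "L -` box l u = box (p l) (p u)"
  proof (rule set_eqI)
    fix x
    have "x \<in> L -` box l u \<longleftrightarrow> (\<forall>b\<in>Basis. l \<bullet> L b < L x \<bullet> L b \<and> L x \<bullet> L b < u \<bullet> L b)"
      by (simp add: mem_box LB[symmetric])
    then show "x \<in> L -` box l u \<longleftrightarrow> x \<in> box (p l) (p u)"
      by (simp add: basis_isometry_inner[OF L] mem_box p)
  qed
  then have "emeasure (distr lborel borel L) (box l u) = emeasure lborel (box (p l) (p u))"
    by (simp add: emeasure_distr)
  also have "\<dots> = (\<Prod>b\<in>Basis. (p u - p l) \<bullet> b)"
    using lu LB by (subst emeasure_lborel_box) (auto simp: p)
  also have "\<dots> = (\<Prod>b\<in>Basis. (u - l) \<bullet> L b)" by (simp add: inner_diff_left p)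
  also have "\<dots> = (\<Prod>b\<in>Basis. (u - l) \<bullet> b)"
    by (subst prod.reindex_bij_betw[OF L(2), symmetric]) (rule refl)
  finally show "emeasure (distr lborel borel L) (box l u) = (\<Prod>b\<in>Basis. (u - l) \<bullet> b)" .
qed simp

lemma nn_integral_lborel_basis_isometry:
  fixes L :: "'a::euclidean_space \<Rightarrow> 'b::euclidean_space"
  assumes L: "linear L" "bij_betw L Basis Basis" and [measurable]: "g \<in> borel_measurable borel"
  shows "(\<integral>\<^sup>+x. g (L x) \<partial>lborel) = (\<integral>\<^sup>+y. g y \<partial>lborel)"
proof -
  have [measurable]: "L \<in> borel_measurable borel"
    using L(1) by (simp add: borel_measurable_continuous_onI linear_continuous_on linear_linear)
  have "(\<integral>\<^sup>+y. g y \<partial>lborel) = integral\<^sup>N (distr lborel borel L) g"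
    by (simp add: distr_lborel_basis_isometry[OF L])
  then show ?thesis by (simp add: nn_integral_distr)
qed

text \<open>The library's change of variables is for Cartesian powers only; \<open>\<iota>\<close> transfers it.\<close>

lemma nn_integral_change_of_variables:
  fixes \<psi> :: "'a::euclidean_space \<Rightarrow> 'a" and \<iota> :: "'a \<Rightarrow> real^'n::{finite,wellorder}"
  assumes \<iota>: "linear \<iota>" "bij_betw \<iota> Basis Basis"
    and S: "S \<in> sets borel"
    and \<psi>': "\<And>x. x \<in> S \<Longrightarrow> (\<psi> has_derivative \<psi>' x) (at x within S)"
    and inj: "inj_on \<psi> S"
    and J: "(\<lambda>x. indicator S x * \<bar>det (matrix (\<iota> \<circ> \<psi>' x \<circ> inv \<iota>))\<bar>) \<in> borel_measurable borel"
    and \<psi>S: "\<psi> ` S \<in> sets borel"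
    and g[measurable]: "g \<in> borel_measurable borel"
  shows "(\<integral>\<^sup>+y. g y * indicator (\<psi> ` S) y \<partial>lborel) =
    (\<integral>\<^sup>+x. g (\<psi> x) * ennreal (indicator S x * \<bar>det (matrix (\<iota> \<circ> \<psi>' x \<circ> inv \<iota>))\<bar>) \<partial>lborel)"
proof -
  let ?k = "inv \<iota>"
  have bij: "bij \<iota>" by (rule basis_isometry_bij[OF \<iota>])
  have ki[simp]: "?k (\<iota> x) = x" "\<iota> (?k y) = y" for x y
    using bij by (auto simp: bij_def surj_f_inv_f)
  have k1: "linear ?k"
  proof (rule linearI)
    show "?k (x + y) = ?k x + ?k y" for x y
      using ki(1)[of "?k x + ?k y"] by (simp add: linear_add[OF \<iota>(1)])
    show "?k (c *\<^sub>R x) = c *\<^sub>R ?k x" for c x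
      using ki(1)[of "c *\<^sub>R ?k x"] by (simp add: linear_cmul[OF \<iota>(1)])
  qed
  have "\<iota> ` Basis = Basis" using \<iota>(2) by (simp add: bij_betw_def)
  moreover have "?k ` \<iota> ` Basis = Basis" by (simp add: image_image)
  ultimately have k: "linear ?k" "bij_betw ?k Basis Basis"
    using k1 by (simp_all add: bij_betw_def inj_on_inverseI[of _ \<iota>])
  have ck: "continuous_on A ?k" and ci: "continuous_on B \<iota>" for A B
    using k(1) \<iota>(1) by (auto intro: linear_continuous_on simp: linear_linear)
  have [measurable]: "?k \<in> borel_measurable borel" "\<iota> \<in> borel_measurable borel"
    by (auto intro: borel_measurable_continuous_onI ck ci)
  define f where "f = \<iota> \<circ> \<psi> \<circ> ?k"
  define f' where "f' y = \<iota> \<circ> \<psi>' (?k y) \<circ> ?k" for y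
  have pre: "\<iota> ` B = ?k -` B" for B
  proof (intro subset_antisym subsetI)
    fix y assume "y \<in> ?k -` B"
    then have "\<iota> (?k y) \<in> \<iota> ` B" by blast
    then show "y \<in> \<iota> ` B" by simp
  qed auto
  have bm: "\<iota> ` B \<in> sets borel" if "B \<in> sets borel" for B
    unfolding pre using measurable_sets[of ?k borel borel B] that by simp
  have f: "(f has_derivative f' y) (at y within \<iota> ` S)" if "y \<in> \<iota> ` S" for y
  proof -
    have im: "?k ` \<iota> ` S = S" by (simp add: image_image)
    have "(?k has_derivative ?k) (at y within \<iota> ` S)"
      using k(1) by (simp add: linear_imp_has_derivative)
    moreover have "(\<psi> has_derivative \<psi>' (?k y)) (at (?k y) within ?k ` \<iota> ` S)"
      unfolding im using that by (intro \<psi>') auto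
    ultimately have "(\<psi> \<circ> ?k has_derivative \<psi>' (?k y) \<circ> ?k) (at y within \<iota> ` S)"
      by (rule diff_chain_within)
    moreover have "(\<iota> has_derivative \<iota>) F" for F using \<iota>(1) by (simp add: linear_imp_has_derivative)
    ultimately show ?thesis
      unfolding f_def f'_def o_assoc[symmetric] by (rule diff_chain_within)
  qed
  have fS: "f ` \<iota> ` S = \<iota> ` \<psi> ` S" by (simp add: f_def image_image)
  have ind: "indicator (\<iota> ` B) (\<iota> x) = indicator B x" for B x
    using bij by (simp add: indicator_def inj_image_mem_iff bij_is_inj)
  have ind': "indicator (\<iota> ` S) y = indicator S (?k y)" for y using ind[of S "?k y"] by simp
  define F where "F x = (if x \<in> S then \<psi> x else 0)" for x
  have F[measurable]: "F \<in> borel_measurable borel"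
    unfolding F_def
    by (rule borel_measurable_continuous_on_if[OF S has_derivative_continuous_on[OF \<psi>'] continuous_on_const])
  define G where "G x = g (F x) * ennreal (indicator S x * \<bar>det (matrix (\<iota> \<circ> \<psi>' x \<circ> ?k))\<bar>)" for x
  have [measurable]: "G \<in> borel_measurable borel"
    unfolding G_def using J by measurable
  have "(\<integral>\<^sup>+y. g y * indicator (\<psi> ` S) y \<partial>lborel) =
      (\<integral>\<^sup>+x. g (?k (\<iota> x)) * indicator (\<iota> ` \<psi> ` S) (\<iota> x) \<partial>lborel)" by (simp add: ind)
  also have "\<dots> = (\<integral>\<^sup>+y. g (?k y) * indicator (\<iota> ` \<psi> ` S) y \<partial>lborel)"
    using bm[OF \<psi>S] by (intro nn_integral_lborel_basis_isometry[OF \<iota>]) auto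
  also have "\<dots> = (\<integral>\<^sup>+y. g (?k (f y)) * ennreal (indicator (\<iota> ` S) y * \<bar>det (matrix (f' y))\<bar>) \<partial>lborel)"
    unfolding fS[symmetric]
  proof (rule nn_integral_change_of_variables_cart[OF bm[OF S] f])
    show "inj_on f (\<iota> ` S)" using inj ki by (simp add: inj_on_def f_def inj_eq[OF bij_is_inj[OF bij]])
    show "(\<lambda>y. indicator (\<iota> ` S) y * \<bar>det (matrix (f' y))\<bar>) \<in> borel_measurable borel"
      unfolding ind' f'_def using measurable_compose[OF \<open>?k \<in> borel_measurable borel\<close> J] by simp
    show "f ` \<iota> ` S \<in> sets borel" unfolding fS by (rule bm[OF \<psi>S])
  qed auto
  also have "\<dots> = (\<integral>\<^sup>+y. G (?k y) \<partial>lborel)"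
    by (intro nn_integral_cong) (auto simp: pre f_def f'_def G_def F_def indicator_def)
  also have "\<dots> = (\<integral>\<^sup>+x. G x \<partial>lborel)"
    by (rule nn_integral_lborel_basis_isometry[OF k]) measurable
  also have "\<dots> = (\<integral>\<^sup>+x. g (\<psi> x) * ennreal (indicator S x * \<bar>det (matrix (\<iota> \<circ> \<psi>' x \<circ> ?k))\<bar>) \<partial>lborel)"
    by (intro nn_integral_cong) (auto simp: G_def F_def indicator_def)
  finally show ?thesis .
qed

section \<open>Infinitesimal volume distortion\<close>

text \<open>Jacobi's formula at the identity. A permutation other than \<open>id\<close> moves at
  least two indices, so the product over all indices but one still contains an off-diagonal zero;
  only \<open>id\<close> contributes.\<close>

lemma det_has_derivative_mat_1: "(det has_derivative trace) (at (mat 1 :: real^'n^'n))"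
proof -
  let ?P = "{p. p permutes (UNIV :: 'n set)}"
  let ?Q = "\<lambda>p i. \<Prod>j\<in>UNIV - {i}. (mat 1 :: real^'n^'n) $ j $ p j"
  have entry: "((\<lambda>A. A $ i $ j) has_derivative (\<lambda>H. H $ i $ j)) F" for i j and F :: "(real^'n^'n) filter"
    by (intro bounded_linear_imp_has_derivative bounded_linear_intros
        bounded_linear_compose[OF bounded_linear_vec_nth bounded_linear_vec_nth])
  have "(det has_derivative (\<lambda>H. \<Sum>p\<in>?P. of_int (sign p) * (\<Sum>i\<in>UNIV. H $ i $ p i * ?Q p i))) (at (mat 1 :: real^'n^'n))"
    unfolding det_def
    by (intro has_derivative_sum has_derivative_mult_right has_derivative_prod entry)
  moreover have "(\<Sum>p\<in>?P. of_int (sign p) * (\<Sum>i\<in>UNIV. H $ i $ p i * ?Q p i)) = trace H" for H :: "real^'n^'n"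
  proof -
    have Q0: "?Q p i = 0" if p: "p permutes UNIV" "p \<noteq> id" for p i
    proof (rule ccontr)
      assume "?Q p i \<noteq> 0"
      then have nz: "(mat 1 :: real^'n^'n) $ j $ p j \<noteq> 0" if "j \<noteq> i" for j
        using that by (auto simp: prod_zero_iff)
      have pj: "p j = j" if "j \<noteq> i" for j using nz[OF that] by (auto simp: mat_def split: if_splits)
      have "p i = i"
      proof (rule ccontr)
        assume "p i \<noteq> i"
        then have "p (p i) = p i" by (rule pj)
        then have "p i = i" using permutes_inj[OF p(1)] by (rule injD[rotated])
        then show False using \<open>p i \<noteq> i\<close> by simp
      qed
      then have "p = id" using pj by (metis id_apply ext)
      then show False using p by simp
    qed
    have "(\<Sum>p\<in>?P. of_int (sign p) * (\<Sum>i\<in>UNIV. H $ i $ p i * ?Q p i)) =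
        (\<Sum>p\<in>?P. if p = id then trace H else 0)"
    proof (rule sum.cong)
      fix p assume "p \<in> ?P"
      then show "of_int (sign p) * (\<Sum>i\<in>UNIV. H $ i $ p i * ?Q p i) = (if p = id then trace H else 0)"
      proof (cases "p = id")
        case True
        have "?Q id i = 1" for i by (intro prod.neutral) (simp add: mat_def)
        then show ?thesis unfolding True by (simp add: trace_def sign_id)
      qed (simp add: Q0)
    qed simp
    also have "\<dots> = trace H" by (simp add: permutes_id finite_permutations)
    finally show ?thesis .
  qed
  ultimately show ?thesis by simp
qed

lemma trace_matrix_basis_isometry:
  fixes \<iota> :: "'a::euclidean_space \<Rightarrow> real^'n"
  assumes \<iota>: "linear \<iota>" "bij_betw \<iota> Basis Basis"
  shows "trace (matrix (\<iota> \<circ> f \<circ> inv \<iota>)) = (\<Sum>b\<in>Basis. f b \<bullet> b)"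
proof -
  have inj: "inj \<iota>" using basis_isometry_bij[OF \<iota>] by (rule bij_is_inj)
  have b1: "bij_betw (\<lambda>i. axis i 1) (UNIV :: 'n set) (Basis :: (real^'n) set)"
    by (auto simp: bij_betw_def inj_on_def axis_eq_axis Basis_vec_def)
  have "trace (matrix (\<iota> \<circ> f \<circ> inv \<iota>)) = (\<Sum>i\<in>UNIV. \<iota> (f (inv \<iota> (axis i 1))) \<bullet> axis i 1)"
    by (simp add: trace_def matrix_def inner_axis)
  also have "\<dots> = (\<Sum>c\<in>Basis. \<iota> (f (inv \<iota> c)) \<bullet> c)"
    by (rule sum.reindex_bij_betw[OF b1])
  also have "\<dots> = (\<Sum>b\<in>Basis. \<iota> (f (inv \<iota> (\<iota> b))) \<bullet> \<iota> b)"
    by (rule sum.reindex_bij_betw[OF \<iota>(2), symmetric])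
  finally show ?thesis by (simp add: inv_f_f[OF inj] basis_isometry_inner[OF \<iota>])
qed

lemma compact_neighbourhood:
  fixes C :: "'a::euclidean_space set"
  assumes "compact C" "open U" "C \<subseteq> U"
  obtains e N where "e > 0" "compact N" "N \<subseteq> U" "\<And>z y. z \<in> C \<Longrightarrow> dist z y \<le> e \<Longrightarrow> y \<in> N"
proof -
  obtain e where e: "e > 0" "(\<Union>x\<in>C. cball x e) \<subseteq> U"
    by (rule compact_subset_open_imp_cball_epsilon_subset[OF assms])
  have eq: "(\<Union>x\<in>C. cball x e) = (\<Union>x\<in>C. \<Union>y\<in>cball 0 e. {x + y})"
  proof -
    have "cball x e = (\<Union>y\<in>cball 0 e. {x + y})" for x :: 'a
    proof (intro subset_antisym subsetI)
      fix y assume "y \<in> cball x e"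
      then have "y - x \<in> cball 0 e" by (simp add: dist_norm norm_minus_commute)
      then show "y \<in> (\<Union>y\<in>cball 0 e. {x + y})" by (rule UN_I) simp
    qed (auto simp: dist_norm)
    then show ?thesis by (rule SUP_cong[OF refl])
  qed
  have cpt: "compact (\<Union>x\<in>C. cball x e)"
    unfolding eq by (rule compact_sums'[OF assms(1) compact_cball])
  show ?thesis
    by (rule that[OF e(1) cpt e(2)]) auto
qed

text \<open>The error of the first-order expansion is controlled by the modulus of continuity of the
  gradient on a compact neighbourhood of \<open>C\<close>, so one step bound serves all base points
  in \<open>C\<close> and all directions of norm at most \<open>B\<close>.\<close>

lemma C1_uniform_expansion:
  fixes f :: "'a::euclidean_space \<Rightarrow> real"
  assumes U: "open U" and f': "\<And>x. x \<in> U \<Longrightarrow> (f has_derivative f' x) (at x)"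
    and cont: "\<And>v. continuous_on U (\<lambda>x. f' x v)"
    and C: "compact C" "C \<subseteq> U" and "\<epsilon> > 0" "B \<ge> 0"
  obtains h\<^sub>0 where "h\<^sub>0 > 0"
    "\<And>h z v. 0 < h \<Longrightarrow> h < h\<^sub>0 \<Longrightarrow> z \<in> C \<Longrightarrow> norm v \<le> B \<Longrightarrow> \<bar>f (z + h *\<^sub>R v) - f z - h * f' z v\<bar> \<le> \<epsilon> * h"
proof -
  define F where "F x = (\<Sum>b\<in>Basis. f' x b *\<^sub>R b)" for x
  have F: "f' x v = F x \<bullet> v" if "x \<in> U" for x v
  proof -
    have l: "linear (f' x)" using f'[OF that] has_derivative_linear by blast
    have "f' x v = f' x (\<Sum>b\<in>Basis. (v \<bullet> b) *\<^sub>R b)" by (simp add: euclidean_representation)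
    also have "\<dots> = (\<Sum>b\<in>Basis. (v \<bullet> b) * f' x b)" by (simp add: linear_sum[OF l] linear_cmul[OF l])
    also have "\<dots> = F x \<bullet> v"
      by (simp add: F_def inner_sum_left inner_commute[of v] mult.commute)
    finally show ?thesis .
  qed
  obtain e N where N: "e > 0" "compact N" "N \<subseteq> U" "\<And>z y. z \<in> C \<Longrightarrow> dist z y \<le> e \<Longrightarrow> y \<in> N"
    by (rule compact_neighbourhood[OF C(1) U C(2)]) (rule that)
  have "continuous_on N F" unfolding F_def
    by (intro continuous_intros continuous_on_subset[OF cont N(3)])
  then have "uniformly_continuous_on N F" by (rule compact_uniformly_continuous[OF _ N(2)])
  moreover define \<eta> where "\<eta> = \<epsilon> / (B + 1)"
  have "\<eta> > 0" using \<open>\<epsilon> > 0\<close> \<open>B \<ge> 0\<close> by (simp add: \<eta>_def)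
  ultimately obtain d where d: "d > 0" "\<And>x y. x \<in> N \<Longrightarrow> y \<in> N \<Longrightarrow> dist y x < d \<Longrightarrow> dist (F y) (F x) < \<eta>"
    unfolding uniformly_continuous_on_def by blast
  \<comment> \<open>Keeps the whole segment from \<open>z\<close> to \<open>z + h v\<close> within
    \<open>min e d\<close> of \<open>z\<close>; \<open>B + 1\<close> is used since \<open>B\<close>
    may be 0.\<close>
  define h\<^sub>0 where "h\<^sub>0 = min e d / (B + 1)"
  show ?thesis
  proof (rule that[of h\<^sub>0])
    show "h\<^sub>0 > 0" using N(1) d(1) \<open>B \<ge> 0\<close> by (simp add: h\<^sub>0_def)
    fix h :: real and z v :: 'a assume h: "0 < h" "h < h\<^sub>0" and z: "z \<in> C" and v: "norm v \<le> B"
    have hB: "h * B < min e d"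
    proof -
      have "h * B \<le> h * (B + 1)" using h(1) by (intro mult_left_mono) auto
      also have "\<dots> < min e d" using h(2) \<open>B \<ge> 0\<close> by (simp add: h\<^sub>0_def field_simps)
      finally show ?thesis .
    qed
    have dist: "dist z (z + s *\<^sub>R v) < min e d" if "0 \<le> s" "s \<le> h" for s
    proof -
      have "s * norm v \<le> h * B" using that v h by (intro mult_mono) auto
      then show ?thesis using hB that by (simp add: dist_norm)
    qed
    have inN: "z + s *\<^sub>R v \<in> N" if "0 \<le> s" "s \<le> h" for s
      using N(4)[OF z, of "z + s *\<^sub>R v"] dist[OF that] by simp
    have "((\<lambda>s. f (z + s *\<^sub>R v)) has_real_derivative F (z + s *\<^sub>R v) \<bullet> v) (at s)" if "0 \<le> s" "s \<le> h" for s
    proof -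
      have "z + s *\<^sub>R v \<in> U" using inN[OF that] N(3) by blast
      have "((\<lambda>s. z + s *\<^sub>R v) has_derivative (\<lambda>r. r *\<^sub>R v)) (at s)"
        by (auto intro!: derivative_eq_intros)
      from has_derivative_compose[OF this f'[OF \<open>z + s *\<^sub>R v \<in> U\<close>]]
      have "((\<lambda>s. f (z + s *\<^sub>R v)) has_derivative (\<lambda>r. f' (z + s *\<^sub>R v) (r *\<^sub>R v))) (at s)" .
      then show ?thesis
        by (rule has_derivative_imp_has_field_derivative) (simp add: F[OF \<open>z + s *\<^sub>R v \<in> U\<close>])
    qed
    from MVT2[OF h(1), of "\<lambda>s. f (z + s *\<^sub>R v)", OF this]
    obtain s where s: "0 < s" "s < h" "f (z + h *\<^sub>R v) - f (z + 0 *\<^sub>R v) = (h - 0) * (F (z + s *\<^sub>R v) \<bullet> v)"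
      by blast
    have "z \<in> N" using inN[of 0] h by simp
    have zU: "z \<in> U" using C(2) z by blast
    have "f (z + h *\<^sub>R v) - f z - h * f' z v = h * ((F (z + s *\<^sub>R v) - F z) \<bullet> v)"
      using s(3) by (simp add: F[OF zU] inner_diff_left algebra_simps)
    also have "\<bar>\<dots>\<bar> \<le> h * (norm (F (z + s *\<^sub>R v) - F z) * norm v)"
      using h(1) Cauchy_Schwarz_ineq2[of "F (z + s *\<^sub>R v) - F z" v] by (simp add: abs_mult)
    also have "\<dots> \<le> h * (\<eta> * (B + 1))"
    proof -
      have "dist (z + s *\<^sub>R v) z < d" using dist[of s] s by (simp add: dist_commute)
      then have "norm (F (z + s *\<^sub>R v) - F z) < \<eta>"
        using d(2)[OF \<open>z \<in> N\<close> inN[of s]] s by (simp add: dist_norm)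
      then show ?thesis using h(1) v \<open>\<eta> > 0\<close> by (intro mult_left_mono mult_mono) auto
    qed
    also have "\<dots> = \<epsilon> * h" using \<open>B \<ge> 0\<close> by (simp add: \<eta>_def)
    finally show "\<bar>f (z + h *\<^sub>R v) - f z - h * f' z v\<bar> \<le> \<epsilon> * h" .
  qed
qed

text \<open>To first order an Euler step multiplies \<rho> times volume by
  \<open>1 + h * (\<rho>' (X) / \<rho> + div X)\<close>, and \<open>div\<close> makes the bracket
  vanish. The lower estimate is enough, since reversing time later supplies the upper one.\<close>

lemma euler_step_distortion:
  fixes X :: "'a::euclidean_space \<Rightarrow> 'a" and \<rho> :: "'a \<Rightarrow> real" and \<iota> :: "'a \<Rightarrow> real^'n"
  assumes \<iota>: "linear \<iota>" "bij_betw \<iota> Basis Basis" and U: "open U"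
    and X': "\<And>z. z \<in> U \<Longrightarrow> (X has_derivative X' z) (at z)" "\<And>v. continuous_on U (\<lambda>z. X' z v)"
    and \<rho>': "\<And>z. z \<in> U \<Longrightarrow> (\<rho> has_derivative \<rho>' z) (at z)" "\<And>v. continuous_on U (\<lambda>z. \<rho>' z v)"
    and pos: "\<And>z. z \<in> U \<Longrightarrow> \<rho> z > 0"
    and div: "\<And>z. z \<in> U \<Longrightarrow> \<rho>' z (X z) + \<rho> z * (\<Sum>b\<in>Basis. X' z b \<bullet> b) = 0"
    and C: "compact C" "C \<subseteq> U" and "\<epsilon> > 0"
  obtains h\<^sub>0 where "h\<^sub>0 > 0"
    "\<And>h z. 0 < h \<Longrightarrow> h < h\<^sub>0 \<Longrightarrow> z \<in> C \<Longrightarrow>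
      (1 - \<epsilon> * h) * \<rho> z \<le> \<rho> (z + h *\<^sub>R X z) * \<bar>det (matrix (\<iota> \<circ> (\<lambda>v. v + h *\<^sub>R X' z v) \<circ> inv \<iota>))\<bar>"
proof (cases "C = {}")
  case False
  have bij: "bij \<iota>" by (rule basis_isometry_bij[OF \<iota>])
  define M where "M z = matrix (\<iota> \<circ> X' z \<circ> inv \<iota>)" for z
  define \<tau> where "\<tau> z = (\<Sum>b\<in>Basis. X' z b \<bullet> b)" for z
  have tr: "trace (M z) = \<tau> z" for z
    unfolding M_def \<tau>_def by (rule trace_matrix_basis_isometry[OF \<iota>])
  have mat: "matrix (\<iota> \<circ> (\<lambda>v. v + h *\<^sub>R X' z v) \<circ> inv \<iota>) = mat 1 + h *\<^sub>R M z" for h z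
    using bij by (simp add: M_def matrix_def vec_eq_iff mat_def linear_add[OF \<iota>(1)] linear_cmul[OF \<iota>(1)]
        surj_f_inv_f bij_is_surj axis_def)
  have bnd: "\<exists>B>0. \<forall>z\<in>C. norm (g z) \<le> B" if "continuous_on C g" for g :: "'a \<Rightarrow> 'b::real_normed_vector"
    using compact_imp_bounded[OF compact_continuous_image[OF that C(1)]] unfolding bounded_pos by blast
  have cX: "continuous_on U X" and c\<rho>: "continuous_on U \<rho>"
    by (rule has_derivative_continuous_on[OF has_derivative_at_withinI],
        erule X'(1) \<rho>'(1))+
  have "continuous_on U M" unfolding M_def matrix_def o_def
    by (intro continuous_on_vec_lambda continuous_on_component
        linear_continuous_on_compose[OF X'(2) \<iota>(1)])
  obtain B\<^sub>X where BX: "B\<^sub>X > 0" "\<And>z. z \<in> C \<Longrightarrow> norm (X z) \<le> B\<^sub>X"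
    using bnd[OF continuous_on_subset[OF cX C(2)]] by blast
  obtain B\<^sub>M where BM: "B\<^sub>M > 0" "\<And>z. z \<in> C \<Longrightarrow> norm (M z) \<le> B\<^sub>M"
    using bnd[OF continuous_on_subset[OF \<open>continuous_on U M\<close> C(2)]] by blast
  have "continuous_on U \<tau>" unfolding \<tau>_def by (intro continuous_intros X'(2))
  then obtain T where T: "T > 0" "\<And>z. z \<in> C \<Longrightarrow> \<bar>\<tau> z\<bar> \<le> T"
    using bnd[OF continuous_on_subset[OF _ C(2)], of \<tau>] by auto
  obtain z\<^sub>0 where z0: "z\<^sub>0 \<in> C" "\<And>z. z \<in> C \<Longrightarrow> \<rho> z\<^sub>0 \<le> \<rho> z"
    using continuous_attains_inf[OF C(1) False continuous_on_subset[OF c\<rho> C(2)]] by blast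
  \<comment> \<open>The minimum of \<rho> on \<open>C\<close>: an absolute error
    \<open>\<delta> * r * h\<close> is then also a relative error of at most
    \<open>\<delta> * h\<close>.\<close>
  define r where "r = \<rho> z\<^sub>0"
  have r: "r > 0" using pos z0(1) C(2) by (auto simp: r_def)
  \<comment> \<open>The two first-order errors add up to \<open>2 * \<delta> * h\<close>, at most
    half of \<open>\<epsilon> * h\<close>; the quadratic term takes the other half. The bound 1
    keeps the perturbed divergence within \<open>T + 1\<close>.\<close>
  define \<delta> where "\<delta> = min 1 (\<epsilon> / 4)"
  have \<delta>: "\<delta> > 0" "\<delta> \<le> 1" "\<delta> \<le> \<epsilon> / 4" using \<open>\<epsilon> > 0\<close> by (auto simp: \<delta>_def)
  obtain h\<^sub>1 where h1: "h\<^sub>1 > 0" "\<And>h z v. 0 < h \<Longrightarrow> h < h\<^sub>1 \<Longrightarrow> z \<in> C \<Longrightarrow> norm v \<le> B\<^sub>X \<Longrightarrow>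
      \<bar>\<rho> (z + h *\<^sub>R v) - \<rho> z - h * \<rho>' z v\<bar> \<le> (\<delta> * r) * h"
    by (rule C1_uniform_expansion[OF U \<rho>' C, of "\<delta> * r" B\<^sub>X]) (use \<delta> r BX in auto)
  have "\<exists>d>0. \<forall>A :: real^'n^'n. norm (A - mat 1) < d \<longrightarrow> norm (det A - det (mat 1) - trace (A - mat 1)) \<le> (\<delta> / B\<^sub>M) * norm (A - mat 1)"
    using det_has_derivative_mat_1[where 'n='n, unfolded has_derivative_at_alt, THEN conjunct2, THEN spec, of "\<delta> / B\<^sub>M"]
      \<delta> BM(1) by simp
  then obtain d where d: "d > 0" "\<And>A :: real^'n^'n. norm (A - mat 1) < d \<Longrightarrow>
      \<bar>det A - 1 - trace (A - mat 1)\<bar> \<le> (\<delta> / B\<^sub>M) * norm (A - mat 1)"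
    by auto
  \<comment> \<open>In order: the expansion of \<rho>, the expansion of the determinant, a quadratic
    term below \<open>\<epsilon> * h / 2\<close>, and nonnegativity of the two factors to be
    multiplied.\<close>
  define h\<^sub>0 where "h\<^sub>0 = Min {h\<^sub>1, d / B\<^sub>M, \<epsilon> / (2 * (T + 1)\<^sup>2), 1 / (T + 1)}"
  show ?thesis
  proof (rule that[of h\<^sub>0])
    show "h\<^sub>0 > 0" using h1(1) d(1) BM(1) T(1) \<open>\<epsilon> > 0\<close> by (simp add: h\<^sub>0_def)
    fix h z assume h: "0 < h" "h < h\<^sub>0" and z: "z \<in> C"
    have h': "h < h\<^sub>1" "h < d / B\<^sub>M" "h < \<epsilon> / (2 * (T + 1)\<^sup>2)" "h < 1 / (T + 1)" using h by (auto simp: h\<^sub>0_def)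
    have zU: "z \<in> U" using z C(2) by blast
    have \<rho>z: "r \<le> \<rho> z" "0 < \<rho> z" using z0 z pos[OF zU] by (auto simp: r_def)
    have dv: "\<rho>' z (X z) = - \<rho> z * \<tau> z" using div[OF zU] by (simp add: \<tau>_def)
    let ?R = "\<rho> (z + h *\<^sub>R X z)" and ?D = "det (mat 1 + h *\<^sub>R M z)"
    have "\<bar>?R - \<rho> z - h * \<rho>' z (X z)\<bar> \<le> (\<delta> * r) * h" by (rule h1(2)[OF h(1) h'(1) z BX(2)[OF z]])
    then have "?R \<ge> \<rho> z - h * (\<rho> z * \<tau> z) - \<delta> * r * h" by (simp add: dv abs_le_iff)
    moreover have "\<delta> * r * h \<le> \<delta> * \<rho> z * h" using \<rho>z \<delta> h by (intro mult_right_mono mult_left_mono) auto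
    ultimately have R: "?R \<ge> \<rho> z * (1 - h * (\<tau> z + \<delta>))" by (simp add: algebra_simps)
    have hM: "norm (h *\<^sub>R M z) \<le> h * B\<^sub>M" using h(1) BM(2)[OF z] by simp
    have "h * B\<^sub>M < d" using h'(2) BM(1) by (simp add: field_simps)
    then have "\<bar>?D - 1 - trace (h *\<^sub>R M z)\<bar> \<le> (\<delta> / B\<^sub>M) * norm (h *\<^sub>R M z)"
      using d(2)[of "mat 1 + h *\<^sub>R M z"] hM by simp
    also have "\<dots> \<le> (\<delta> / B\<^sub>M) * (h * B\<^sub>M)" using hM \<delta> BM(1) by (intro mult_left_mono) auto
    also have "\<dots> = \<delta> * h" using BM(1) by simp
    finally have "\<bar>?D - 1 - h * \<tau> z\<bar> \<le> \<delta> * h"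
      by (simp add: tr[symmetric] trace_def sum_distrib_left)
    then have D: "?D \<ge> 1 + h * (\<tau> z - \<delta>)" by (simp add: abs_le_iff algebra_simps)
    have ht: "h * (T + 1) < 1" using h'(4) T(1) by (simp add: field_simps)
    have t: "\<bar>\<tau> z\<bar> \<le> T" by (rule T(2)[OF z])
    have a1: "\<bar>h * (\<tau> z + \<delta>)\<bar> \<le> h * (T + 1)" "\<bar>h * (\<tau> z - \<delta>)\<bar> \<le> h * (T + 1)"
      using h(1) t \<delta> by (auto simp: abs_mult intro!: mult_left_mono)
    have nn: "0 \<le> 1 - h * (\<tau> z + \<delta>)" "0 \<le> 1 + h * (\<tau> z - \<delta>)" using a1 ht by linarith+
    have "(1 - \<epsilon> * h) \<le> (1 - h * (\<tau> z + \<delta>)) * (1 + h * (\<tau> z - \<delta>))"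
    proof -
      have "(h * (\<tau> z + \<delta>)) * (h * (\<tau> z - \<delta>)) \<le> \<bar>h * (\<tau> z + \<delta>)\<bar> * \<bar>h * (\<tau> z - \<delta>)\<bar>"
        by (metis abs_ge_self abs_mult)
      also have "\<dots> \<le> (h * (T + 1)) * (h * (T + 1))" using a1 by (intro mult_mono) auto
      also have "\<dots> = h * (h * (T + 1)\<^sup>2)" by (simp add: power2_eq_square)
      also have "\<dots> \<le> h * (\<epsilon> / 2)"
      proof (rule mult_left_mono)
        have "h * (2 * (T + 1)\<^sup>2) \<le> \<epsilon>" using h'(3) T(1) by (simp add: pos_less_divide_eq)
        then show "h * (T + 1)\<^sup>2 \<le> \<epsilon> / 2" by simp
      qed (use h in simp)
      finally have "(h * (\<tau> z + \<delta>)) * (h * (\<tau> z - \<delta>)) \<le> h * (\<epsilon> / 2)" .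
      moreover have "h * (2 * \<delta>) \<le> h * (\<epsilon> / 2)" using h(1) \<delta> by (intro mult_left_mono) auto
      ultimately show ?thesis by (simp add: algebra_simps)
    qed
    then have "(1 - \<epsilon> * h) * \<rho> z \<le> (1 - h * (\<tau> z + \<delta>)) * (1 + h * (\<tau> z - \<delta>)) * \<rho> z"
      using \<rho>z by (intro mult_right_mono) auto
    also have "\<dots> = (\<rho> z * (1 - h * (\<tau> z + \<delta>))) * (1 + h * (\<tau> z - \<delta>))" by (simp add: mult_ac)
    also have "\<dots> \<le> ?R * ?D"
      using R D nn \<rho>z by (intro mult_mono) (auto intro: order_trans[OF _ R])
    also have "\<dots> \<le> ?R * \<bar>?D\<bar>"
      using nn \<rho>z by (intro mult_left_mono order_trans[OF _ R]) auto
    finally show "(1 - \<epsilon> * h) * \<rho> z \<le> ?R * \<bar>det (matrix (\<iota> \<circ> (\<lambda>v. v + h *\<^sub>R X' z v) \<circ> inv \<iota>))\<bar>"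
      unfolding mat .
  qed
qed (rule that[of 1], auto)

section \<open>Liouville's theorem for confined flows\<close>

text \<open>Each step commits a local error of at most \<open>L * B * h\<^sup>2\<close> and
  amplifies the earlier error by at most \<open>1 + h * L\<close>. For \<open>n * h\<close> bounded
  the total is of order \<open>h\<close>.\<close>

lemma lipschitz_flow_euler_error:
  fixes Y :: "'a::euclidean_space \<Rightarrow> 'a"
  assumes L: "L-lipschitz_on UNIV Y" and B: "\<And>z. norm (Y z) \<le> B"
    and x: "\<And>s. s \<in> {0..T} \<Longrightarrow> (x has_vector_derivative Y (x s)) (at s)"
    and h: "h > 0" and n: "real n * h \<le> T"
  shows "norm (((\<lambda>z. z + h *\<^sub>R Y z) ^^ n) (x 0) - x (real n * h)) \<le> real n * (L * B * h\<^sup>2) * (1 + h * L) ^ n"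
  using n
proof (induction n)
  case (Suc n)
  let ?\<psi> = "\<lambda>z. z + h *\<^sub>R Y z"
  define t where "t = real n * h"
  have t: "0 \<le> t" "t + h \<le> T" "real (Suc n) * h = t + h" using Suc.prems h by (auto simp: t_def algebra_simps)
  have L0: "L \<ge> 0" using L lipschitz_on_nonneg by blast
  have B0: "B \<ge> 0" using B[of 0] norm_ge_zero order_trans by blast
  have sub: "norm (Y z - Y w) \<le> L * norm (z - w)" for z w using lipschitz_on_normD[OF L] by blast
  have speed: "norm (x s - x t) \<le> B * h" if s: "t \<le> s" "s \<le> t + h" for s
  proof (cases "s = t")
    case False
    have "norm (x s - x t) \<le> B * s - B * t"
    proof (rule differentiable_bound_general[where f'="\<lambda>s. Y (x s)" and \<phi>'="\<lambda>s. B"])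
      show "continuous_on {t..s} x"
        by (intro continuous_at_imp_continuous_on ballI has_vector_derivative_continuous[OF x]) (use s t in auto)
      show "((*) B has_vector_derivative B) (at r)" for r
        by (auto intro!: derivative_eq_intros simp: has_real_derivative_iff_has_vector_derivative[symmetric])
    qed (use False s t x B in \<open>auto intro!: continuous_intros\<close>)
    also have "\<dots> = B * (s - t)" by (simp add: algebra_simps)
    also have "\<dots> \<le> B * h" using s B0 by (intro mult_left_mono) auto
    finally show ?thesis .
  qed (use B0 h in simp)
  \<comment> \<open>During one step the curve moves by at most \<open>B * h\<close>, so its velocity
    changes by at most \<open>L * (B * h)\<close>.\<close>
  have step: "norm (x (t + h) - x t - (t + h - t) *\<^sub>R Y (x t)) \<le> norm (t + h - t) * (L * (B * h))"
  proof (rule vector_differentiable_bound_linearization[where S="{t..t+h}"])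
    show "(x has_vector_derivative Y (x s)) (at s within {t..t + h})" if "s \<in> {t..t + h}" for s
      using x[of s] that t by (auto intro: has_vector_derivative_at_within)
    show "closed_segment t (t + h) \<subseteq> {t..t + h}" using h by (simp add: closed_segment_eq_real_ivl)
    show "norm (Y (x s) - Y (x t)) \<le> L * (B * h)" if "s \<in> {t..t + h}" for s
      using sub[of "x s" "x t"] mult_left_mono[OF speed[of s] L0] that by auto
  qed (use h in auto)
  define z where "z = (?\<psi> ^^ n) (x 0)"
  have IH: "norm (z - x t) \<le> real n * (L * B * h\<^sup>2) * (1 + h * L) ^ n"
    using Suc.IH t h by (simp add: z_def t_def algebra_simps)
  have "(?\<psi> ^^ Suc n) (x 0) - x (t + h)
      = (z - x t) + h *\<^sub>R (Y z - Y (x t)) - (x (t + h) - x t - h *\<^sub>R Y (x t))"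
    by (simp add: z_def algebra_simps)
  note this[THEN arg_cong, of norm]
  then have "norm ((?\<psi> ^^ Suc n) (x 0) - x (t + h))
      \<le> norm (z - x t) + norm (h *\<^sub>R (Y z - Y (x t))) + norm (x (t + h) - x t - h *\<^sub>R Y (x t))"
    using norm_triangle_ineq4[of "(z - x t) + h *\<^sub>R (Y z - Y (x t))" "x (t + h) - x t - h *\<^sub>R Y (x t)"]
      norm_triangle_ineq[of "z - x t" "h *\<^sub>R (Y z - Y (x t))"] by linarith
  also have "\<dots> \<le> norm (z - x t) + h * (L * norm (z - x t)) + h * (L * (B * h))"
    using step sub[of z "x t"] h by (intro add_mono) auto
  also have "\<dots> = (1 + h * L) * norm (z - x t) + L * B * h\<^sup>2"
    by (simp add: algebra_simps power2_eq_square)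
  also have "\<dots> \<le> (1 + h * L) * (real n * (L * B * h\<^sup>2) * (1 + h * L) ^ n) + L * B * h\<^sup>2 * (1 + h * L) ^ Suc n"
  proof (intro add_mono mult_left_mono[OF IH])
    have "1 \<le> (1 + h * L) ^ Suc n" using h L0 by (intro one_le_power) auto
    then show "L * B * h\<^sup>2 \<le> L * B * h\<^sup>2 * (1 + h * L) ^ Suc n"
      using L0 B0 mult_left_mono[of 1 "(1 + h * L) ^ Suc n" "L * B * h\<^sup>2"] by simp
  qed (use h L0 in auto)
  also have "\<dots> = real (Suc n) * (L * B * h\<^sup>2) * (1 + h * L) ^ Suc n" by (simp add: algebra_simps)
  finally show ?case by (simp only: t(3))
qed simp

context
  fixes \<iota> :: "'a::euclidean_space \<Rightarrow> real^'n::{finite,wellorder}"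
    and U :: "'a set" and \<rho> :: "'a \<Rightarrow> real" and \<rho>' :: "'a \<Rightarrow> 'a \<Rightarrow> real"
  assumes \<iota>: "linear \<iota>" "bij_betw \<iota> Basis Basis" and U: "open U"
    and \<rho>': "\<And>z. z \<in> U \<Longrightarrow> (\<rho> has_derivative \<rho>' z) (at z)" "\<And>v. continuous_on U (\<lambda>z. \<rho>' z v)"
    and pos: "\<And>z. z \<in> U \<Longrightarrow> \<rho> z > 0"
begin

abbreviation (input) weighted :: "'a measure" where
  "weighted \<equiv> density lborel (\<lambda>z. ennreal (indicator U z * \<rho> z))"

lemma weight_continuous: "continuous_on U \<rho>"
  by (rule has_derivative_continuous_on[OF has_derivative_at_withinI], erule \<rho>')

lemma weight_measurable [measurable]: "(\<lambda>z. indicator U z * \<rho> z) \<in> borel_measurable borel"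
  using borel_measurable_continuous_on_indicator[OF _ weight_continuous] U by auto

lemma weighted_compact_finite:
  assumes "compact K" "K \<subseteq> U"
  shows "emeasure weighted K < \<infinity>"
proof -
  have "bounded (\<rho> ` K)"
    by (rule compact_imp_bounded[OF compact_continuous_image[OF continuous_on_subset[OF weight_continuous assms(2)] assms(1)]])
  then obtain B where B: "\<forall>r\<in>\<rho> ` K. norm r \<le> B" unfolding bounded_iff by blast
  have "emeasure weighted K = (\<integral>\<^sup>+z. ennreal (indicator U z * \<rho> z) * indicator K z \<partial>lborel)"
    using assms(1) by (intro emeasure_density) (auto simp: compact_imp_closed)
  also have "\<dots> \<le> (\<integral>\<^sup>+z. ennreal B * indicator K z \<partial>lborel)"
  proof (intro nn_integral_mono)
    fix z show "ennreal (indicator U z * \<rho> z) * indicator K z \<le> ennreal B * indicator K z"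
    proof (cases "z \<in> K")
      case True
      then have "\<rho> z \<le> B" using B by auto
      then show ?thesis using True assms(2) by (auto simp: indicator_def intro!: ennreal_leI)
    qed simp
  qed
  also have "\<dots> = ennreal B * emeasure lborel K"
    using assms(1) by (intro nn_integral_cmult_indicator) (auto simp: compact_imp_closed)
  also have "\<dots> < \<infinity>" using emeasure_compact_finite[OF assms(1)] by (simp add: ennreal_mult_less_top)
  finally show ?thesis .
qed

context
  fixes X :: "'a \<Rightarrow> 'a" and X' :: "'a \<Rightarrow> 'a \<Rightarrow> 'a"
  assumes X': "\<And>z. z \<in> U \<Longrightarrow> (X has_derivative X' z) (at z)" "\<And>v. continuous_on U (\<lambda>z. X' z v)"
begin

text \<open>The pointwise estimate \<open>dis\<close>, integrated over \<open>A\<close>, becomes an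
  estimate of measures because the step is injective on \<open>A\<close> and the change of variables
  absorbs its Jacobian.\<close>

lemma euler_step_weighted:
  assumes h: "h > 0" "\<epsilon> * h \<le> 1"
    and N: "compact A" "A \<subseteq> U" "\<psi> ` A \<subseteq> U" and inj: "inj_on \<psi> A"
    and \<psi>': "\<And>z. z \<in> A \<Longrightarrow> (\<psi> has_derivative (\<lambda>v. v + h *\<^sub>R X' z v)) (at z)"
    and dis: "\<And>z. z \<in> A \<Longrightarrow>
      (1 - \<epsilon> * h) * \<rho> z \<le> \<rho> (\<psi> z) * \<bar>det (matrix (\<iota> \<circ> (\<lambda>v. v + h *\<^sub>R X' z v) \<circ> inv \<iota>))\<bar>"
  shows "ennreal (1 - \<epsilon> * h) * emeasure weighted A \<le> emeasure weighted (\<psi> ` A)"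
proof -
  let ?w = "\<lambda>z. ennreal (indicator U z * \<rho> z)"
  let ?d = "\<lambda>z. \<bar>det (matrix (\<iota> \<circ> (\<lambda>v. v + h *\<^sub>R X' z v) \<circ> inv \<iota>))\<bar>"
  have c\<psi>: "continuous_on A \<psi>"
    by (rule has_derivative_continuous_on[OF has_derivative_at_withinI], erule \<psi>')
  have A: "A \<in> sets borel" "\<psi> ` A \<in> sets borel"
    using N(1) compact_continuous_image[OF c\<psi> N(1)] by (auto simp: compact_imp_closed)
  have "continuous_on A ?d"
    unfolding matrix_def o_def det_def
    by (simp, intro continuous_intros linear_continuous_on_compose[OF _ \<iota>(1)] continuous_on_subset[OF X'(2) N(2)])
  then have J: "(\<lambda>x. indicator A x * ?d x) \<in> borel_measurable borel"
    using borel_measurable_continuous_on_indicator[OF A(1), of ?d] by simp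
  have "ennreal (1 - \<epsilon> * h) * emeasure weighted A = (\<integral>\<^sup>+z. ennreal (1 - \<epsilon> * h) * (?w z * indicator A z) \<partial>lborel)"
    using A by (simp add: emeasure_density nn_integral_cmult)
  also have "\<dots> \<le> (\<integral>\<^sup>+z. ?w (\<psi> z) * ennreal (indicator A z * ?d z) \<partial>lborel)"
  proof (intro nn_integral_mono)
    fix z
    show "ennreal (1 - \<epsilon> * h) * (?w z * indicator A z) \<le> ?w (\<psi> z) * ennreal (indicator A z * ?d z)"
    proof (cases "z \<in> A")
      case True
      then have zU: "z \<in> U" "\<psi> z \<in> U" using N by auto
      have "ennreal (1 - \<epsilon> * h) * ennreal (\<rho> z) = ennreal ((1 - \<epsilon> * h) * \<rho> z)"
        using h pos[OF zU(1)] by (intro ennreal_mult[symmetric]) auto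
      also have "\<dots> \<le> ennreal (\<rho> (\<psi> z) * ?d z)" by (rule ennreal_leI[OF dis[OF True]])
      also have "\<dots> = ennreal (\<rho> (\<psi> z)) * ennreal (?d z)"
        using pos[OF zU(2)] by (intro ennreal_mult) auto
      finally show ?thesis using True zU by simp
    qed simp
  qed
  also have "\<dots> = (\<integral>\<^sup>+z. ?w z * indicator (\<psi> ` A) z \<partial>lborel)"
    by (rule nn_integral_change_of_variables[OF \<iota> A(1) _ inj J A(2), symmetric])
      (auto intro: has_derivative_at_withinI \<psi>')
  also have "\<dots> = emeasure weighted (\<psi> ` A)" using A by (simp add: emeasure_density)
  finally show ?thesis .
qed

text \<open>Euler polygons almost preserve the weighted measure of \<open>K\<close> and end up in any given
  neighbourhood of the compact set \<open>\<phi> T ` K\<close>, on which the measure is upper semicontinuous.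
  No differentiability of the flow is needed.\<close>

lemma weighted_le_flow_image:
  assumes div: "\<And>z. z \<in> U \<Longrightarrow> \<rho>' z (X z) + \<rho> z * (\<Sum>b\<in>Basis. X' z b \<bullet> b) = 0"
    and C: "compact C" "C \<subseteq> U" and T: "T > 0"
    and \<phi>0: "\<And>z. z \<in> C \<Longrightarrow> \<phi> 0 z = z"
    and \<phi>C: "\<And>z s. z \<in> C \<Longrightarrow> s \<in> {0..T} \<Longrightarrow> \<phi> s z \<in> C"
    and \<phi>': "\<And>z s. z \<in> C \<Longrightarrow> s \<in> {0..T} \<Longrightarrow> ((\<lambda>s. \<phi> s z) has_vector_derivative X (\<phi> s z)) (at s)"
    and K: "compact K" "K \<subseteq> C"
  shows "emeasure weighted K \<le> emeasure weighted (\<phi> T ` K)"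
proof (cases "K = {}")
  case False
  have cX: "C1_on U X" by (rule C1_onI[OF X'])
  obtain Y L B V where Y: "L-lipschitz_on UNIV Y" "\<And>z. norm (Y z) \<le> B" and V: "open V" "C \<subseteq> V" "V \<subseteq> U"
    and YX: "\<And>z. z \<in> V \<Longrightarrow> Y z = X z"
    by (rule C1_lipschitz_cutoff[OF U cX C]) (rule that)
  obtain e N where N: "e > 0" "compact N" "N \<subseteq> V" "\<And>z y. z \<in> C \<Longrightarrow> dist z y \<le> e \<Longrightarrow> y \<in> N"
    by (rule compact_neighbourhood[OF C(1) V(1,2)]) (rule that)
  have NU: "N \<subseteq> U" using N(3) V(3) by blast
  have L0: "L \<ge> 0" using Y(1) lipschitz_on_nonneg by blast
  have B0: "B \<ge> 0" using Y(2)[of 0] norm_ge_zero order_trans by blast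
  have \<phi>Y: "((\<lambda>s. \<phi> s z) has_vector_derivative Y (\<phi> s z)) (at s)" if "z \<in> C" "s \<in> {0..T}" for z s
  proof -
    have "Y (\<phi> s z) = X (\<phi> s z)" using YX V(2) \<phi>C[OF that] by blast
    then show ?thesis using \<phi>'[OF that] by simp
  qed
  define D where "D = \<phi> T ` K"
  have lip: "(exp (L * T))-lipschitz_on C (\<phi> T)"
  proof (rule lipschitz_onI)
    fix z w assume zw: "z \<in> C" "w \<in> C"
    have "norm (\<phi> T z - \<phi> T w) \<le> exp (L * T) * norm (\<phi> 0 z - \<phi> 0 w)"
      by (rule gronwall_lipschitz_nonneg[OF Y(1)]) (use zw \<phi>Y T in auto)
    then show "dist (\<phi> T z) (\<phi> T w) \<le> exp (L * T) * dist z w" using zw by (simp add: dist_norm \<phi>0)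
  qed simp
  have Dc: "compact D" unfolding D_def
    by (rule compact_continuous_image[OF continuous_on_subset[OF lipschitz_on_continuous_on[OF lip] K(2)] K(1)])
  have D: "D \<noteq> {}" "D \<subseteq> C" using False K(2) \<phi>C T by (auto simp: D_def)
  have DN: "D \<subseteq> N" using D(2) N(1,4) by (auto intro: N(4)[where z=z for z])
  \<comment> \<open>A neighbourhood of \<open>D\<close> shrinking with \<eta>. Intersecting with
    \<open>N\<close> keeps it compact and inside \<open>U\<close>, hence of finite weighted measure,
    as continuity from above demands.\<close>
  define E where "E \<eta> = {y. infdist y D \<le> \<eta>} \<inter> N" for \<eta>
  have cE: "compact (E \<eta>)" for \<eta> unfolding E_def
    by (intro closed_Int_compact[OF _ N(2)] closed_Collect_le continuous_intros)
  have key: "ennreal (1 - \<epsilon> * T) * emeasure weighted K \<le> emeasure weighted (E \<eta>)"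
    if \<epsilon>: "\<epsilon> > 0" and \<eta>: "\<eta> > 0" for \<epsilon> \<eta>
  proof -
    obtain h\<^sub>0 where h0: "h\<^sub>0 > 0" "\<And>h z. 0 < h \<Longrightarrow> h < h\<^sub>0 \<Longrightarrow> z \<in> N \<Longrightarrow>
      (1 - \<epsilon> * h) * \<rho> z \<le> \<rho> (z + h *\<^sub>R X z) * \<bar>det (matrix (\<iota> \<circ> (\<lambda>v. v + h *\<^sub>R X' z v) \<circ> inv \<iota>))\<bar>"
      by (rule euler_step_distortion[OF \<iota> U X' \<rho>' pos div N(2) NU \<epsilon>])
        (assumption | (rule that; assumption))+
    define m where "m = min e \<eta>"
    have m: "m > 0" using N(1) \<eta> by (simp add: m_def)
    \<comment> \<open>The summands ensure, in order, \<open>n > 0\<close>,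
      \<open>h < h\<^sub>0\<close>, injectivity of the step (\<open>h * L < 1\<close>), a positive
      factor \<open>1 - \<epsilon> * h\<close>, and a total Euler error of at most
      \<open>m\<close>.\<close>
    obtain n :: nat where "n > 1 + T / h\<^sub>0 + T * L + T * \<epsilon> + T * L * B * T * exp (L * T) / m"
      using reals_Archimedean2 by blast
    moreover have "T / h\<^sub>0 \<ge> 0" "T * L \<ge> 0" "T * \<epsilon> \<ge> 0" "T * L * B * T * exp (L * T) / m \<ge> 0"
      using T h0(1) L0 B0 \<epsilon> m by auto
    ultimately have n: "real n > 0" "T / h\<^sub>0 < n" "T * L < n" "T * \<epsilon> < n" "T * L * B * T * exp (L * T) / m < n"
      by linarith+
    define h where "h = T / n"
    have h: "h > 0" "h < h\<^sub>0" "h * L < 1" "\<epsilon> * h < 1" "n * h = T"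
      using n T h0(1) by (auto simp: h_def field_simps)
    have err: "real n * (L * B * h\<^sup>2) * exp (L * T) \<le> m"
    proof -
      have "real n * (L * B * h\<^sup>2) * exp (L * T) = T * L * B * T * exp (L * T) / n"
        using n(1) by (simp add: h_def power2_eq_square)
      also have "\<dots> \<le> m" using n(1,5) m by (simp add: field_simps)
      finally show ?thesis .
    qed
    let ?\<psi> = "\<lambda>z. z + h *\<^sub>R Y z"
    have close: "norm ((?\<psi> ^^ j) z - \<phi> (j * h) z) \<le> m" if j: "j \<le> n" and z: "z \<in> K" for j z
    proof -
      have zC: "z \<in> C" using z K(2) by blast
      have "j * h \<le> n * h" using j h(1) by (intro mult_right_mono) auto
      then have "norm ((?\<psi> ^^ j) (\<phi> 0 z) - \<phi> (j * h) z) \<le> real j * (L * B * h\<^sup>2) * (1 + h * L) ^ j"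
        by (intro lipschitz_flow_euler_error[OF Y(1,2) \<phi>Y[OF zC] h(1)]) (use h in auto)
      also have "\<dots> \<le> real n * (L * B * h\<^sup>2) * exp (L * T)"
      proof (intro mult_mono)
        have "(1 + h * L) ^ j \<le> (exp (h * L)) ^ j"
          using h L0 by (intro power_mono exp_ge_add_one_self) auto
        also have "\<dots> \<le> (exp (h * L)) ^ n" using j h L0 by (intro power_increasing) auto
        also have "\<dots> = exp (L * T)" using h(5) by (simp add: exp_of_nat_mult[symmetric] mult_ac)
        finally show "(1 + h * L) ^ j \<le> exp (L * T)" .
      qed (use j L0 B0 h in auto)
      also have "\<dots> \<le> m" by (rule err)
      finally show ?thesis by (simp add: \<phi>0[OF zC])
    qed
    define A where "A j = (?\<psi> ^^ j) ` K" for j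
    have AS: "A (Suc j) = ?\<psi> ` A j" for j by (simp add: A_def image_comp)
    have AN: "A j \<subseteq> N" if j: "j \<le> n" for j
    proof
      fix y assume "y \<in> A j"
      then obtain z where z: "z \<in> K" "y = (?\<psi> ^^ j) z" by (auto simp: A_def)
      have "\<phi> (j * h) z \<in> C"
        using z K(2) h j mult_right_mono[of "real j" "real n" h] by (intro \<phi>C) auto
      moreover have "dist (\<phi> (j * h) z) y \<le> e"
        using close[OF j z(1)] z(2) by (simp add: dist_norm norm_minus_commute m_def)
      ultimately show "y \<in> N" by (rule N(4))
    qed
    have cY: "continuous_on S Y" for S using lipschitz_on_continuous_on[OF Y(1)] continuous_on_subset by blast
    have cA: "compact (A j)" for j
    proof (induction j)
      case (Suc j)
      show ?case unfolding AS by (intro compact_continuous_image Suc continuous_intros cY)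
    qed (simp add: A_def K)
    \<comment> \<open>If two points had the same image, their distance would be at most
      \<open>h * L < 1\<close> times itself.\<close>
    have inj: "inj_on ?\<psi> S" for S
    proof (rule inj_onI)
      fix z w assume "?\<psi> z = ?\<psi> w"
      then have "z - w = h *\<^sub>R (Y w - Y z)" by (simp add: algebra_simps)
      then have "norm (z - w) = h * norm (Y w - Y z)" using h(1) by simp
      also have "\<dots> \<le> h * (L * norm (w - z))"
        using h(1) lipschitz_on_normD[OF Y(1), of w z] by (intro mult_left_mono) auto
      finally have "(1 - h * L) * norm (z - w) \<le> 0" by (simp add: algebra_simps norm_minus_commute)
      then have "norm (z - w) \<le> 0" using h(3) by (simp add: mult_le_0_iff)
      then show "z = w" by simp
    qed
    have mono: "ennreal ((1 - \<epsilon> * h) ^ j) * emeasure weighted K \<le> emeasure weighted (A j)" if "j \<le> n" for j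
      using that
    proof (induction j)
      case (Suc j)
      then have j: "A j \<subseteq> N" "?\<psi> ` A j \<subseteq> N" using AN[of j] AN[of "Suc j"] by (auto simp: AS)
      have psi: "?\<psi> z = z + h *\<^sub>R X z" if "z \<in> N" for z using YX N(3) that by auto
      have "ennreal ((1 - \<epsilon> * h) ^ Suc j) * emeasure weighted K
          = ennreal (1 - \<epsilon> * h) * (ennreal ((1 - \<epsilon> * h) ^ j) * emeasure weighted K)"
        using h(4) by (simp add: ennreal_mult mult.assoc)
      also have "\<dots> \<le> ennreal (1 - \<epsilon> * h) * emeasure weighted (A j)"
        using Suc by (intro mult_left_mono) auto
      also have "\<dots> \<le> emeasure weighted (?\<psi> ` A j)"
      proof (rule euler_step_weighted)
        show "(?\<psi> has_derivative (\<lambda>v. v + h *\<^sub>R X' z v)) (at z)" if "z \<in> A j" for z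
        proof -
          have zV: "z \<in> V" using that j(1) N(3) by blast
          have "((\<lambda>z. z + h *\<^sub>R X z) has_derivative (\<lambda>v. v + h *\<^sub>R X' z v)) (at z)"
            by (intro derivative_intros X'(1)) (use zV V(3) in blast)
          then show ?thesis
            by (rule has_derivative_transform_within_open[OF _ V(1) zV]) (simp add: YX)
        qed
        show "(1 - \<epsilon> * h) * \<rho> z \<le> \<rho> (?\<psi> z) * \<bar>det (matrix (\<iota> \<circ> (\<lambda>v. v + h *\<^sub>R X' z v) \<circ> inv \<iota>))\<bar>"
          if "z \<in> A j" for z
        proof -
          have zN: "z \<in> N" using that j(1) by blast
          show ?thesis unfolding psi[OF zN] by (rule h0(2)[OF h(1,2) zN])
        qed
      qed (use h j NU cA inj in auto)
      finally show ?case by (simp add: AS)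
    qed (simp add: A_def)
    \<comment> \<open>Bernoulli keeps the product of the \<open>n\<close> losses above
      \<open>1 - \<epsilon> * T\<close>, a bound in which the number of steps no longer
      appears.\<close>
    have "1 + real n * (- (\<epsilon> * h)) \<le> (1 + - (\<epsilon> * h)) ^ n" by (rule Bernoulli_inequality) (use h in simp)
    moreover have "real n * (\<epsilon> * h) = \<epsilon> * T" using h(5) by (metis mult.left_commute)
    ultimately have "1 - \<epsilon> * T \<le> (1 - \<epsilon> * h) ^ n" by simp
    then have "ennreal (1 - \<epsilon> * T) * emeasure weighted K \<le> ennreal ((1 - \<epsilon> * h) ^ n) * emeasure weighted K"
      by (intro mult_right_mono ennreal_leI) auto
    also have "\<dots> \<le> emeasure weighted (A n)" by (rule mono) simp
    also have "\<dots> \<le> emeasure weighted (E \<eta>)"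
    proof (rule emeasure_mono)
      show "A n \<subseteq> E \<eta>"
      proof
        fix y assume y: "y \<in> A n"
        then obtain z where z: "z \<in> K" "y = (?\<psi> ^^ n) z" by (auto simp: A_def)
        have "dist y (\<phi> T z) \<le> \<eta>" using close[OF order_refl z(1)] h(5) z(2) by (simp add: dist_norm m_def)
        moreover have "\<phi> T z \<in> D" using z by (simp add: D_def)
        ultimately have "infdist y D \<le> \<eta>" using infdist_le2 by blast
        then show "y \<in> E \<eta>" using y AN[of n] by (auto simp: E_def)
      qed
      show "E \<eta> \<in> sets weighted" using cE by (simp add: compact_imp_closed)
    qed
    finally show ?thesis .
  qed
  \<comment> \<open>The neighbourhoods shrink to \<open>D\<close> while \<epsilon> is fixed; the
    limit in \<epsilon> is taken afterwards, between real numbers.\<close>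
  have lim: "ennreal (1 - \<epsilon> * T) * emeasure weighted K \<le> emeasure weighted D" if "\<epsilon> > 0" for \<epsilon>
  proof (rule LIMSEQ_le_const)
    let ?E = "\<lambda>i. E (inverse (real (Suc i)))"
    have "(\<Inter>i. ?E i) = D"
    proof (intro subset_antisym subsetI)
      fix y assume y: "y \<in> (\<Inter>i. ?E i)"
      have "infdist y D \<le> inverse (real (Suc i))" for i using y by (auto simp: E_def)
      then have "infdist y D \<le> 0"
        by (intro LIMSEQ_le_const[OF LIMSEQ_inverse_real_of_nat]) auto
      then have "infdist y D = 0" using infdist_nonneg[of y D] by simp
      then show "y \<in> D" using in_closed_iff_infdist_zero[OF compact_imp_closed[OF Dc] D(1)] by blast
    next
      fix y assume "y \<in> D"
      then show "y \<in> (\<Inter>i. ?E i)" using DN by (auto simp: E_def)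
    qed
    moreover have "(\<lambda>i. emeasure weighted (?E i)) \<longlonglongrightarrow> emeasure weighted (\<Inter>i. ?E i)"
    proof (rule Lim_emeasure_decseq)
      show "range ?E \<subseteq> sets weighted" using cE by (auto simp: compact_imp_closed)
      show "decseq ?E" by (rule decseq_SucI) (auto simp: E_def intro: order_trans le_imp_inverse_le)
      show "emeasure weighted (?E i) \<noteq> \<infinity>" for i
      proof -
        have "?E i \<subseteq> U" using NU unfolding E_def by blast
        from weighted_compact_finite[OF cE this] show ?thesis by (rule less_imp_neq)
      qed
    qed
    ultimately show "(\<lambda>i. emeasure weighted (?E i)) \<longlonglongrightarrow> emeasure weighted D" by simp
    show "\<exists>N. \<forall>i\<ge>N. ennreal (1 - \<epsilon> * T) * emeasure weighted K \<le> emeasure weighted (?E i)"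
      using key[OF that] by auto
  qed
  have "emeasure weighted K \<noteq> \<infinity>" "emeasure weighted D \<noteq> \<infinity>"
    using weighted_compact_finite[OF K(1) order_trans[OF K(2) C(2)]]
      weighted_compact_finite[OF Dc order_trans[OF D(2) C(2)]] by auto
  then obtain k d where kd: "k \<ge> 0" "emeasure weighted K = ennreal k" "d \<ge> 0" "emeasure weighted D = ennreal d"
    by (cases "emeasure weighted K"; cases "emeasure weighted D") auto
  have "(1 - \<epsilon> * T) * k \<le> d" if "\<epsilon> > 0" for \<epsilon>
  proof (cases "1 - \<epsilon> * T \<ge> 0")
    case True
    then show ?thesis using lim[OF that] kd by (simp add: ennreal_mult[symmetric])
  next
    case False
    then have "(1 - \<epsilon> * T) * k \<le> 0" using kd by (intro mult_nonpos_nonneg) auto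
    then show ?thesis using kd by simp
  qed
  then have "eventually (\<lambda>\<epsilon>. (1 - \<epsilon> * T) * k \<le> d) (at_right 0)" by (auto simp: eventually_at_right_field intro!: exI[of _ 1])
  moreover have "((\<lambda>\<epsilon>. (1 - \<epsilon> * T) * k) \<longlongrightarrow> (1 - 0 * T) * k) (at_right 0)" by (intro tendsto_intros)
  ultimately have "(1 - 0 * T) * k \<le> d" by (intro tendsto_upperbound) auto
  then show ?thesis using kd by (simp add: D_def ennreal_leI)
qed simp

end

end

text \<open>Restricted to a compact piece of \<open>U\<close>, the measure and its transport by
  \<phi> are finite and agree on closed sets, an intersection-stable generator of the Borel sets. An
  exhaustion of \<open>U\<close> by compact sets then reaches every Borel subset.\<close>

lemma emeasure_image_eq_of_compact:
  fixes M :: "'a::euclidean_space measure"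
  assumes U: "open U" and sM: "sets M = sets borel"
    and \<phi>: "continuous_on U \<phi>" and \<psi>: "continuous_on U \<psi>"
    and inv: "\<And>z. z \<in> U \<Longrightarrow> \<phi> z \<in> U \<and> \<psi> (\<phi> z) = z" "\<And>z. z \<in> U \<Longrightarrow> \<psi> z \<in> U \<and> \<phi> (\<psi> z) = z"
    and fin: "\<And>K. compact K \<Longrightarrow> K \<subseteq> U \<Longrightarrow> emeasure M K < \<infinity>"
    and eq: "\<And>K. compact K \<Longrightarrow> K \<subseteq> U \<Longrightarrow> emeasure M (\<phi> ` K) = emeasure M K"
    and A: "A \<in> sets borel" "A \<subseteq> U"
  shows "\<phi> ` A \<in> sets borel" and "emeasure M (\<phi> ` A) = emeasure M A"
proof -
  \<comment> \<open>A Borel extension of the inverse \<psi>; through it images under \<phi> become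
    preimages, hence Borel sets.\<close>
  define F where "F x = (if x \<in> U then \<psi> x else x)" for x
  have F: "F \<in> borel_measurable borel"
    unfolding F_def by (rule borel_measurable_continuous_on_if[OF _ \<psi> continuous_on_id]) (use U in auto)
  have im: "\<phi> ` B = U \<inter> F -` B" if "B \<subseteq> U" for B
  proof (intro subset_antisym subsetI)
    fix y assume "y \<in> \<phi> ` B"
    then show "y \<in> U \<inter> F -` B" using that inv(1) by (auto simp: F_def)
  next
    fix y assume "y \<in> U \<inter> F -` B"
    then have "y = \<phi> (\<psi> y)" "\<psi> y \<in> B" using inv(2)[of y] by (auto simp: F_def)
    then show "y \<in> \<phi> ` B" by (rule image_eqI)
  qed
  have meas: "\<phi> ` B \<in> sets borel" if "B \<in> sets borel" "B \<subseteq> U" for B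
    unfolding im[OF that(2)] using U measurable_sets[OF F that(1)] by auto
  show "\<phi> ` A \<in> sets borel" by (rule meas[OF A])
  obtain C where C: "\<And>n. compact (C n)" "\<And>n. C n \<subseteq> U" "\<And>n. C n \<subseteq> interior (C (Suc n))" "\<Union>(range C) = U"
    using open_Union_compact_subsets[OF U] by metis
  have Cb: "C n \<in> sets borel" for n using C(1) by (simp add: compact_imp_closed)
  have fin_eq: "emeasure M (\<phi> ` (A \<inter> C n)) = emeasure M (A \<inter> C n)" for n
  proof -
    let ?N1 = "density M (indicator (C n))"
    let ?N2 = "distr (density M (indicator (\<phi> ` C n))) borel F"
    have Fm: "F \<in> measurable M borel" using F sM by (simp cong: measurable_cong_sets)
    have fib: "\<phi> ` C n \<in> sets M" "C n \<in> sets M" using meas[OF Cb C(2)] Cb sM by auto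
    have N1: "emeasure ?N1 B = emeasure M (B \<inter> C n)" if "B \<in> sets borel" for B
    proof -
      have "emeasure ?N1 B = (\<integral>\<^sup>+x. indicator (C n) x * indicator B x \<partial>M)"
        using that sM fib by (intro emeasure_density) auto
      also have "\<dots> = (\<integral>\<^sup>+x. indicator (B \<inter> C n) x \<partial>M)"
        by (intro nn_integral_cong) (auto simp: indicator_def)
      finally show ?thesis using that sM fib by simp
    qed
    have N2: "emeasure ?N2 B = emeasure M (\<phi> ` (B \<inter> C n))" if B: "B \<in> sets borel" for B
    proof -
      have FB: "F -` B \<inter> space M \<in> sets M" using measurable_sets[OF Fm B] .
      have sp: "space M = UNIV" using sets_eq_imp_space_eq[OF sM] by simp
      have "emeasure ?N2 B = emeasure (density M (indicator (\<phi> ` C n))) (F -` B)"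
        using Fm B by (simp add: emeasure_distr sp)
      also have "\<dots> = (\<integral>\<^sup>+x. indicator (\<phi> ` C n) x * indicator (F -` B) x \<partial>M)"
        using FB fib by (intro emeasure_density) (auto simp: sp)
      also have "\<dots> = (\<integral>\<^sup>+x. indicator (\<phi> ` (B \<inter> C n)) x \<partial>M)"
      proof (intro nn_integral_cong)
        have BU: "B \<inter> C n \<subseteq> U" using C(2) by blast
        show "indicator (\<phi> ` C n) x * indicator (F -` B) x = (indicator (\<phi> ` (B \<inter> C n)) x :: ennreal)" for x
          unfolding im[OF C(2)] im[OF BU] by (auto simp: indicator_def)
      qed
      also have "\<dots> = emeasure M (\<phi> ` (B \<inter> C n))"
        using meas[of "B \<inter> C n"] B Cb C(2) sM by (intro nn_integral_indicator) auto
      finally show ?thesis .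
    qed
    have "?N1 = ?N2"
    proof (rule measure_eqI_generator_eq[where E="Collect closed" and \<Omega>=UNIV and A="\<lambda>_. UNIV"])
      show "Int_stable (Collect closed :: 'a set set)" by (auto simp: Int_stable_def)
      show "emeasure ?N1 X = emeasure ?N2 X" if "X \<in> Collect closed" for X
      proof -
        have "compact (X \<inter> C n)" using that C(1) by (simp add: closed_Int_compact)
        then show ?thesis using that C(2) by (simp add: N1 N2 eq le_infI2)
      qed
      show "sets ?N1 = sigma_sets UNIV (Collect closed)" using sM by (simp add: borel_eq_closed)
      show "sets ?N2 = sigma_sets UNIV (Collect closed)" by (simp add: borel_eq_closed)
      show "emeasure ?N1 UNIV \<noteq> \<infinity>" for i :: nat using fin[OF C(1,2)] by (simp add: N1 less_top)
    qed auto
    then show ?thesis using N1[OF A(1)] N2[OF A(1)] by simp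
  qed
  have inc: "C n \<subseteq> C (Suc n)" for n using C(3)[of n] interior_subset by blast
  have AU: "A = (\<Union>n. A \<inter> C n)" using A(2) C(4) by blast
  have m1: "range (\<lambda>n. A \<inter> C n) \<subseteq> sets M" "range (\<lambda>n. \<phi> ` (A \<inter> C n)) \<subseteq> sets M"
    using meas[of "A \<inter> C n" for n] A Cb C(2) sM by (auto simp: le_infI1)
  have i1: "incseq (\<lambda>n. A \<inter> C n)" using inc by (intro incseq_SucI) blast
  have i2: "incseq (\<lambda>n. \<phi> ` (A \<inter> C n))" using inc by (intro incseq_SucI) blast
  have "emeasure M (\<phi> ` A) = emeasure M (\<Union>n. \<phi> ` (A \<inter> C n))"
    by (rule arg_cong[where f="emeasure M"]) (subst AU, rule image_UN)
  also have "\<dots> = (SUP n. emeasure M (\<phi> ` (A \<inter> C n)))" by (rule SUP_emeasure_incseq[OF m1(2) i2, symmetric])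
  also have "\<dots> = (SUP n. emeasure M (A \<inter> C n))" by (simp add: fin_eq)
  also have "\<dots> = emeasure M (\<Union>n. A \<inter> C n)" by (rule SUP_emeasure_incseq[OF m1(1) i1])
  finally show "emeasure M (\<phi> ` A) = emeasure M A" using AU by simp
qed

text \<open>\<open>confine\<close> places every compact set in a compact set cut out by values of
  the first integrals. Such a set is invariant, which yields completeness of the flow and uniform
  Lipschitz constants along trajectories.\<close>

locale confined_flow =
  fixes U :: "'a::euclidean_space set" and X :: "'a \<Rightarrow> 'a" and X' :: "'a \<Rightarrow> 'a \<Rightarrow> 'a"
    and F :: "'a \<Rightarrow> 'b::euclidean_space" and F' :: "'a \<Rightarrow> 'a \<Rightarrow> 'b"
  assumes U: "open U"
    and X': "\<And>z. z \<in> U \<Longrightarrow> (X has_derivative X' z) (at z)" "\<And>v. continuous_on U (\<lambda>z. X' z v)"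
    and F': "\<And>z. z \<in> U \<Longrightarrow> (F has_derivative F' z) (at z)"
    and integral: "\<And>z. z \<in> U \<Longrightarrow> F' z (X z) = 0"
    and confine: "\<And>K. compact K \<Longrightarrow> K \<subseteq> U \<Longrightarrow> \<exists>P. compact {z \<in> U. F z \<in> P} \<and> K \<subseteq> {z \<in> U. F z \<in> P}"
begin

lemma C1: "C1_on U X" by (rule C1_onI[OF X'])

lemma first_integral_derivative:
  assumes "x s \<in> U" "(x has_vector_derivative X (x s)) (at s)"
  shows "((\<lambda>s. F (x s)) has_vector_derivative 0) (at s)"
proof -
  have "((\<lambda>s. F (x s)) has_derivative (\<lambda>h. F' (x s) (h *\<^sub>R X (x s)))) (at s)"
    by (rule has_derivative_compose[OF assms(2)[unfolded has_vector_derivative_def] F'[OF assms(1)]])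
  moreover have "F' (x s) (h *\<^sub>R X (x s)) = 0" for h
    using F'[OF assms(1)] integral[OF assms(1)] by (simp add: linear_cmul[OF has_derivative_linear])
  ultimately show ?thesis by (simp add: has_vector_derivative_def)
qed

text \<open>A cut-off field has a global solution. The times it spends in the compact invariant set
  are closed, by compactness, and open: near such a time the curve is still in \<open>V\<close>,
  hence solves the true equation and keeps the value of \<open>F\<close>. The real line being
  connected, it never leaves.\<close>

lemma solution_exists:
  assumes z: "z \<in> U"
  shows "\<exists>x. x 0 = z \<and> (\<forall>t. x t \<in> U \<and> (x has_vector_derivative X (x t)) (at t))"
proof -
  obtain P where C: "compact {y \<in> U. F y \<in> P}" and zC: "z \<in> {y \<in> U. F y \<in> P}"
    using confine[of "{z}"] z by auto
  let ?C = "{y \<in> U. F y \<in> P}"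
  obtain Y L B V where Y: "L-lipschitz_on UNIV Y" and V: "open V" "?C \<subseteq> V" "V \<subseteq> U"
    and YX: "\<And>z. z \<in> V \<Longrightarrow> Y z = X z"
    by (rule C1_lipschitz_cutoff[OF U C1 C]) blast+
  obtain x where x: "x 0 = z" "\<And>t. (x has_vector_derivative Y (x t)) (at t)"
    by (rule picard_global[OF Y]) (rule that)
  have cx: "continuous_on UNIV x"
    using x(2) has_vector_derivative_continuous continuous_at_imp_continuous_on by blast
  let ?T = "{t. x t \<in> ?C}"
  have "closed ?T"
    using closed_vimage[OF compact_imp_closed[OF C] cx] by (simp add: vimage_def)
  moreover have "open ?T"
  proof (rule openI)
    fix t assume t: "t \<in> ?T"
    have "open (x -` V)" by (rule open_vimage[OF V(1) cx])
    moreover have "t \<in> x -` V" using t V(2) by blast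
    ultimately obtain e where e: "e > 0" "ball t e \<subseteq> x -` V" using open_contains_ball by blast
    have "((\<lambda>s. F (x s)) has_derivative (\<lambda>h. 0)) (at s within ball t e)" if "s \<in> ball t e" for s
    proof -
      have "x s \<in> V" using that e by blast
      then have "((\<lambda>s. F (x s)) has_vector_derivative 0) (at s)"
        using first_integral_derivative x(2)[of s] YX V(3) by auto
      then show ?thesis by (simp add: has_vector_derivative_def has_derivative_at_withinI)
    qed
    from has_derivative_zero_constant[OF convex_ball this]
    obtain c where c: "\<And>s. s \<in> ball t e \<Longrightarrow> F (x s) = c" by blast
    have "ball t e \<subseteq> ?T"
    proof
      fix s assume s: "s \<in> ball t e"
      have "F (x s) = F (x t)" using c[OF s] c[of t] e(1) by simp
      then show "s \<in> ?T" using t s e(2) V(3) by auto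
    qed
    then show "\<exists>e>0. ball t e \<subseteq> ?T" using e(1) by blast
  qed
  moreover have "0 \<in> ?T" using x(1) zC by simp
  ultimately have "?T = UNIV" using clopen[of ?T] by blast
  then have xC: "x t \<in> ?C" for t by blast
  have "x t \<in> U \<and> (x has_vector_derivative X (x t)) (at t)" for t
  proof -
    have "x t \<in> V" using xC V(2) by blast
    then show ?thesis using x(2)[of t] YX V(3) by auto
  qed
  then show ?thesis using x(1) by blast
qed

definition \<Phi> :: "real \<Rightarrow> 'a \<Rightarrow> 'a" where
  "\<Phi> t z = (SOME x. x 0 = z \<and> (\<forall>t. x t \<in> U \<and> (x has_vector_derivative X (x t)) (at t))) t"

lemma
  assumes "z \<in> U"
  shows \<Phi>_0: "\<Phi> 0 z = z" and \<Phi>_in: "\<Phi> t z \<in> U"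
    and \<Phi>_derivative: "((\<lambda>t. \<Phi> t z) has_vector_derivative X (\<Phi> t z)) (at t)"
  using someI_ex[OF solution_exists[OF assms]] unfolding \<Phi>_def by (auto simp: eta_contract_eq)

lemma \<Phi>_unique:
  assumes "is_interval J" "0 \<in> J" "t \<in> J"
    and "\<And>s. s \<in> J \<Longrightarrow> y s \<in> U \<and> (y has_vector_derivative X (y s)) (at s)"
  shows "y t = \<Phi> t (y 0)"
proof -
  have "y 0 \<in> U" using assms by blast
  then show ?thesis
    by (intro C1_flow_unique[OF U C1 assms(1-3), of y "\<lambda>t. \<Phi> t (y 0)"] assms(4) conjI \<Phi>_in \<Phi>_derivative)
      (auto simp: \<Phi>_0)
qed

lemma \<Phi>_add:
  assumes "z \<in> U"
  shows "\<Phi> t (\<Phi> s z) = \<Phi> (s + t) z"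
proof -
  have "((\<lambda>t. \<Phi> (s + t) z) has_vector_derivative X (\<Phi> (s + t) z)) (at t)" for t
  proof -
    have "((+) s has_vector_derivative 1) (at t)" by (auto intro!: derivative_eq_intros)
    from vector_diff_chain_at[OF this \<Phi>_derivative[OF assms]] show ?thesis by (simp add: o_def)
  qed
  then have "\<Phi> (s + t) z = \<Phi> t (\<Phi> (s + 0) z)"
    using \<Phi>_unique[of UNIV t "\<lambda>t. \<Phi> (s + t) z"] \<Phi>_in[OF assms] by simp
  then show ?thesis by simp
qed

lemma \<Phi>_inverse: "z \<in> U \<Longrightarrow> \<Phi> (- t) (\<Phi> t z) = z" "z \<in> U \<Longrightarrow> \<Phi> t (\<Phi> (- t) z) = z"
  by (simp_all add: \<Phi>_add \<Phi>_0)

lemma first_integral: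
  assumes "z \<in> U"
  shows "F (\<Phi> t z) = F z"
proof -
  have "((\<lambda>t. F (\<Phi> t z)) has_derivative (\<lambda>h. 0)) (at t within UNIV)" for t
    using first_integral_derivative[OF \<Phi>_in[OF assms] \<Phi>_derivative[OF assms]]
    by (simp add: has_vector_derivative_def)
  from has_derivative_zero_constant[OF convex_UNIV this] show ?thesis
    using \<Phi>_0[OF assms] by (metis UNIV_I)
qed

text \<open>A small ball around the point lies in an invariant compact set on which \<open>X\<close>
  is Lipschitz, so Gronwall makes the time-\<open>t\<close> map Lipschitz on that ball.\<close>

lemma \<Phi>_continuous: "continuous_on U (\<Phi> t)"
proof (rule continuous_at_imp_continuous_on, rule ballI)
  fix z assume "z \<in> U"
  then obtain e where e: "e > 0" "cball z e \<subseteq> U" using U open_contains_cball by blast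
  obtain P where C: "compact {y \<in> U. F y \<in> P}" "cball z e \<subseteq> {y \<in> U. F y \<in> P}"
    using confine[OF compact_cball e(2)] by blast
  let ?C = "{y \<in> U. F y \<in> P}"
  obtain L where L: "L-lipschitz_on ?C X"
    by (rule C1_on_lipschitz_compact[OF U C1 C(1)]) blast+
  have inC: "\<Phi> s y \<in> ?C" if "y \<in> ?C" for s y using that by (auto simp: \<Phi>_in first_integral)
  have "(exp (L * \<bar>t\<bar>))-lipschitz_on ?C (\<Phi> t)"
  proof (rule lipschitz_onI)
    fix y w assume yw: "y \<in> ?C" "w \<in> ?C"
    then have yw': "y \<in> U" "w \<in> U" by auto
    have "norm (\<Phi> t y - \<Phi> t w) \<le> exp (L * \<bar>t\<bar>) * norm (\<Phi> 0 y - \<Phi> 0 w)"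
      by (rule gronwall_lipschitz[OF L]) (intro conjI inC yw \<Phi>_derivative yw')+
    then show "dist (\<Phi> t y) (\<Phi> t w) \<le> exp (L * \<bar>t\<bar>) * dist y w" by (simp add: dist_norm \<Phi>_0 yw')
  qed simp
  then have "continuous_on (cball z e) (\<Phi> t)"
    using lipschitz_on_continuous_on C(2) continuous_on_subset by blast
  then show "isCont (\<Phi> t) z" using e(1) continuous_on_interior[of "cball z e" "\<Phi> t" z] by simp
qed

text \<open>The Euler comparison only says that a compact set does not lose measure, but for times
  of either sign. Applied at time \<open>- t\<close> to the image it gives the reverse inequality,
  and compact sets determine the Borel ones.\<close>

lemma emeasure_flow_image:
  fixes \<iota> :: "'a \<Rightarrow> real^'n::{finite,wellorder}"
  assumes \<iota>: "linear \<iota>" "bij_betw \<iota> Basis Basis"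
    and \<rho>': "\<And>z. z \<in> U \<Longrightarrow> (\<rho> has_derivative \<rho>' z) (at z)" "\<And>v. continuous_on U (\<lambda>z. \<rho>' z v)"
    and pos: "\<And>z. z \<in> U \<Longrightarrow> \<rho> z > 0"
    and div: "\<And>z. z \<in> U \<Longrightarrow> \<rho>' z (X z) + \<rho> z * (\<Sum>b\<in>Basis. X' z b \<bullet> b) = 0"
    and A: "A \<in> sets borel" "A \<subseteq> U"
  shows "\<Phi> t ` A \<in> sets borel"
    and "emeasure (density lborel (\<lambda>z. ennreal (indicator U z * \<rho> z))) (\<Phi> t ` A) =
      emeasure (density lborel (\<lambda>z. ennreal (indicator U z * \<rho> z))) A"
proof -
  let ?M = "density lborel (\<lambda>z. ennreal (indicator U z * \<rho> z))"
  have le: "emeasure ?M K \<le> emeasure ?M (\<Phi> t ` K)" if K: "compact K" "K \<subseteq> U" for K t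
  proof -
    obtain P where C: "compact {y \<in> U. F y \<in> P}" "K \<subseteq> {y \<in> U. F y \<in> P}"
      using confine[OF K] by blast
    let ?C = "{y \<in> U. F y \<in> P}"
    have CU: "?C \<subseteq> U" by blast
    have inC: "\<Phi> s y \<in> ?C" if "y \<in> ?C" for s y using that by (auto simp: \<Phi>_in first_integral)
    consider "t = 0" | "t > 0" | "t < 0" by linarith
    then show ?thesis
    proof cases
      case 1
      have "\<Phi> 0 ` K = K" using K(2) \<Phi>_0 by (auto simp: image_iff subset_iff)
      then show ?thesis using 1 by simp
    next
      case 2
      show ?thesis
        by (rule weighted_le_flow_image[OF \<iota> U \<rho>' pos X' div C(1) CU 2 _ _ _ K(1) C(2)])
          (auto intro: \<Phi>_derivative simp: \<Phi>_0 \<Phi>_in first_integral)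
    next
      case 3
      \<comment> \<open>Negative times are positive times of the field \<open>- X\<close>, for which
        the divergence equation merely changes sign.\<close>
      have "emeasure ?M K \<le> emeasure ?M ((\<lambda>z. \<Phi> (- (- t)) z) ` K)"
      proof (rule weighted_le_flow_image[OF \<iota> U \<rho>' pos, where X="\<lambda>z. - X z" and X'="\<lambda>z v. - X' z v" and C="?C" and \<phi>="\<lambda>s. \<Phi> (- s)"])
        show "((\<lambda>z. - X z) has_derivative (\<lambda>v. - X' z v)) (at z)" if "z \<in> U" for z
          by (intro derivative_intros X'(1) that)
        show "continuous_on U (\<lambda>z. - X' z v)" for v by (intro continuous_intros X'(2))
        show "\<rho>' z (- X z) + \<rho> z * (\<Sum>b\<in>Basis. - X' z b \<bullet> b) = 0" if "z \<in> U" for z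
          using div[OF that] linear_neg[OF has_derivative_linear[OF \<rho>'(1)[OF that]]]
          by (simp add: sum_negf)
        show "((\<lambda>s. \<Phi> (- s) z) has_vector_derivative - X (\<Phi> (- s) z)) (at s)" if "z \<in> ?C" for z s
          using that by (intro has_vector_derivative_reflect[of "\<lambda>s. \<Phi> s z"] \<Phi>_derivative) auto
        show "\<Phi> (- s) z \<in> ?C" if "z \<in> ?C" for z s using inC[OF that] .
      qed (use 3 C K in \<open>auto simp: \<Phi>_0 \<Phi>_in first_integral\<close>)
      then show ?thesis by simp
    qed
  qed
  have eq: "emeasure ?M (\<Phi> t ` K) = emeasure ?M K" if K: "compact K" "K \<subseteq> U" for K
  proof (rule antisym[OF _ le[OF K]])
    have K': "compact (\<Phi> t ` K)" "\<Phi> t ` K \<subseteq> U"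
      using compact_continuous_image[OF continuous_on_subset[OF \<Phi>_continuous K(2)] K(1)] K(2) \<Phi>_in by auto
    have "\<Phi> (- t) ` \<Phi> t ` K = K" using K(2) \<Phi>_inverse by (auto simp: image_image subset_iff)
    then show "emeasure ?M (\<Phi> t ` K) \<le> emeasure ?M K" using le[OF K', of "- t"] by simp
  qed
  have sets: "sets ?M = sets borel" by simp
  note ext = emeasure_image_eq_of_compact[OF U sets \<Phi>_continuous[of t] \<Phi>_continuous[of "- t"] _ _
      weighted_compact_finite[OF \<iota> U \<rho>' pos] eq A]
  show "\<Phi> t ` A \<in> sets borel" "emeasure ?M (\<Phi> t ` A) = emeasure ?M A"
    by (rule ext; simp add: \<Phi>_in \<Phi>_inverse)+
qed

end

section \<open>The rolling equations in body coordinates\<close>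

lemma exists_basis_isometry:
  assumes "DIM('a::euclidean_space) = DIM('b::euclidean_space)"
  obtains \<iota> :: "'a::euclidean_space \<Rightarrow> 'b::euclidean_space" where "linear \<iota>" "bij_betw \<iota> Basis Basis"
proof -
  obtain f where f: "bij_betw f (Basis :: 'a set) (Basis :: 'b set)"
    using finite_same_card_bij[OF finite_Basis finite_Basis assms] by blast
  define \<iota> where "\<iota> x = (\<Sum>b\<in>Basis. (x \<bullet> b) *\<^sub>R f b)" for x
  have "linear \<iota>" unfolding \<iota>_def
    by (intro linearI) (simp_all add: inner_add_left scaleR_add_left sum.distrib scaleR_sum_right)
  moreover have "\<iota> b = f b" if "b \<in> Basis" for b
  proof -
    have "\<iota> b = (\<Sum>c\<in>Basis. if c = b then f c else 0)"
      unfolding \<iota>_def using that by (intro sum.cong) (auto simp: inner_Basis)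
    then show ?thesis using that by simp
  qed
  then have "bij_betw \<iota> Basis Basis" using f by (simp cong: bij_betw_cong)
  ultimately show ?thesis by (rule that)
qed

lemma sum_Basis_Pair:
  "(\<Sum>i\<in>Basis. f i) = (\<Sum>i\<in>Basis. f (i, 0)) + (\<Sum>i\<in>Basis. f (0, i))"
  unfolding Basis_prod_def
  by (subst sum.union_disjoint) (auto simp: sum.reindex inj_on_def nonzero_Basis)

lemma cross3_triple_swap: "x \<bullet> (y \<times> z) = - (z \<bullet> (y \<times> x))"
  by (simp add: cross3_simps)

lemma cross3_cross_right: "x \<times> (y \<times> z) = (x \<bullet> z) *\<^sub>R y - (x \<bullet> y) *\<^sub>R z"
  by (simp add: cross3_simps forall_3)

lemma cross3_cross_left: "(x \<times> y) \<times> z = (x \<bullet> z) *\<^sub>R y - (y \<bullet> z) *\<^sub>R x"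
  by (simp add: cross3_simps forall_3)

lemma cross3_inner_cross: "(x \<times> y) \<bullet> (z \<times> w) = (x \<bullet> z) * (y \<bullet> w) - (x \<bullet> w) * (y \<bullet> z)"
  by (simp add: cross3_simps)

lemma has_derivative_cross3 [derivative_intros]:
  "(f has_derivative f') (at x within S) \<Longrightarrow> (g has_derivative g') (at x within S) \<Longrightarrow>
    ((\<lambda>x. f x \<times> g x) has_derivative (\<lambda>h. f x \<times> g' h + f' h \<times> g x)) (at x within S)"
  by (rule bounded_bilinear.FDERIV[OF bounded_bilinear_cross3])

lemma has_derivative_imp_continuous_on_open:
  "(\<And>x. x \<in> S \<Longrightarrow> (f has_derivative f' x) (at x)) \<Longrightarrow> continuous_on S f"
  by (rule has_derivative_continuous_on[OF has_derivative_at_withinI])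

lemma cross3_measurable [measurable (raw)]:
  assumes "f \<in> borel_measurable M" "g \<in> borel_measurable M"
  shows "(\<lambda>x. f x \<times> g x) \<in> borel_measurable M"
  by (rule borel_measurable_continuous_Pair[OF assms]) (intro continuous_on_cross continuous_intros)

section \<open>Inertia operators of the rolling sphere, the reduced field and its ambient
  extension\<close>

locale rubber_rolling =
  fixes a b \<mu> I\<^sub>1 I\<^sub>2 I\<^sub>3 :: real
  assumes a: "a > 0" and b: "b \<noteq> 0" "b \<noteq> - a" and \<mu>: "\<mu> > 0" and I: "I\<^sub>1 > 0" "I\<^sub>2 > 0" "I\<^sub>3 > 0"
begin

definition k :: real where "k = 1 + b / a"

text \<open>Diagonal of the inertia felt in rolling: for \<Omega> orthogonal to \<gamma>, no slip
  makes the translational energy equal to \<open>\<mu> b\<^sup>2 / 2\<close> times the square of the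
  norm of \<Omega>, which adds \<open>\<mu> b\<^sup>2\<close> to each moment.\<close>

definition j :: "real^3" where
  "j = vector [I\<^sub>1 + \<mu> * b\<^sup>2, I\<^sub>2 + \<mu> * b\<^sup>2, I\<^sub>3 + \<mu> * b\<^sup>2]"

definition J :: "real^3 \<Rightarrow> real^3" where "J v = (\<chi> i. j $ i * v $ i)"

definition B :: "real^3 \<Rightarrow> real^3" where "B v = (\<chi> i. v $ i / j $ i)"

definition D :: "real^3 \<Rightarrow> real" where "D \<gamma> = \<gamma> \<bullet> B \<gamma>"

lemma k_nz: "k \<noteq> 0" using a b by (auto simp: k_def field_simps)

lemma j_pos: "j $ i > 0"
proof -
  have "\<mu> * b\<^sup>2 > 0" using \<mu> b by simp
  then have "\<forall>i. j $ i > 0" using I by (simp add: forall_3 j_def)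
  then show ?thesis by blast
qed

lemma j_nz [simp]: "j $ i \<noteq> 0" using j_pos[of i] by simp

lemma JB [simp]: "J (B v) = v" and BJ [simp]: "B (J v) = v"
  by (simp_all add: J_def B_def vec_eq_iff)

lemma J_eq: "J v = (\<mu> * b\<^sup>2) *\<^sub>R v + diag3 I\<^sub>1 I\<^sub>2 I\<^sub>3 *v v"
  by (simp add: J_def j_def diag3_def matrix_vector_mult_def vec_eq_iff forall_3 sum_3 algebra_simps)

lemma linear_B: "linear B"
  by (intro linearI) (simp_all add: B_def vec_eq_iff add_divide_distrib)

lemma linear_J: "linear J"
  by (intro linearI) (simp_all add: J_def vec_eq_iff algebra_simps)

lemma bounded_linear_B: "bounded_linear B" and bounded_linear_J: "bounded_linear J"
  using linear_B linear_J by (simp_all add: linear_conv_bounded_linear)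

lemmas B_simps = linear_add[OF linear_B] linear_diff[OF linear_B] linear_cmul[OF linear_B] linear_0[OF linear_B]
  linear_neg[OF linear_B]

lemmas J_simps = linear_add[OF linear_J] linear_diff[OF linear_J] linear_cmul[OF linear_J] linear_0[OF linear_J]
  linear_neg[OF linear_J]

lemma B_sym: "B v \<bullet> w = v \<bullet> B w"
  by (simp add: B_def inner_vec_def)

lemma B_swap: "v \<bullet> B w = w \<bullet> B v"
  by (simp add: B_def inner_vec_def mult_ac)

lemma J_sym: "J v \<bullet> w = v \<bullet> J w"
  by (simp add: J_def inner_vec_def mult_ac)

lemma B_coercive: obtains \<beta> where "\<beta> > 0" "\<And>v. \<beta> * (v \<bullet> v) \<le> v \<bullet> B v"
proof
  let ?\<beta> = "Min (range (\<lambda>i. 1 / j $ i))"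
  show "?\<beta> > 0" using j_pos by simp
  show "?\<beta> * (v \<bullet> v) \<le> v \<bullet> B v" for v
  proof -
    have "?\<beta> * (v $ i * v $ i) \<le> (1 / j $ i) * (v $ i * v $ i)" for i
      by (rule mult_right_mono) auto
    then show ?thesis
      unfolding inner_vec_def by (simp add: B_def sum_distrib_left del: Min_le_iff) (rule sum_mono, simp add: mult.assoc)
  qed
qed

lemma D_pos: "\<gamma> \<noteq> 0 \<Longrightarrow> D \<gamma> > 0"
proof -
  assume "\<gamma> \<noteq> 0"
  obtain \<beta> where "\<beta> > 0" "\<And>v. \<beta> * (v \<bullet> v) \<le> v \<bullet> B v" using B_coercive by blast
  then show ?thesis using \<open>\<gamma> \<noteq> 0\<close> unfolding D_def
    by (metis inner_gt_zero_iff mult_pos_pos order_less_le_trans)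
qed

lemma B_Basis: assumes "i \<in> Basis" shows "B i = (i \<bullet> B i) *\<^sub>R i"
proof -
  obtain l where e: "i = axis l 1" using assms by (auto simp: Basis_vec_def)
  have "axis l 1 \<bullet> B (axis l 1) = 1 / j $ l" by (simp add: inner_axis' B_def)
  then show ?thesis unfolding e by (simp add: vec_eq_iff) (simp add: B_def axis_def)
qed

lemma cross_B_Basis: "i \<in> Basis \<Longrightarrow> (w \<times> B i) \<bullet> i = 0"
  by (subst B_Basis) (simp_all add: cross_mult_right dot_cross_self)

text \<open>Projection along \<open>\<gamma>\<close> onto the momenta \<open>K = J \<Omega>\<close> with \<open>\<Omega> \<bullet> \<gamma> = 0\<close> (no twist).\<close>

definition spin :: "real^3 \<Rightarrow> real^3 \<Rightarrow> real" where "spin \<gamma> K = \<gamma> \<bullet> B K"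

definition notwist :: "real^3 \<Rightarrow> real^3 \<Rightarrow> real^3" where
  "notwist \<gamma> K = K - (spin \<gamma> K / D \<gamma>) *\<^sub>R \<gamma>"

lemma notwist_orth: "\<gamma> \<noteq> 0 \<Longrightarrow> \<gamma> \<bullet> B (notwist \<gamma> K) = 0"
  using D_pos[of \<gamma>] by (simp add: notwist_def B_simps inner_diff_right spin_def D_def)

text \<open>On the unit sphere \<open>(1/k) (p \<times> \<gamma>)\<close> is the component of
  \<open>K\<close> orthogonal to \<gamma>, and \<open>notwist\<close> restores the radial component.
  The second entry is the derivative of \<open>k \<gamma> \<times> K\<close> under the rolling
  equations, freed of double cross products by \<open>momentum_identity\<close>.\<close>

definition reduced_vf :: "phase \<Rightarrow> phase" where
  "reduced_vf = (\<lambda>(\<gamma>, p). let K = notwist \<gamma> ((1/k) *\<^sub>R (p \<times> \<gamma>)) in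
     ((1/k) *\<^sub>R (\<gamma> \<times> B K), ((1 - k) * (\<gamma> \<bullet> K)) *\<^sub>R B K - (B K \<bullet> K) *\<^sub>R \<gamma>))"

text \<open>The ambient field extends the dynamics from \<open>\<bar>\<gamma>\<bar> = 1\<close>, \<open>spin = 0\<close> to all level sets of \<open>\<bar>\<gamma>\<bar>\<close> and
  \<^const>\<open>spin\<close> such that the projection to the phase space does not see these levels. A momentum
  splits as \<open>K = J \<Omega> + mult \<gamma>\<close>; \<open>lam\<close> is the Lagrange multiplier of the no-twist constraint and
  \<open>drift\<close> the derivative of \<open>D \<gamma>\<close> along the field.\<close>

definition punctured :: "phase set" where "punctured = {(\<gamma>, K). \<gamma> \<noteq> 0}"

definition \<Omega> :: "phase \<Rightarrow> real^3" where "\<Omega> z = B (notwist (fst z) (snd z))"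

definition mult :: "phase \<Rightarrow> real" where "mult z = spin (fst z) (snd z) / D (fst z)"

definition lam :: "phase \<Rightarrow> real" where
  "lam z = - (fst z \<bullet> B (notwist (fst z) (snd z) \<times> \<Omega> z)) / D (fst z)"

definition drift :: "phase \<Rightarrow> real" where
  "drift z = (2/k) * (B (fst z) \<bullet> (fst z \<times> \<Omega> z))"

definition ambient :: "phase \<Rightarrow> phase" where
  "ambient z = ((1/k) *\<^sub>R (fst z \<times> \<Omega> z),
     notwist (fst z) (snd z) \<times> \<Omega> z + (mult z / k) *\<^sub>R (fst z \<times> \<Omega> z)
       + (lam z - mult z * drift z / D (fst z)) *\<^sub>R fst z)"

section \<open>Derivative and divergence of the ambient field\<close>

definition mult' :: "phase \<Rightarrow> phase \<Rightarrow> real" where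
  "mult' z v = (fst v \<bullet> B (snd z) + fst z \<bullet> B (snd v) - 2 * mult z * (B (fst z) \<bullet> fst v)) / D (fst z)"

definition nt' :: "phase \<Rightarrow> phase \<Rightarrow> real^3" where
  "nt' z v = snd v - mult' z v *\<^sub>R fst z - mult z *\<^sub>R fst v"

definition lam' :: "phase \<Rightarrow> phase \<Rightarrow> real" where
  "lam' z v = - (fst v \<bullet> B (notwist (fst z) (snd z) \<times> \<Omega> z)
      + fst z \<bullet> B (nt' z v \<times> \<Omega> z + notwist (fst z) (snd z) \<times> B (nt' z v))) / D (fst z)
    - lam z * (2 * (B (fst z) \<bullet> fst v)) / D (fst z)"

definition drift' :: "phase \<Rightarrow> phase \<Rightarrow> real" where
  "drift' z v = (2/k) * (B (fst v) \<bullet> (fst z \<times> \<Omega> z) + B (fst z) \<bullet> (fst v \<times> \<Omega> z + fst z \<times> B (nt' z v)))"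

definition coef' :: "phase \<Rightarrow> phase \<Rightarrow> real" where
  "coef' z v = lam' z v - (mult' z v * drift z + mult z * drift' z v) / D (fst z)
     + mult z * drift z * (2 * (B (fst z) \<bullet> fst v)) / (D (fst z))\<^sup>2"

definition ambient' :: "phase \<Rightarrow> phase \<Rightarrow> phase" where
  "ambient' z v = ((1/k) *\<^sub>R (fst v \<times> \<Omega> z + fst z \<times> B (nt' z v)),
     nt' z v \<times> \<Omega> z + notwist (fst z) (snd z) \<times> B (nt' z v)
       + (mult' z v / k) *\<^sub>R (fst z \<times> \<Omega> z) + (mult z / k) *\<^sub>R (fst v \<times> \<Omega> z + fst z \<times> B (nt' z v))
       + coef' z v *\<^sub>R fst z + (lam z - mult z * drift z / D (fst z)) *\<^sub>R fst v)"

lemma open_punctured: "open punctured"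
proof -
  have eq: "punctured = - (fst -` {0} :: phase set)" by (auto simp: punctured_def)
  show ?thesis unfolding eq
    by (intro open_Compl closed_vimage) (auto intro: continuous_intros)
qed

lemma notwist_mult: "notwist (fst z) (snd z) = snd z - mult z *\<^sub>R fst z"
  by (simp add: notwist_def mult_def)

lemma has_derivative_B [derivative_intros]:
  "(f has_derivative f') F \<Longrightarrow> ((\<lambda>x. B (f x)) has_derivative (\<lambda>x. B (f' x))) F"
  by (rule bounded_linear.has_derivative[OF bounded_linear_B])

context
  fixes z assumes z: "z \<in> punctured"
begin

lemma Dz: "D (fst z) > 0" "D (fst z) \<noteq> 0" using D_pos[of "fst z"] z by (auto simp: punctured_def)

lemma D_derivative: "((\<lambda>z. D (fst z)) has_derivative (\<lambda>v. 2 * (B (fst z) \<bullet> fst v))) (at z)"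
  unfolding D_def
  by (rule derivative_eq_intros refl)+
    (simp add: fun_eq_iff inner_commute[of "B (fst z)"] B_swap[of "fst z"])

lemma mult_derivative: "(mult has_derivative mult' z) (at z)"
proof -
  have "((\<lambda>z. fst z \<bullet> B (snd z) / D (fst z)) has_derivative mult' z) (at z)"
    by (rule derivative_eq_intros D_derivative refl Dz)+
      (use Dz in \<open>simp add: fun_eq_iff mult'_def mult_def spin_def field_simps\<close>)
  then show ?thesis by (simp add: mult_def[abs_def] spin_def)
qed

lemma nt_derivative: "((\<lambda>z. notwist (fst z) (snd z)) has_derivative nt' z) (at z)"
  unfolding notwist_mult
  by (rule derivative_eq_intros mult_derivative refl)+ (simp add: fun_eq_iff nt'_def)

lemma \<Omega>_derivative: "(\<Omega> has_derivative (\<lambda>v. B (nt' z v))) (at z)"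
  unfolding \<Omega>_def[abs_def] by (intro derivative_intros nt_derivative)

lemma lam_derivative: "(lam has_derivative lam' z) (at z)"
  unfolding lam_def[abs_def]
  by (rule derivative_eq_intros nt_derivative \<Omega>_derivative D_derivative refl Dz)+
    (use Dz in \<open>simp add: fun_eq_iff lam'_def lam_def field_simps B_simps inner_add_right\<close>)

lemma drift_derivative: "(drift has_derivative drift' z) (at z)"
  unfolding drift_def[abs_def]
  by (rule derivative_eq_intros \<Omega>_derivative refl)+
    (simp add: fun_eq_iff drift'_def algebra_simps)

lemma ambient_derivative: "(ambient has_derivative ambient' z) (at z)"
proof -
  have "((\<lambda>z. lam z - mult z * drift z / D (fst z)) has_derivative coef' z) (at z)"
    by (rule derivative_eq_intros lam_derivative mult_derivative drift_derivative D_derivative refl Dz)+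
      (use Dz in \<open>simp add: fun_eq_iff coef'_def field_simps power2_eq_square\<close>)
  note coef = this
  show ?thesis
    unfolding ambient_def[abs_def]
    by (rule coef nt_derivative \<Omega>_derivative mult_derivative k_nz derivative_eq_intros refl)+
      (simp add: fun_eq_iff ambient'_def algebra_simps)
qed

lemma twist_free: "fst z \<bullet> \<Omega> z = 0"
  using notwist_orth z by (auto simp: \<Omega>_def punctured_def)

lemma B_snd: "B (snd z) = \<Omega> z + mult z *\<^sub>R B (fst z)"
  by (simp add: \<Omega>_def notwist_mult B_simps)

lemma Basis_trace:
  "(\<Sum>i\<in>Basis. (v \<times> B i) \<bullet> i) = 0" "(\<Sum>i\<in>Basis. (i \<times> v) \<bullet> i) = 0"
  "(\<Sum>i\<in>Basis. (w \<bullet> i) * (v \<bullet> i)) = w \<bullet> v"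
  by (auto simp: cross_B_Basis dot_cross_self euclidean_inner[of w v] intro!: sum.neutral)

text \<open>With \<open>W = B \<gamma> \<bullet> (\<gamma> \<times> \<Omega>)\<close>, the \<gamma>
  block contributes \<open>W / (k D)\<close>; the momentum block contributes
  \<open>- W / D + W / (k D)\<close> and, through the coefficient of \<gamma>,
  \<open>- 2 W / (k D)\<close>. The terms with \<open>k\<close> cancel. As \<open>D\<close> grows at
  rate \<open>2 W / k\<close>, the sum is minus the logarithmic derivative of
  \<open>D powr (k / 2)\<close>, whence the weight.\<close>

lemma ambient_trace:
  "(\<Sum>i\<in>Basis. ambient' z i \<bullet> i) = - (B (fst z) \<bullet> (fst z \<times> \<Omega> z)) / D (fst z)"
proof -
  let ?\<gamma> = "fst z" let ?W = "B ?\<gamma> \<bullet> (?\<gamma> \<times> \<Omega> z)"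
  have "(\<Sum>i\<in>Basis. ambient' z (i, 0) \<bullet> (i, 0)) = (1/k) * (?W / D ?\<gamma>)"
  proof -
    have "ambient' z (i, 0) \<bullet> (i, 0) = (1/k) * ((i \<times> \<Omega> z) \<bullet> i
        - (((B (snd z) - (2 * mult z) *\<^sub>R B ?\<gamma>) \<bullet> i) * ((?\<gamma> \<times> B ?\<gamma>) \<bullet> i)) / D ?\<gamma>
        - mult z * ((?\<gamma> \<times> B i) \<bullet> i))" for i :: "real^3"
    proof -
      have c: "mult' z (i, 0) = ((B (snd z) - (2 * mult z) *\<^sub>R B ?\<gamma>) \<bullet> i) / D ?\<gamma>"
        by (simp add: mult'_def inner_diff_left inner_commute[of i] B_simps)
      have n: "?\<gamma> \<times> B (nt' z (i, 0)) = - (mult' z (i, 0) *\<^sub>R (?\<gamma> \<times> B ?\<gamma>)) - mult z *\<^sub>R (?\<gamma> \<times> B i)"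
        by (simp add: nt'_def B_simps Cross3.right_diff_distrib cross_mult_right)
      have "ambient' z (i, 0) \<bullet> (i, 0) = (1/k) * ((i \<times> \<Omega> z) \<bullet> i
        - mult' z (i, 0) * ((?\<gamma> \<times> B ?\<gamma>) \<bullet> i) - mult z * ((?\<gamma> \<times> B i) \<bullet> i))"
        by (simp add: ambient'_def n inner_add_left inner_diff_left)
      then show ?thesis by (simp add: c)
    qed
    then have "(\<Sum>i\<in>Basis. ambient' z (i, 0) \<bullet> (i, 0))
        = (1/k) * (- (((B (snd z) - (2 * mult z) *\<^sub>R B ?\<gamma>) \<bullet> (?\<gamma> \<times> B ?\<gamma>)) / D ?\<gamma>))"
      by (simp add: sum_distrib_left[symmetric] sum.distrib sum_subtractf Basis_trace
          sum_divide_distrib[symmetric])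
    also have "(B (snd z) - (2 * mult z) *\<^sub>R B ?\<gamma>) \<bullet> (?\<gamma> \<times> B ?\<gamma>) = - ?W"
      using cross3_triple_swap[of "\<Omega> z" ?\<gamma> "B ?\<gamma>"]
      by (simp add: B_snd inner_diff_left inner_add_left dot_cross_self)
    finally show ?thesis by simp
  qed
  moreover have "(\<Sum>i\<in>Basis. ambient' z (0, i) \<bullet> (0, i)) = - ?W / D ?\<gamma> + (1/k) * ?W / D ?\<gamma> - drift z / D ?\<gamma>"
  proof -
    \<comment> \<open>Linearity turns the trace of the rank-one term \<open>coef'\<close> times
      \<gamma> into a single value, that in the direction \<gamma>.\<close>
    have lin: "linear (\<lambda>i. coef' z (0, i))"
      unfolding coef'_def lam'_def drift'_def nt'_def mult'_def
      by (intro linearI)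
        (simp_all add: B_simps inner_add_right inner_diff_right cross_add_left cross_add_right
          Cross3.left_diff_distrib Cross3.right_diff_distrib cross_mult_left cross_mult_right
          scaleR_add_left scaleR_add_right add_divide_distrib diff_divide_distrib algebra_simps)
    have "(\<Sum>i\<in>Basis. coef' z (0, i) * (?\<gamma> \<bullet> i)) = coef' z (0, \<Sum>i\<in>Basis. (?\<gamma> \<bullet> i) *\<^sub>R i)"
      using linear_sum[OF lin, of "\<lambda>i. (?\<gamma> \<bullet> i) *\<^sub>R i" Basis] by (simp add: linear_cmul[OF lin] mult.commute)
    also have "\<dots> = coef' z (0, ?\<gamma>)" by (simp add: euclidean_representation)
    \<comment> \<open>In the direction \<open>(0, \<gamma>)\<close> only \<open>mult\<close>
      changes, at rate 1, while \<open>notwist\<close>, \<open>lam\<close> and \<open>drift\<close>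
      stay fixed.\<close>
    also have "\<dots> = - drift z / D ?\<gamma>"
    proof -
      have "mult' z (0, ?\<gamma>) = 1" using Dz by (simp add: mult'_def D_def B_simps)
      then have "nt' z (0, ?\<gamma>) = 0" by (simp add: nt'_def)
      then show ?thesis using \<open>mult' z (0, ?\<gamma>) = 1\<close> by (simp add: coef'_def lam'_def drift'_def B_simps)
    qed
    finally have c: "(\<Sum>i\<in>Basis. coef' z (0, i) * (?\<gamma> \<bullet> i)) = - drift z / D ?\<gamma>" .
    have "ambient' z (0, i) \<bullet> (0, i) = (i \<times> \<Omega> z) \<bullet> i + (notwist ?\<gamma> (snd z) \<times> B i) \<bullet> i + (mult z / k) * ((?\<gamma> \<times> B i) \<bullet> i)
        + ((B ?\<gamma> \<bullet> i) * ((- (?\<gamma> \<times> \<Omega> z) - notwist ?\<gamma> (snd z) \<times> B ?\<gamma> + (1/k) *\<^sub>R (?\<gamma> \<times> \<Omega> z)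
            - (mult z / k) *\<^sub>R (?\<gamma> \<times> B ?\<gamma>)) \<bullet> i)) / D ?\<gamma>
        + coef' z (0, i) * (?\<gamma> \<bullet> i)" for i :: "real^3"
    proof -
      have c: "mult' z (0, i) = (B ?\<gamma> \<bullet> i) / D ?\<gamma>" by (simp add: mult'_def B_sym)
      have n: "nt' z (0, i) = i - mult' z (0, i) *\<^sub>R ?\<gamma>" by (simp add: nt'_def)
      have "ambient' z (0, i) \<bullet> (0, i) = (i \<times> \<Omega> z) \<bullet> i + (notwist ?\<gamma> (snd z) \<times> B i) \<bullet> i + (mult z / k) * ((?\<gamma> \<times> B i) \<bullet> i)
        + mult' z (0, i) * ((- (?\<gamma> \<times> \<Omega> z) - notwist ?\<gamma> (snd z) \<times> B ?\<gamma> + (1/k) *\<^sub>R (?\<gamma> \<times> \<Omega> z)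
            - (mult z / k) *\<^sub>R (?\<gamma> \<times> B ?\<gamma>)) \<bullet> i)
        + coef' z (0, i) * (?\<gamma> \<bullet> i)"
        by (simp add: ambient'_def n B_simps cross_mult_left cross_mult_right Cross3.left_diff_distrib
          Cross3.right_diff_distrib inner_add_left inner_diff_left)
          (simp add: algebra_simps diff_divide_distrib)
      then show ?thesis by (simp add: c)
    qed
    then have "(\<Sum>i\<in>Basis. ambient' z (0, i) \<bullet> (0, i)) = (B ?\<gamma> \<bullet> (- (?\<gamma> \<times> \<Omega> z) - notwist ?\<gamma> (snd z) \<times> B ?\<gamma>
          + (1/k) *\<^sub>R (?\<gamma> \<times> \<Omega> z) - (mult z / k) *\<^sub>R (?\<gamma> \<times> B ?\<gamma>))) / D ?\<gamma> - drift z / D ?\<gamma>"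
      by (simp add: sum.distrib Basis_trace c sum_distrib_left[symmetric] sum_divide_distrib[symmetric])
    also have "\<dots> = - ?W / D ?\<gamma> + (1/k) * ?W / D ?\<gamma> - drift z / D ?\<gamma>"
      by (simp add: inner_add_right inner_diff_right dot_cross_self add_divide_distrib diff_divide_distrib)
    finally show ?thesis .
  qed
  ultimately show ?thesis
    by (simp add: sum_Basis_Pair drift_def)
qed

end

text \<open>The third entry is twice the kinetic energy of the twist-free part of the momentum and
  bounds \<open>K\<close> on the joint level sets; the first two are the invariants on which the
  slicing rests.\<close>

definition integrals :: "phase \<Rightarrow> real \<times> real \<times> real" where
  "integrals z = (fst z \<bullet> fst z, spin (fst z) (snd z), notwist (fst z) (snd z) \<bullet> B (notwist (fst z) (snd z)))"

definition integrals' :: "phase \<Rightarrow> phase \<Rightarrow> real \<times> real \<times> real" where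
  "integrals' z v = (2 * (fst z \<bullet> fst v), fst v \<bullet> B (snd z) + fst z \<bullet> B (snd v), 2 * (\<Omega> z \<bullet> nt' z v))"

lemma integrals_derivative:
  assumes z: "z \<in> punctured"
  shows "(integrals has_derivative integrals' z) (at z)"
  unfolding integrals_def[abs_def] spin_def
  by (rule nt_derivative[OF z] derivative_eq_intros refl)+
    (simp add: fun_eq_iff integrals'_def \<Omega>_def inner_commute[of "fst z"] B_swap[of "notwist (fst z) (snd z)"]
      inner_commute[of "B (notwist (fst z) (snd z))"])

lemma D_rate: "2 * (B (fst z) \<bullet> fst (ambient z)) = drift z"
  by (simp add: ambient_def drift_def)

text \<open>The radial coefficient of \<open>ambient\<close> is chosen for this: \<open>lam\<close>
  balances the gyroscopic term, and \<open>mult * drift / D\<close> balances the two contributions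
  of the moving \<gamma>.\<close>

lemma spin_rate:
  assumes z: "z \<in> punctured"
  shows "fst (ambient z) \<bullet> B (snd z) + fst z \<bullet> B (snd (ambient z)) = 0"
proof -
  let ?W = "B (fst z) \<bullet> (fst z \<times> \<Omega> z)" and ?Q = "B (fst z) \<bullet> (notwist (fst z) (snd z) \<times> \<Omega> z)"
  have "fst (ambient z) \<bullet> B (snd z) = (mult z / k) * ?W"
    by (simp add: ambient_def B_snd[OF z] inner_add_right dot_cross_self inner_commute)
  moreover have "fst z \<bullet> B (snd (ambient z)) = B (fst z) \<bullet> snd (ambient z)" by (simp add: B_sym)
  moreover have "B (fst z) \<bullet> snd (ambient z) = ?Q + (mult z / k) * ?W + (lam z - mult z * drift z / D (fst z)) * D (fst z)"
    by (simp add: ambient_def inner_add_right D_def inner_commute)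
  moreover have "(lam z - mult z * drift z / D (fst z)) * D (fst z) = - ?Q - (2 * mult z / k) * ?W"
    using Dz[OF z] by (simp add: lam_def drift_def left_diff_distrib B_sym)
  ultimately show ?thesis by simp
qed

lemma mult_rate:
  assumes z: "z \<in> punctured"
  shows "mult' z (ambient z) = - mult z * drift z / D (fst z)"
  using spin_rate[OF z] D_rate[of z] Dz[OF z] by (simp add: mult'_def field_simps)

text \<open>The twist-free part obeys the genuine rolling equation with multiplier
  \<open>lam\<close>, whatever the value of \<open>mult\<close>. This independence lets the levels
  of spin be forgotten in the projection.\<close>

lemma notwist_rate:
  assumes z: "z \<in> punctured"
  shows "nt' z (ambient z) = notwist (fst z) (snd z) \<times> \<Omega> z + lam z *\<^sub>R fst z"
  unfolding nt'_def mult_rate[OF z] by (simp add: ambient_def algebra_simps)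

lemma integrals_rate:
  assumes z: "z \<in> punctured"
  shows "integrals' z (ambient z) = 0"
proof -
  have "fst z \<bullet> fst (ambient z) = 0" by (simp add: ambient_def dot_cross_self)
  moreover have "\<Omega> z \<bullet> nt' z (ambient z) = 0"
    using twist_free[OF z] by (simp add: notwist_rate[OF z] inner_add_right dot_cross_self inner_commute)
  ultimately show ?thesis
    using spin_rate[OF z] by (simp add: integrals'_def zero_prod_def)
qed

lemma continuous_on_B [continuous_intros]: "continuous_on S f \<Longrightarrow> continuous_on S (\<lambda>x. B (f x))"
  by (rule bounded_linear.continuous_on[OF bounded_linear_B])

lemma ambient'_continuous: "continuous_on punctured (\<lambda>z. ambient' z v)"
proof -
  note c = D_derivative[THEN has_derivative_imp_continuous_on_open] mult_derivative[THEN has_derivative_imp_continuous_on_open]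
    nt_derivative[THEN has_derivative_imp_continuous_on_open] \<Omega>_derivative[THEN has_derivative_imp_continuous_on_open]
    lam_derivative[THEN has_derivative_imp_continuous_on_open] drift_derivative[THEN has_derivative_imp_continuous_on_open]
  have m: "continuous_on punctured (\<lambda>z. mult' z v)"
    unfolding mult'_def by (intro continuous_intros c) (simp_all add: Dz)
  have n: "continuous_on punctured (\<lambda>z. nt' z v)"
    unfolding nt'_def by (intro continuous_intros c m)
  have l: "continuous_on punctured (\<lambda>z. lam' z v)"
    unfolding lam'_def by (intro continuous_intros continuous_on_cross c n) (simp_all add: Dz)
  have d: "continuous_on punctured (\<lambda>z. drift' z v)"
    unfolding drift'_def by (intro continuous_intros continuous_on_cross c n)
  have e: "continuous_on punctured (\<lambda>z. coef' z v)"
    unfolding coef'_def by (intro continuous_intros c m l d) (simp_all add: Dz)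
  show ?thesis
    unfolding ambient'_def
    by (intro continuous_intros continuous_on_cross c m n e) (simp_all add: Dz k_nz)
qed

text \<open>The first integral bounds \<gamma>, and its lower bound \<open>r\<close> on
  \<open>K\<close> keeps \<gamma> away from 0. Energy bounds the twist-free part by coercivity of
  \<open>B\<close>; spin divided by \<open>D \<ge> \<beta> * r\<close> bounds the radial part. The
  bound \<open>r\<close> also makes the set closed in the whole space.\<close>

lemma integrals_confine:
  assumes K: "compact K" "K \<subseteq> punctured"
  shows "\<exists>P. compact {z \<in> punctured. integrals z \<in> P} \<and> K \<subseteq> {z \<in> punctured. integrals z \<in> P}"
proof (cases "K = {}")
  case True
  then show ?thesis by (intro exI[of _ "{}"]) simp
next
  case False
  have ci: "continuous_on punctured integrals" by (rule has_derivative_imp_continuous_on_open, erule integrals_derivative)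
  have "continuous_on K (\<lambda>z. fst z \<bullet> fst z)" by (intro continuous_intros)
  then obtain z\<^sub>0 where z0: "z\<^sub>0 \<in> K" "\<And>z. z \<in> K \<Longrightarrow> fst z\<^sub>0 \<bullet> fst z\<^sub>0 \<le> fst z \<bullet> fst z"
    using continuous_attains_inf[OF K(1) False] by blast
  define r where "r = fst z\<^sub>0 \<bullet> fst z\<^sub>0"
  have r: "r > 0" using z0(1) K(2) by (auto simp: r_def punctured_def)
  have "bounded (integrals ` K)"
    by (rule compact_imp_bounded[OF compact_continuous_image[OF continuous_on_subset[OF ci K(2)] K(1)]])
  then obtain R where R: "\<And>z. z \<in> K \<Longrightarrow> norm (integrals z) \<le> R" unfolding bounded_iff by blast
  define P where "P = {p :: real \<times> real \<times> real. r \<le> fst p} \<inter> cball 0 R"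
  have KP: "K \<subseteq> {z \<in> punctured. integrals z \<in> P}"
    using K(2) R z0(2) by (auto simp: P_def r_def) (auto simp: integrals_def)
  obtain \<beta> where \<beta>: "\<beta> > 0" "\<And>v. \<beta> * (v \<bullet> v) \<le> v \<bullet> B v" using B_coercive by blast
  let ?C = "{z \<in> punctured. integrals z \<in> P}"
  have "norm z \<le> sqrt R + (sqrt (R / \<beta>) + R / (\<beta> * r) * sqrt R)" if z: "z \<in> ?C" for z
  proof -
    have zp: "z \<in> punctured" and "norm (integrals z) \<le> R" and rz: "r \<le> fst z \<bullet> fst z"
      using z by (auto simp: P_def integrals_def)
    then have n: "fst z \<bullet> fst z \<le> R" "\<bar>spin (fst z) (snd z)\<bar> \<le> R"
        "notwist (fst z) (snd z) \<bullet> B (notwist (fst z) (snd z)) \<le> R"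
      using norm_fst_le[of "fst (integrals z)" "snd (integrals z)"]
        norm_snd_le[of "snd (integrals z)" "fst (integrals z)"]
        norm_fst_le[of "fst (snd (integrals z))" "snd (snd (integrals z))"]
        norm_snd_le[of "snd (snd (integrals z))" "fst (snd (integrals z))"]
      by (auto simp: integrals_def)
    have g: "norm (fst z) \<le> sqrt R" using n(1) by (simp add: norm_eq_sqrt_inner)
    have "\<beta> * (notwist (fst z) (snd z) \<bullet> notwist (fst z) (snd z)) \<le> R" using \<beta>(2) n(3) by (rule order_trans)
    then have t: "norm (notwist (fst z) (snd z)) \<le> sqrt (R / \<beta>)"
      using \<beta>(1) by (simp add: norm_eq_sqrt_inner field_simps)
    have "\<beta> * r \<le> \<beta> * (fst z \<bullet> fst z)" using rz \<beta>(1) by simp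
    then have Dr: "\<beta> * r \<le> D (fst z)" using \<beta>(2)[of "fst z"] by (simp add: D_def)
    have "\<bar>mult z\<bar> \<le> R / (\<beta> * r)"
      unfolding mult_def abs_divide using Dr \<beta>(1) r n(2) Dz[OF zp] by (intro frac_le) auto
    then have "norm (mult z *\<^sub>R fst z) \<le> R / (\<beta> * r) * sqrt R"
      using mult_mono[OF \<open>\<bar>mult z\<bar> \<le> R / (\<beta> * r)\<close> g] \<beta>(1) r order_trans[OF abs_ge_zero n(2)] by simp
    then have "norm (snd z) \<le> sqrt (R / \<beta>) + R / (\<beta> * r) * sqrt R"
      using t norm_triangle_ineq[of "notwist (fst z) (snd z)" "mult z *\<^sub>R fst z"] by (simp add: notwist_mult)
    then show ?thesis using norm_Pair_le[of "fst z" "snd z"] g by simp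
  qed
  then have "bounded ?C" by (rule boundedI)
  moreover have "closed ?C"
  proof -
    let ?S = "{z :: phase. r \<le> fst z \<bullet> fst z}"
    have "closed ?S" by (intro closed_Collect_le continuous_intros)
    moreover have "?S \<subseteq> punctured" using r by (auto simp: punctured_def)
    moreover have "closed P" unfolding P_def by (intro closed_Int closed_Collect_le continuous_intros closed_cball)
    ultimately have "closed (?S \<inter> integrals -` P)"
      using continuous_closed_preimage[OF continuous_on_subset[OF ci]] by blast
    moreover have "?S \<inter> integrals -` P = ?C"
      using \<open>?S \<subseteq> punctured\<close> by (auto simp: P_def integrals_def)
    ultimately show ?thesis by simp
  qed
  ultimately have "compact ?C" by (simp add: compact_eq_bounded_closed)
  then show ?thesis using KP by blast
qed

sublocale amb: confined_flow punctured ambient ambient' integrals integrals'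
  by unfold_locales
    (use open_punctured ambient_derivative ambient'_continuous integrals_derivative integrals_rate integrals_confine in auto)

section \<open>The invariant density of the ambient flow\<close>

definition weight :: "real^3 \<Rightarrow> real" where "weight \<gamma> = D \<gamma> powr (k / 2)"

definition ambient_measure :: "phase measure" where
  "ambient_measure = density lborel (\<lambda>z. ennreal (indicator punctured z * weight (fst z)))"

lemma ambient_flow_invariant:
  assumes A: "A \<in> sets borel" "A \<subseteq> punctured"
  shows "amb.\<Phi> t ` A \<in> sets borel" "emeasure ambient_measure (amb.\<Phi> t ` A) = emeasure ambient_measure A"
proof -
  have "DIM(phase) = DIM(real^6)" by simp
  then obtain \<iota> :: "phase \<Rightarrow> real^6" where \<iota>: "linear \<iota>" "bij_betw \<iota> Basis Basis"
    by (rule exists_basis_isometry)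
  define \<rho>' where "\<rho>' z v = 2 * (B (fst z) \<bullet> fst v) * (k / 2 * D (fst z) powr (k / 2 - 1))" for z v :: phase
  have \<rho>': "((\<lambda>z. weight (fst z)) has_derivative \<rho>' z) (at z)" if z: "z \<in> punctured" for z
  proof -
    have "((\<lambda>x. x powr (k / 2)) has_real_derivative (k / 2 * D (fst z) powr (k / 2 - 1))) (at (D (fst z)))"
      using Dz[OF z] by (intro has_real_derivative_powr)
    then have "((\<lambda>x. x powr (k / 2)) has_derivative (\<lambda>h. h * (k / 2 * D (fst z) powr (k / 2 - 1)))) (at (D (fst z)))"
      unfolding has_field_derivative_def by (rule has_derivative_eq_rhs) (simp add: fun_eq_iff)
    from has_derivative_compose[OF D_derivative[OF z] this]
    show ?thesis unfolding weight_def \<rho>'_def .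
  qed
  have c: "continuous_on punctured (\<lambda>z. \<rho>' z v)" for v
    unfolding \<rho>'_def
    by (intro continuous_intros D_derivative[THEN has_derivative_imp_continuous_on_open]) (auto dest: Dz)
  have pos: "weight (fst z) > 0" if "z \<in> punctured" for z
    using Dz[OF that] by (simp add: weight_def)
  have div: "\<rho>' z (ambient z) + weight (fst z) * (\<Sum>i\<in>Basis. ambient' z i \<bullet> i) = 0" if z: "z \<in> punctured" for z
  proof -
    have "weight (fst z) = D (fst z) * D (fst z) powr (k / 2 - 1)"
      using Dz[OF z] by (simp add: weight_def powr_mult_base)
    then show ?thesis
      using Dz[OF z] k_nz by (simp add: \<rho>'_def D_rate ambient_trace[OF z] drift_def)
  qed
  note inv = amb.emeasure_flow_image[OF \<iota> \<rho>' c pos div A, of t]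
  show "amb.\<Phi> t ` A \<in> sets borel" by (rule inv(1))
  show "emeasure ambient_measure (amb.\<Phi> t ` A) = emeasure ambient_measure A"
    unfolding ambient_measure_def using inv(2) .
qed

end

context rubber_rolling
begin

subsection \<open>Projection of the ambient flow\<close>

text \<open>\<open>notwist\<close> projects along \<gamma>, so it depends on \<open>K\<close> only
  modulo \<gamma> and on \<gamma> only through its line.\<close>

lemma notwist_add_radial: "\<gamma> \<noteq> 0 \<Longrightarrow> notwist \<gamma> (K + c *\<^sub>R \<gamma>) = notwist \<gamma> K"
  using D_pos[of \<gamma>]
  by (simp add: notwist_def spin_def B_simps inner_add_right add_divide_distrib D_def[symmetric] algebra_simps)

lemma notwist_scale: "r \<noteq> 0 \<Longrightarrow> notwist (r *\<^sub>R \<gamma>) K = notwist \<gamma> K"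
  by (simp add: notwist_def spin_def D_def B_simps)

definition project :: "phase \<Rightarrow> phase" where
  "project z = ((1 / norm (fst z)) *\<^sub>R fst z, k *\<^sub>R (((1 / norm (fst z)) *\<^sub>R fst z) \<times> snd z))"

text \<open>A section of \<open>project\<close> over \<open>cotangent_sphere\<close>, with values at
  norm 1 and spin 0, where the ambient field is the rolling field itself.\<close>

definition embed :: "phase \<Rightarrow> phase" where
  "embed z = (fst z, notwist (fst z) ((1/k) *\<^sub>R (snd z \<times> fst z)))"

lemma project_in: "z \<in> punctured \<Longrightarrow> project z \<in> cotangent_sphere"
  by (auto simp: project_def punctured_def cotangent_sphere_def dot_cross_self cross_mult_left)

lemma embed_in: "z \<in> cotangent_sphere \<Longrightarrow> embed z \<in> punctured"
  by (auto simp: embed_def punctured_def cotangent_sphere_def)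

lemma project_embed:
  assumes "z \<in> cotangent_sphere"
  shows "project (embed z) = z"
proof -
  obtain \<gamma> p where z: "z = (\<gamma>, p)" "norm \<gamma> = 1" "\<gamma> \<bullet> p = 0"
    using assms by (auto simp: cotangent_sphere_def)
  then have "\<gamma> \<bullet> \<gamma> = 1" using norm_eq_1 by blast
  then show ?thesis
    using z k_nz by (simp add: project_def embed_def notwist_def cross_mult_right
      Cross3.right_diff_distrib cross3_cross_right del: norm_eq_1)
qed

lemma notwist_project:
  assumes "z \<in> punctured"
  shows "notwist (fst (project z)) ((1/k) *\<^sub>R (snd (project z) \<times> fst (project z))) = notwist (fst z) (snd z)"
proof -
  define u where "u = (1 / norm (fst z)) *\<^sub>R fst z"
  have n: "norm (fst z) \<noteq> 0" using assms by (auto simp: punctured_def)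
  then have "norm u = 1" by (simp add: u_def)
  then have u: "u \<bullet> u = 1" "u \<noteq> 0" using norm_eq_1 by auto
  have "(1/k) *\<^sub>R (snd (project z) \<times> fst (project z)) = snd z + (- (u \<bullet> snd z)) *\<^sub>R u"
    using k_nz u by (simp add: project_def u_def[symmetric] cross_mult_left cross3_cross_left inner_commute)
  then have "notwist u ((1/k) *\<^sub>R (snd (project z) \<times> fst (project z))) = notwist u (snd z)"
    using notwist_add_radial[OF u(2), of "snd z" "- (u \<bullet> snd z)"] by simp
  moreover have "fst (project z) = u" by (simp add: project_def u_def)
  ultimately show ?thesis using n by (simp add: u_def notwist_scale)
qed

text \<open>For \<Omega> in place of \<open>W\<close> and \<open>M = J \<Omega>\<close>, the left
  side is the derivative of \<open>k \<gamma> \<times> M\<close> along a rolling motion; expanding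
  the double cross products cancels the component along \<open>M\<close>.\<close>

lemma momentum_identity:
  assumes "\<gamma> \<bullet> W = 0"
  shows "(\<gamma> \<times> W) \<times> M + k *\<^sub>R (\<gamma> \<times> (M \<times> W)) = ((1 - k) * (\<gamma> \<bullet> M)) *\<^sub>R W - (W \<bullet> M) *\<^sub>R \<gamma>"
  by (simp add: cross3_cross_left cross3_cross_right assms algebra_simps)

text \<open>In the derivative of \<open>\<gamma> \<times> K\<close> the radial part
  \<open>mult \<gamma>\<close> of \<open>K\<close> contributes through the motion of \<gamma>, and
  the term \<open>(mult / k) (\<gamma> \<times> \<Omega>)\<close> of the field cancels exactly that.
  The constant norm of \<gamma> factors out, since \<Omega> depends only on the line of
  \<gamma>.\<close>

lemma project_ambient_flow:
  assumes w: "w \<in> punctured"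
  shows "((\<lambda>t. project (amb.\<Phi> t w)) has_vector_derivative reduced_vf (project (amb.\<Phi> t w))) (at t)"
proof -
  define r where "r = norm (fst w)"
  have r: "r > 0" using w by (auto simp: r_def punctured_def)
  have "integrals (amb.\<Phi> s w) = integrals w" for s by (rule amb.first_integral[OF w])
  then have nr: "norm (fst (amb.\<Phi> s w)) = r" for s
    by (simp add: integrals_def r_def norm_eq_sqrt_inner)
  have proj: "project (amb.\<Phi> s w) = ((1/r) *\<^sub>R fst (amb.\<Phi> s w), (k/r) *\<^sub>R (fst (amb.\<Phi> s w) \<times> snd (amb.\<Phi> s w)))" for s
    by (simp add: project_def nr cross_mult_left)
  define z where "z = amb.\<Phi> t w"
  have z: "z \<in> punctured" unfolding z_def by (rule amb.\<Phi>_in[OF w])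
  define \<gamma> where "\<gamma> = (1/r) *\<^sub>R fst z"
  define M where "M = notwist (fst z) (snd z)"
  have d: "((\<lambda>t. amb.\<Phi> t w) has_derivative (\<lambda>h. h *\<^sub>R ambient z)) (at t)"
    using amb.\<Phi>_derivative[OF w] by (simp add: has_vector_derivative_def z_def)
  have "((\<lambda>t. project (amb.\<Phi> t w)) has_derivative
      (\<lambda>h. h *\<^sub>R ((1/r) *\<^sub>R fst (ambient z), (k/r) *\<^sub>R (fst (ambient z) \<times> snd z + fst z \<times> snd (ambient z))))) (at t)"
    unfolding proj
    by (rule derivative_eq_intros d refl)+
      (simp add: fun_eq_iff z_def[symmetric] cross_mult_left cross_mult_right algebra_simps)
  moreover have "reduced_vf (project z) = ((1/r) *\<^sub>R fst (ambient z), (k/r) *\<^sub>R (fst (ambient z) \<times> snd z + fst z \<times> snd (ambient z)))"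
  proof -
    have f: "fst z = r *\<^sub>R \<gamma>" using r by (simp add: \<gamma>_def)
    have pz: "fst (project z) = \<gamma>" using proj[of t] by (simp add: z_def \<gamma>_def)
    have W: "\<Omega> z = B M" by (simp add: \<Omega>_def M_def)
    have orth: "\<gamma> \<bullet> B M = 0" using twist_free[OF z] r by (simp add: f W)
    have K: "snd z = M + mult z *\<^sub>R fst z" by (simp add: M_def notwist_mult)
    have "reduced_vf (project z) = ((1/k) *\<^sub>R (\<gamma> \<times> B M), ((1 - k) * (\<gamma> \<bullet> M)) *\<^sub>R B M - (B M \<bullet> M) *\<^sub>R \<gamma>)"
      using notwist_project[OF z] by (simp add: reduced_vf_def case_prod_beta pz M_def Let_def)
    also have "\<dots> = ((1/k) *\<^sub>R (\<gamma> \<times> B M), (\<gamma> \<times> B M) \<times> M + k *\<^sub>R (\<gamma> \<times> (M \<times> B M)))"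
      by (simp add: momentum_identity[OF orth])
    also have "(\<gamma> \<times> B M) \<times> M + k *\<^sub>R (\<gamma> \<times> (M \<times> B M))
        = (k/r) *\<^sub>R (fst (ambient z) \<times> snd z + fst z \<times> snd (ambient z))"
    proof -
      have 1: "fst (ambient z) = (r/k) *\<^sub>R (\<gamma> \<times> B M)" by (simp add: ambient_def W f cross_mult_left)
      have 2: "fst z \<times> snd (ambient z) = r *\<^sub>R (\<gamma> \<times> (M \<times> B M)) + (r * r * mult z / k) *\<^sub>R (\<gamma> \<times> (\<gamma> \<times> B M))"
        unfolding ambient_def W M_def[symmetric] by (simp add: f cross_mult_left cross_mult_right cross_add_right)
      have 3: "fst (ambient z) \<times> snd z = (r/k) *\<^sub>R ((\<gamma> \<times> B M) \<times> M) + (r * r * mult z / k) *\<^sub>R ((\<gamma> \<times> B M) \<times> \<gamma>)"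
        unfolding K 1 by (simp add: f cross_mult_left cross_mult_right cross_add_right)
      have 4: "(\<gamma> \<times> B M) \<times> \<gamma> = - (\<gamma> \<times> (\<gamma> \<times> B M))" by (rule cross_skew)
      show ?thesis unfolding 2 3 4 using r k_nz by (simp add: algebra_simps)
    qed
    also have "(1/k) *\<^sub>R (\<gamma> \<times> B M) = (1/r) *\<^sub>R fst (ambient z)"
      using r by (simp add: ambient_def W f cross_mult_left)
    finally show ?thesis .
  qed
  ultimately show ?thesis by (simp add: has_vector_derivative_def z_def)
qed

lemma C1_reduced_vf: "C1_on punctured reduced_vf"
proof -
  note li = C1_on_linear[OF bounded_linear_B]
  have D: "C1_on punctured (\<lambda>z. inverse (D (fst z)))"
    unfolding D_def by (intro C1_on_inverse C1_on_intros li) (use D_pos in \<open>auto simp: punctured_def D_def[symmetric] less_imp_neq[symmetric]\<close>)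
  define N where "N z = notwist (fst z) ((1/k) *\<^sub>R (snd z \<times> fst z))" for z :: phase
  have N: "C1_on punctured N"
    unfolding N_def notwist_def spin_def divide_inverse by (intro C1_on_intros li D)
  have "reduced_vf = (\<lambda>z. ((1/k) *\<^sub>R (fst z \<times> B (N z)),
      ((1 - k) * (fst z \<bullet> N z)) *\<^sub>R B (N z) - (B (N z) \<bullet> N z) *\<^sub>R fst z))"
    by (auto simp: reduced_vf_def N_def Let_def fun_eq_iff)
  then show ?thesis using N by (simp only:) (intro C1_on_intros li N)
qed

lemma cotangent_subset_punctured: "cotangent_sphere \<subseteq> punctured"
  by (auto simp: cotangent_sphere_def punctured_def)

text \<open>Projected ambient curves provide solutions for all times, and \<open>reduced_vf\<close>
  is C1 on the open set \<open>punctured\<close>, so there are no others; the flow relation is the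
  graph of a map.\<close>

lemma flow_reduced_vf:
  "(z, z') \<in> flow cotangent_sphere reduced_vf t \<longleftrightarrow> z \<in> cotangent_sphere \<and> z' = project (amb.\<Phi> t (embed z))"
proof
  assume "(z, z') \<in> flow cotangent_sphere reduced_vf t"
  then obtain J y where y: "open J" "is_interval J" "0 \<in> J" "t \<in> J" "y 0 = z" "y t = z'"
    "\<And>s. s \<in> J \<Longrightarrow> y s \<in> cotangent_sphere \<and> (y has_vector_derivative reduced_vf (y s)) (at s)"
    unfolding flow_def by blast
  have z: "z \<in> cotangent_sphere" using y by blast
  have "y t = project (amb.\<Phi> t (embed z))"
  proof (rule C1_flow_unique[OF open_punctured C1_reduced_vf y(2-4)])
    show "y s \<in> punctured \<and> (y has_vector_derivative reduced_vf (y s)) (at s)" if "s \<in> J" for s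
      using y(7)[OF that] cotangent_subset_punctured by blast
    show "project (amb.\<Phi> s (embed z)) \<in> punctured \<and>
        ((\<lambda>s. project (amb.\<Phi> s (embed z))) has_vector_derivative reduced_vf (project (amb.\<Phi> s (embed z)))) (at s)" for s
      using project_in[OF amb.\<Phi>_in[OF embed_in[OF z]]] cotangent_subset_punctured
        project_ambient_flow[OF embed_in[OF z]] by blast
    show "y 0 = project (amb.\<Phi> 0 (embed z))"
      by (simp add: y(5) amb.\<Phi>_0[OF embed_in[OF z]] project_embed[OF z])
  qed
  then show "z \<in> cotangent_sphere \<and> z' = project (amb.\<Phi> t (embed z))" using z y(6) by simp
next
  assume z: "z \<in> cotangent_sphere \<and> z' = project (amb.\<Phi> t (embed z))"
  then have e: "embed z \<in> punctured" using embed_in by blast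
  show "(z, z') \<in> flow cotangent_sphere reduced_vf t"
    unfolding flow_def
    by (auto intro!: exI[of _ UNIV] exI[of _ "\<lambda>s. project (amb.\<Phi> s (embed z))"]
        project_in amb.\<Phi>_in e project_ambient_flow simp: z amb.\<Phi>_0[OF e] project_embed)
qed

end

section \<open>Rolling motions and the reduced field\<close>

lemma linear_hat: "linear hat"
  by (intro linearI) (simp_all add: hat_def matrix_def vec_eq_iff cross_add_left cross_mult_left)

lemma hat_mult: "hat w *v u = w \<times> u"
proof -
  have "linear ((\<times>) w)" by (intro linearI) (simp_all add: cross_add_right cross_mult_right)
  then show ?thesis by (simp add: hat_def matrix_works)
qed

lemma transpose_hat: "transpose (hat w) = - hat w"
  by (simp add: vec_eq_iff forall_3 transpose_def hat_def matrix_def cross3_simps axis_def)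

lemma linear_vee: "linear vee"
  by (intro linearI) (simp_all add: vee_def vec_eq_iff forall_3 algebra_simps)

lemma bounded_linear_vee: "bounded_linear vee" and bounded_linear_hat: "bounded_linear hat"
  using linear_vee linear_hat by (simp_all add: linear_conv_bounded_linear)

lemma matrix_add_mult: "(A + B) ** (C :: real^'n^'n) = A ** C + B ** C" "C ** (A + B) = C ** A + C ** B"
  by (simp_all add: matrix_matrix_mult_def vec_eq_iff sum.distrib algebra_simps)

lemma matrix_scaleR_mult: "(c *\<^sub>R A) ** (C :: real^'n^'n) = c *\<^sub>R (A ** C)" "C ** (c *\<^sub>R A) = c *\<^sub>R (C ** A)"
  by (simp_all add: matrix_matrix_mult_def vec_eq_iff sum_distrib_left algebra_simps)

lemma bounded_bilinear_matrix_mult: "bounded_bilinear (\<lambda>(A :: real^'n^'n) (B :: real^'n^'n). A ** B)"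
  unfolding bilinear_conv_bounded_bilinear[symmetric] bilinear_def
  by (auto intro!: linearI simp: matrix_add_mult matrix_scaleR_mult)

lemma bounded_bilinear_matrix_vector_mult: "bounded_bilinear (\<lambda>(A :: real^'n^'n) v. A *v v)"
  unfolding bilinear_conv_bounded_bilinear[symmetric] bilinear_def
  by (auto intro!: linearI simp: matrix_vector_mult_def vec_eq_iff sum.distrib sum_distrib_left algebra_simps)

lemma bounded_linear_transpose: "bounded_linear (transpose :: real^'n^'n \<Rightarrow> real^'n^'n)"
  unfolding linear_conv_bounded_linear[symmetric] by (intro linearI) (simp_all add: transpose_def vec_eq_iff)

lemma hat_commutator: "vee (hat x ** hat y - hat y ** hat x) = x \<times> y"
proof -
  have "hat x ** hat y - hat y ** hat x = hat (x \<times> y)"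
    unfolding matrix_eq
    by (simp add: matrix_vector_mult_diff_rdistrib matrix_vector_mul_assoc[symmetric] hat_mult
        cross3_cross_right cross3_cross_left inner_commute algebra_simps)
  then show ?thesis by (simp add: vee_hat)
qed

lemma rotation_matrixD:
  fixes R :: "real^3^3"
  assumes "rotation_matrix R"
  shows "transpose R ** R = mat 1" "R ** transpose R = mat 1" "matrix_inv R = transpose R"
    "transpose R *v (R *v x) = x" "R *v (transpose R *v x) = x" "(R *v x) \<bullet> (R *v y) = x \<bullet> y"
    "rotation_matrix (transpose R)"
proof -
  show 1: "transpose R ** R = mat 1" and 2: "R ** transpose R = mat 1"
    using assms by (auto simp: rotation_matrix_def orthogonal_matrix_def)
  show "matrix_inv R = transpose R"
  proof -
    have "R ** matrix_inv R = mat 1 \<and> matrix_inv R ** R = mat 1"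
      unfolding matrix_inv_def by (rule someI[of _ "transpose R"]) (use 1 2 in blast)
    then have "matrix_inv R ** R = mat 1" ..
    then have "matrix_inv R ** R ** transpose R = transpose R" by simp
    then show ?thesis by (simp add: matrix_mul_assoc[symmetric] 2)
  qed
  show tr: "transpose R *v (R *v x) = x" for x by (simp only: matrix_vector_mul_assoc 1 matrix_vector_mul_lid)
  show "R *v (transpose R *v x) = x" by (simp only: matrix_vector_mul_assoc 2 matrix_vector_mul_lid)
  show "(R *v x) \<bullet> (R *v y) = x \<bullet> y"
    using dot_lmul_matrix[of "R *v x" R y] tr[of x] by simp
  show "rotation_matrix (transpose R)" using assms by (simp add: rotation_matrix_def)
qed

lemma hat_conjugate:
  assumes "rotation_matrix R"
  shows "R ** hat w = hat (R *v w) ** R"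
  unfolding matrix_eq
  by (simp add: matrix_vector_mul_assoc[symmetric] hat_mult cross_rotation_matrix[OF assms])

lemma has_vector_derivative_linear:
  assumes "bounded_linear l" "(f has_vector_derivative d) F"
  shows "((\<lambda>t. l (f t)) has_vector_derivative l d) F"
  by (rule bounded_linear.has_vector_derivative[OF assms])

lemma has_derivative_norm_squared:
  "((\<lambda>x. (norm (fst x :: 'n::euclidean_space))\<^sup>2) has_derivative (\<lambda>h. 2 * (fst x \<bullet> fst h))) (at x)"
  unfolding power2_norm_eq_inner
  by (rule derivative_eq_intros refl)+ (simp add: fun_eq_iff inner_commute)

lemma continuous_on_hat [continuous_intros]: "continuous_on S f \<Longrightarrow> continuous_on S (\<lambda>x. hat (f x))"
  by (rule bounded_linear.continuous_on[OF bounded_linear_hat])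

text \<open>As \<open>hat\<close> is skew, \<open>R R\<^sup>T\<close> has derivative 0 and remains
  the identity. The determinant is then 1 or -1, and by continuity it cannot jump from its initial
  value 1.\<close>

lemma attitude_rotation:
  fixes R :: "real \<Rightarrow> real^3^3"
  assumes R0: "R 0 = mat 1" and R': "\<And>t. t \<in> ball 0 \<epsilon> \<Longrightarrow> (R has_vector_derivative R t ** hat (W t)) (at t)"
    and t: "t \<in> ball 0 \<epsilon>"
  shows "rotation_matrix (R t)"
proof -
  have orth: "orthogonal_matrix (R s)" if s: "s \<in> ball 0 \<epsilon>" for s
  proof -
    have "((\<lambda>s. R s ** transpose (R s)) has_derivative (\<lambda>h. 0)) (at s within ball 0 \<epsilon>)" if "s \<in> ball 0 \<epsilon>" for s
    proof -
      have "((\<lambda>s. R s ** transpose (R s)) has_vector_derivative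
          R s ** transpose (R s ** hat (W s)) + (R s ** hat (W s)) ** transpose (R s)) (at s)"
        by (intro bounded_bilinear.has_vector_derivative[OF bounded_bilinear_matrix_mult]
            bounded_linear.has_vector_derivative[OF bounded_linear_transpose] R' that)
      moreover have "R s ** transpose (R s ** hat (W s)) = - ((R s ** hat (W s)) ** transpose (R s))"
      proof -
        have "R s ** transpose (R s ** hat (W s)) = R s ** ((- hat (W s)) ** transpose (R s))"
          by (simp only: matrix_transpose_mul transpose_hat)
        also have "\<dots> = - (R s ** (hat (W s) ** transpose (R s)))"
          using matrix_scaleR_mult(1)[of "-1" "hat (W s)" "transpose (R s)"]
            matrix_scaleR_mult(2)[of "R s" "-1" "hat (W s) ** transpose (R s)"] by simp
        finally show ?thesis by (simp only: matrix_mul_assoc)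
      qed
      ultimately have "((\<lambda>s. R s ** transpose (R s)) has_vector_derivative 0) (at s)" by simp
      then show ?thesis by (simp add: has_vector_derivative_def has_derivative_at_withinI)
    qed
    from has_derivative_zero_constant[OF convex_ball this]
    obtain c where c: "\<And>s. s \<in> ball 0 \<epsilon> \<Longrightarrow> R s ** transpose (R s) = c" by blast
    have "0 \<in> ball (0::real) \<epsilon>" using s by (auto simp: dist_norm intro: le_less_trans[OF norm_ge_zero])
    from c[OF this] have "c = mat 1" by (simp add: R0)
    then have "orthogonal_matrix (transpose (R s))" using c[OF s] unfolding orthogonal_matrix by simp
    then show ?thesis by simp
  qed
  have "continuous_on (ball 0 \<epsilon>) R"
    by (intro continuous_at_imp_continuous_on ballI has_vector_derivative_continuous[OF R'])
  then have "continuous_on (ball 0 \<epsilon>) (\<lambda>s. det (R s))"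
    unfolding det_3 by (intro continuous_intros)
  then have con: "connected ((\<lambda>s. det (R s)) ` ball 0 \<epsilon>)" by (rule connected_continuous_image) (rule connected_ball)
  have "0 \<in> ball (0::real) \<epsilon>" using t by (auto simp: dist_norm intro: le_less_trans[OF norm_ge_zero])
  then have one: "1 \<in> (\<lambda>s. det (R s)) ` ball 0 \<epsilon>" by (intro image_eqI[of _ _ 0]) (simp_all add: R0)
  have "det (R t) = 1"
  proof (rule ccontr)
    assume "det (R t) \<noteq> 1"
    then have "det (R t) = - 1" using det_orthogonal_matrix[OF orth[OF t]] by blast
    then have "- 1 \<in> (\<lambda>s. det (R s)) ` ball 0 \<epsilon>" using t by force
    then have "{- 1..1} \<subseteq> (\<lambda>s. det (R s)) ` ball 0 \<epsilon>" by (rule connected_contains_Icc[OF con _ one])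
    then have "0 \<in> (\<lambda>s. det (R s)) ` ball 0 \<epsilon>" by auto
    then obtain s where "s \<in> ball 0 \<epsilon>" "det (R s) = 0" by auto
    then show False using det_orthogonal_matrix[OF orth] by force
  qed
  then show ?thesis using orth[OF t] by (simp add: rotation_matrix_def)
qed

lemma flow_cong:
  assumes "\<And>z. z \<in> N \<Longrightarrow> X z = Y z"
  shows "flow N X t = flow N Y t"
proof -
  have "(\<forall>s\<in>J. z s \<in> N \<and> (z has_vector_derivative X (z s)) (at s)) \<longleftrightarrow>
      (\<forall>s\<in>J. z s \<in> N \<and> (z has_vector_derivative Y (z s)) (at s))" for J z
    using assms by (metis (no_types, lifting))
  then show ?thesis unfolding flow_def by simp
qed

section \<open>Constraints and Lagrangian in the body frame\<close>

context rubber_rolling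
begin

abbreviation A :: "real^3^3" where "A \<equiv> diag3 I\<^sub>1 I\<^sub>2 I\<^sub>3"

lemma A_eq: "A *v v = J v - (\<mu> * b\<^sup>2) *\<^sub>R v"
  by (simp add: J_eq)

lemma A_sym: "(A *v v) \<bullet> w = (A *v w) \<bullet> v"
  using J_sym[of v w] by (simp add: A_eq inner_diff_left inner_diff_right inner_commute)

definition body_velocity :: "config \<Rightarrow> config \<Rightarrow> real^3" where
  "body_velocity x v = vee (transpose (snd x) ** snd v)"

text \<open>Conjugation by the attitude carries \<omega> to \<open>W\<close> and \<open>q\<close> to
  \<open>a \<gamma>\<close>. No twist becomes orthogonality of \<open>W\<close> and \<gamma>, and no
  slip is solved for the velocity of \<open>q\<close> because \<open>k\<close> is nonzero.\<close>

lemma constraint_body: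
  assumes x: "x \<in> config_space a" and v: "v \<in> rubber_distribution a b x"
  defines "\<gamma> \<equiv> reduced_position a x" and "W \<equiv> body_velocity x v"
  shows "rotation_matrix (snd x)" "fst x = a *\<^sub>R (snd x *v \<gamma>)" "norm \<gamma> = 1" "\<gamma> \<bullet> W = 0"
    "snd v = snd x ** hat W" "fst v = (b / k) *\<^sub>R (snd x *v (W \<times> \<gamma>))"
proof -
  obtain q R where xq: "x = (q, R)" by (cases x)
  have R: "rotation_matrix R" and q: "norm q = a" using x by (auto simp: xq config_space_def)
  obtain u \<omega> where vu: "v = (u, hat \<omega> ** R)" and u: "(1 + b/a) *\<^sub>R u = (b/a) *\<^sub>R (\<omega> \<times> q)" and tw: "\<omega> \<bullet> q = 0"
    using v by (auto simp: xq rubber_distribution_def)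
  note RD = rotation_matrixD[OF R]
  show "rotation_matrix (snd x)" by (simp add: xq R)
  have g: "\<gamma> = (1/a) *\<^sub>R (transpose R *v q)" by (simp add: \<gamma>_def xq reduced_position_def RD(3))
  have Rg: "R *v \<gamma> = (1/a) *\<^sub>R q" unfolding g by (simp only: matrix_vector_mult_scaleR RD(5))
  show qR: "fst x = a *\<^sub>R (snd x *v \<gamma>)" using a by (simp add: xq Rg)
  have "\<gamma> \<bullet> \<gamma> = (1/a) *\<^sub>R q \<bullet> (1/a) *\<^sub>R q" unfolding Rg[symmetric] by (rule RD(6)[symmetric])
  also have "\<dots> = 1" using q a by (simp add: dot_square_norm power2_eq_square)
  finally show "norm \<gamma> = 1" by (simp add: norm_eq_1)
  define w where "w = transpose R *v \<omega>"
  have \<omega>: "\<omega> = R *v w" unfolding w_def by (rule RD(5)[symmetric])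
  have V: "hat \<omega> ** R = R ** hat w" unfolding \<omega> by (rule hat_conjugate[OF R, symmetric])
  have W: "W = w"
    by (simp add: W_def body_velocity_def xq vu V matrix_mul_assoc RD(1) vee_hat)
  show "snd v = snd x ** hat W" by (simp add: vu V W xq)
  have "\<omega> \<bullet> q = \<omega> \<bullet> (a *\<^sub>R (R *v \<gamma>))" using qR by (simp add: xq)
  also have "\<dots> = a * (w \<bullet> \<gamma>)" unfolding \<omega> inner_scaleR_right RD(6) ..
  finally have "a * (w \<bullet> \<gamma>) = \<omega> \<bullet> q" ..
  then show "\<gamma> \<bullet> W = 0" using tw a by (simp add: W inner_commute)
  have "u = (1 / k) *\<^sub>R (k *\<^sub>R u)" using k_nz by simp
  also have "k *\<^sub>R u = (b/a) *\<^sub>R ((R *v w) \<times> (a *\<^sub>R (R *v \<gamma>)))" using u qR by (simp add: k_def \<omega>[symmetric] xq)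
  also have "\<dots> = b *\<^sub>R (R *v (w \<times> \<gamma>))" using a by (simp add: cross_mult_right cross_rotation_matrix[OF R])
  finally show "fst v = (b / k) *\<^sub>R (snd x *v (W \<times> \<gamma>))" by (simp add: vu xq W)
qed

text \<open>Converse of \<open>constraint_body\<close>: the virtual displacements at a configuration
  are parametrized by the vectors \<open>N\<close> orthogonal to \<gamma>, which serve as test
  vectors in the equations of motion.\<close>

lemma body_distribution:
  assumes R: "rotation_matrix R" and "N \<bullet> \<gamma> = 0"
  shows "((b / k) *\<^sub>R (R *v (N \<times> \<gamma>)), R ** hat N) \<in> rubber_distribution a b (a *\<^sub>R (R *v \<gamma>), R)"
proof -
  have "(1 + b/a) *\<^sub>R ((b / k) *\<^sub>R (R *v (N \<times> \<gamma>))) = (b/a) *\<^sub>R ((R *v N) \<times> (a *\<^sub>R (R *v \<gamma>)))"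
    using a k_nz by (simp add: k_def[symmetric] cross_mult_right cross_rotation_matrix[OF R])
  then show ?thesis
    using assms(2) a by (auto simp: rubber_distribution_def hat_conjugate[OF R] rotation_matrixD(6)[OF R]
        intro!: exI[of _ "R *v N"])
qed

lemma has_derivative_A: "(f has_derivative f') F \<Longrightarrow> ((\<lambda>x. A *v f x) has_derivative (\<lambda>x. A *v f' x)) F"
  by (rule bounded_linear.has_derivative[OF bounded_bilinear.bounded_linear_right[OF bounded_bilinear_matrix_vector_mult]])

lemma lagrangian_velocity_derivative:
  "frechet_derivative (rolling_lagrangian a b \<mu> A x) (at v) \<delta>
    = \<mu> * k\<^sup>2 * (fst v \<bullet> fst \<delta>) + (A *v body_velocity x v) \<bullet> body_velocity x \<delta>"
proof -
  have L: "rolling_lagrangian a b \<mu> A x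
      = (\<lambda>v. (1/2) * (\<mu> * k\<^sup>2 * (norm (fst v))\<^sup>2 + (A *v body_velocity x v) \<bullet> body_velocity x v))"
    by (auto simp: fun_eq_iff rolling_lagrangian_def body_velocity_def k_def Let_def split: prod.splits)
  have bl: "bounded_linear (body_velocity x)"
    unfolding body_velocity_def
    by (intro bounded_linear_compose[OF bounded_linear_vee]
        bounded_linear_compose[OF bounded_bilinear.bounded_linear_right[OF bounded_bilinear_matrix_mult]] bounded_linear_snd)
  have "((\<lambda>v. (1/2) * (\<mu> * k\<^sup>2 * (norm (fst v))\<^sup>2 + (A *v body_velocity x v) \<bullet> body_velocity x v)) has_derivative
      (\<lambda>\<delta>. \<mu> * k\<^sup>2 * (fst v \<bullet> fst \<delta>) + (A *v body_velocity x v) \<bullet> body_velocity x \<delta>)) (at v)"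
    by (rule derivative_eq_intros has_derivative_norm_squared has_derivative_A bounded_linear_imp_has_derivative[OF bl] refl)+
      (simp add: fun_eq_iff A_sym[of "body_velocity x _" "body_velocity x v"] algebra_simps)
  from frechet_derivative_at[OF this] show ?thesis unfolding L by metis
qed

text \<open>\<open>body_velocity\<close> is linear in the configuration as well as in the velocity,
  so the rotational energy is a quadratic form in either argument.\<close>

lemma lagrangian_position_derivative:
  "frechet_derivative (\<lambda>y. rolling_lagrangian a b \<mu> A y v) (at x) \<delta>
    = (A *v body_velocity x v) \<bullet> body_velocity \<delta> v"
proof -
  have L: "(\<lambda>y. rolling_lagrangian a b \<mu> A y v)
      = (\<lambda>y. (1/2) * (\<mu> * k\<^sup>2 * (norm (fst v))\<^sup>2 + (A *v body_velocity y v) \<bullet> body_velocity y v))"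
    by (auto simp: fun_eq_iff rolling_lagrangian_def body_velocity_def k_def Let_def split: prod.splits)
  have bl: "bounded_linear (\<lambda>y. body_velocity y v)"
    unfolding body_velocity_def
    by (intro bounded_linear_compose[OF bounded_linear_vee]
        bounded_linear_compose[OF bounded_bilinear.bounded_linear_left[OF bounded_bilinear_matrix_mult]]
        bounded_linear_compose[OF bounded_linear_transpose] bounded_linear_snd)
  have "((\<lambda>y. (1/2) * (\<mu> * k\<^sup>2 * (norm (fst v))\<^sup>2 + (A *v body_velocity y v) \<bullet> body_velocity y v)) has_derivative
      (\<lambda>\<delta>. (A *v body_velocity x v) \<bullet> body_velocity \<delta> v)) (at x)"
    by (rule derivative_eq_intros has_derivative_A bounded_linear_imp_has_derivative[OF bl] refl)+
      (simp add: fun_eq_iff A_sym[of "body_velocity _ v" "body_velocity x v"])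
  from frechet_derivative_at[OF this] show ?thesis unfolding L by metis
qed

end

text \<open>Kinematics only: the same computations serve a given rolling motion and a constructed
  curve that has yet to be shown to satisfy the dynamics.\<close>

locale constrained_motion = rubber_rolling +
  fixes T :: "real set" and x v w :: "real \<Rightarrow> config"
  assumes T: "open T"
    and config: "\<And>t. t \<in> T \<Longrightarrow> x t \<in> config_space a"
    and x': "\<And>t. t \<in> T \<Longrightarrow> (x has_vector_derivative v t) (at t)"
    and v': "\<And>t. t \<in> T \<Longrightarrow> (v has_vector_derivative w t) (at t)"
    and constraint: "\<And>t. t \<in> T \<Longrightarrow> v t \<in> rubber_distribution a b (x t)"
begin

definition R :: "real \<Rightarrow> real^3^3" where "R t = snd (x t)"
definition \<gamma> :: "real \<Rightarrow> real^3" where "\<gamma> t = reduced_position a (x t)"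
definition W :: "real \<Rightarrow> real^3" where "W t = body_velocity (x t) (v t)"
definition W' :: "real \<Rightarrow> real^3" where
  "W' t = vee (transpose (R t ** hat (W t)) ** (R t ** hat (W t)) + transpose (R t) ** snd (w t))"

lemma body:
  assumes "t \<in> T"
  shows "rotation_matrix (R t)" "fst (x t) = a *\<^sub>R (R t *v \<gamma> t)" "norm (\<gamma> t) = 1" "\<gamma> t \<bullet> W t = 0"
    "snd (v t) = R t ** hat (W t)" "fst (v t) = (b / k) *\<^sub>R (R t *v (W t \<times> \<gamma> t))" "\<gamma> t \<bullet> \<gamma> t = 1"
  using constraint_body[OF config[OF assms] constraint[OF assms]]
  by (simp_all add: R_def \<gamma>_def W_def norm_eq_1)

lemma R': "t \<in> T \<Longrightarrow> (R has_vector_derivative R t ** hat (W t)) (at t)"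
  using has_vector_derivative_linear[OF bounded_linear_snd x'] body(5) by (simp add: R_def[abs_def])

lemma \<gamma>':
  assumes t: "t \<in> T"
  shows "(\<gamma> has_vector_derivative (1/k) *\<^sub>R (\<gamma> t \<times> W t)) (at t)"
proof -
  have "((\<lambda>s. (1/a) *\<^sub>R (transpose (R s) *v fst (x s))) has_vector_derivative
      (1/a) *\<^sub>R (transpose (R t) *v fst (v t) + transpose (R t ** hat (W t)) *v fst (x t))) (at t)"
    by (intro has_vector_derivative_linear[OF bounded_linear_scaleR_right]
        bounded_bilinear.has_vector_derivative[OF bounded_bilinear_matrix_vector_mult]
        has_vector_derivative_linear[OF bounded_linear_transpose] R'[OF t]
        has_vector_derivative_linear[OF bounded_linear_fst x'[OF t]])
  moreover have "(1/a) *\<^sub>R (transpose (R t) *v fst (v t) + transpose (R t ** hat (W t)) *v fst (x t)) = (1/k) *\<^sub>R (\<gamma> t \<times> W t)"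
  proof -
    note RD = rotation_matrixD[OF body(1)[OF t]]
    have "transpose (R t ** hat (W t)) *v fst (x t) = - (a *\<^sub>R (W t \<times> \<gamma> t))"
      unfolding body(2)[OF t] matrix_transpose_mul transpose_hat matrix_vector_mul_assoc[symmetric]
      by (simp only: matrix_vector_mult_scaleR RD(4)
        bounded_bilinear.minus_left[OF bounded_bilinear_matrix_vector_mult] hat_mult scaleR_minus_right)
    moreover have "transpose (R t) *v fst (v t) = (b / k) *\<^sub>R (W t \<times> \<gamma> t)"
      unfolding body(6)[OF t] by (simp only: matrix_vector_mult_scaleR RD(4))
    \<comment> \<open>From \<open>a * k = a + b\<close>; this is the origin of the factor
      \<open>1 / k\<close> in the motion of \<gamma>.\<close>
    moreover have "b / k - a = - a / k"
    proof -
      have "b - a * k = - a" using a by (simp add: k_def algebra_simps)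
      then have "(b - a * k) / k = - a / k" by simp
      then show ?thesis using k_nz by (simp add: diff_divide_distrib)
    qed
    moreover have "(b / k) *\<^sub>R (W t \<times> \<gamma> t) + - (a *\<^sub>R (W t \<times> \<gamma> t)) = (b / k - a) *\<^sub>R (W t \<times> \<gamma> t)"
      by (simp add: scaleR_left_diff_distrib)
    ultimately have "transpose (R t) *v fst (v t) + transpose (R t ** hat (W t)) *v fst (x t) = (- a / k) *\<^sub>R (W t \<times> \<gamma> t)"
      by simp
    then show ?thesis using a cross_skew[of "\<gamma> t" "W t"] by simp
  qed
  ultimately have d: "((\<lambda>s. (1/a) *\<^sub>R (transpose (R s) *v fst (x s))) has_vector_derivative (1/k) *\<^sub>R (\<gamma> t \<times> W t)) (at t)"
    by simp
  have "\<gamma> s = (1/a) *\<^sub>R (transpose (R s) *v fst (x s))" if "s \<in> T" for s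
    using rotation_matrixD(3)[OF body(1)[OF that]]
    by (simp add: \<gamma>_def reduced_position_def R_def case_prod_beta)
  then show ?thesis
    by (intro has_vector_derivative_transform_within_open[OF d T t]) simp
qed

lemma W_derivative:
  assumes t: "t \<in> T"
  shows "(W has_vector_derivative W' t) (at t)"
proof -
  have "((\<lambda>s. vee (transpose (R s) ** snd (v s))) has_vector_derivative
      vee (transpose (R t) ** snd (w t) + transpose (R t ** hat (W t)) ** snd (v t))) (at t)"
    by (intro has_vector_derivative_linear[OF bounded_linear_vee]
        bounded_bilinear.has_vector_derivative[OF bounded_bilinear_matrix_mult]
        has_vector_derivative_linear[OF bounded_linear_transpose] R'[OF t]
        has_vector_derivative_linear[OF bounded_linear_snd v'[OF t]])
  moreover have e: "(\<lambda>s. vee (transpose (R s) ** snd (v s))) = W"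
    by (simp add: fun_eq_iff W_def body_velocity_def R_def)
  moreover have e2: "vee (transpose (R t) ** snd (w t) + transpose (R t ** hat (W t)) ** snd (v t)) = W' t"
    by (simp add: W'_def body(5)[OF t] add.commute)
  ultimately show ?thesis by (simp only:)
qed

text \<open>The centripetal terms are all along \<gamma>, normal to the sphere, so they do no work
  in an admissible displacement, whose translational part is a multiple of
  \<open>R (N \<times> \<gamma>)\<close>.\<close>

lemma acceleration:
  assumes t: "t \<in> T"
  shows "fst (w t) = (b / k) *\<^sub>R (R t *v (W' t \<times> \<gamma> t - (W t \<bullet> W t * (1 - 1 / k)) *\<^sub>R \<gamma> t))"
proof -
  have "((\<lambda>s. (b / k) *\<^sub>R (R s *v (W s \<times> \<gamma> s))) has_vector_derivative
      (b / k) *\<^sub>R (R t *v (W t \<times> ((1/k) *\<^sub>R (\<gamma> t \<times> W t)) + W' t \<times> \<gamma> t) + (R t ** hat (W t)) *v (W t \<times> \<gamma> t))) (at t)"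
    by (intro has_vector_derivative_linear[OF bounded_linear_scaleR_right]
        bounded_bilinear.has_vector_derivative[OF bounded_bilinear_matrix_vector_mult]
        bounded_bilinear.has_vector_derivative[OF bounded_bilinear_cross3] R' \<gamma>' W_derivative t)
  then have "((\<lambda>s. fst (v s)) has_vector_derivative
      (b / k) *\<^sub>R (R t *v (W t \<times> ((1/k) *\<^sub>R (\<gamma> t \<times> W t)) + W' t \<times> \<gamma> t) + (R t ** hat (W t)) *v (W t \<times> \<gamma> t))) (at t)"
    by (rule has_vector_derivative_transform_within_open[OF _ T t]) (simp add: body(6))
  then have "fst (w t) = (b / k) *\<^sub>R (R t *v (W t \<times> ((1/k) *\<^sub>R (\<gamma> t \<times> W t)) + W' t \<times> \<gamma> t) + (R t ** hat (W t)) *v (W t \<times> \<gamma> t))"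
    using has_vector_derivative_linear[OF bounded_linear_fst v'[OF t]] vector_derivative_unique_at by blast
  also have "\<dots> = (b / k) *\<^sub>R (R t *v (W t \<times> ((1/k) *\<^sub>R (\<gamma> t \<times> W t)) + W' t \<times> \<gamma> t + W t \<times> (W t \<times> \<gamma> t)))"
    by (simp only: matrix_vector_mul_assoc[symmetric] hat_mult matrix_vector_right_distrib)
  also have "W t \<times> ((1/k) *\<^sub>R (\<gamma> t \<times> W t)) + W' t \<times> \<gamma> t + W t \<times> (W t \<times> \<gamma> t)
      = W' t \<times> \<gamma> t - (W t \<bullet> W t * (1 - 1 / k)) *\<^sub>R \<gamma> t"
    using body(4)[OF t]
    by (simp add: cross_mult_right cross3_cross_right inner_commute algebra_simps)
  finally show ?thesis .
qed

text \<open>The displacement \<delta> is fixed while \<open>R s\<close> moves. The resulting extra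
  term and the position derivative combine into a commutator, in body form
  \<open>N \<times> W\<close>, which yields \<open>(W \<times> A W) \<bullet> N\<close>. Translation
  adds \<open>\<mu> b\<^sup>2 (W' \<bullet> N)\<close>, and since \<open>W \<times> W = 0\<close>,
  \<open>A\<close> may be replaced by \<open>J\<close> in the gyroscopic term too.\<close>

lemma lagrange_dalembert_body:
  assumes t: "t \<in> T" and N: "N \<bullet> \<gamma> t = 0"
  defines "\<delta> \<equiv> ((b / k) *\<^sub>R (R t *v (N \<times> \<gamma> t)), R t ** hat N)"
  shows "((\<lambda>s. frechet_derivative (rolling_lagrangian a b \<mu> A (x s)) (at (v s)) \<delta>) has_real_derivative
      frechet_derivative (\<lambda>y. rolling_lagrangian a b \<mu> A y (v t)) (at (x t)) \<delta>) (at t)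
    \<longleftrightarrow> (J (W' t) + W t \<times> J (W t)) \<bullet> N = 0"
proof -
  note RD = rotation_matrixD[OF body(1)[OF t]]
  let ?d = "\<mu> * k\<^sup>2 * (fst (w t) \<bullet> fst \<delta>) + ((A *v W t) \<bullet> vee (transpose (R t ** hat (W t)) ** snd \<delta>)
      + (A *v W' t) \<bullet> vee (transpose (R t) ** snd \<delta>))"
  have "((\<lambda>s. \<mu> * k\<^sup>2 * (fst (v s) \<bullet> fst \<delta>) + (A *v W s) \<bullet> vee (transpose (R s) ** snd \<delta>)) has_vector_derivative ?d) (at t)"
    by (intro has_vector_derivative_add has_vector_derivative_linear[OF bounded_linear_mult_right]
        has_vector_derivative_linear[OF bounded_linear_inner_left]
        bounded_bilinear.has_vector_derivative[OF bounded_bilinear_inner]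
        has_vector_derivative_linear[OF bounded_linear_vee]
        has_vector_derivative_linear[OF bounded_bilinear.bounded_linear_left[OF bounded_bilinear_matrix_mult]]
        has_vector_derivative_linear[OF bounded_bilinear.bounded_linear_right[OF bounded_bilinear_matrix_vector_mult]]
        has_vector_derivative_linear[OF bounded_linear_transpose] R'[OF t] W_derivative[OF t]
        has_vector_derivative_linear[OF bounded_linear_fst v'[OF t]])
  then have der: "((\<lambda>s. frechet_derivative (rolling_lagrangian a b \<mu> A (x s)) (at (v s)) \<delta>) has_real_derivative ?d) (at t)"
    unfolding lagrangian_velocity_derivative W_def[symmetric] has_real_derivative_iff_has_vector_derivative
    unfolding body_velocity_def R_def[symmetric] .
  have v1: "vee (transpose (R t) ** snd \<delta>) = N"
    by (simp add: \<delta>_def matrix_mul_assoc RD(1) vee_hat)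
  have tr: "transpose (R t ** hat y) ** (R t ** hat z) = - (hat y ** hat z)" for y z
  proof -
    have "transpose (R t ** hat y) ** (R t ** hat z) = transpose (hat y) ** ((transpose (R t) ** R t) ** hat z)"
      by (simp only: matrix_transpose_mul matrix_mul_assoc)
    also have "\<dots> = (- hat y) ** hat z" by (simp add: RD(1) transpose_hat)
    also have "\<dots> = - (hat y ** hat z)"
      using matrix_scaleR_mult(1)[of "-1" "hat y" "hat z"] by simp
    finally show ?thesis .
  qed
  have v2: "vee (transpose (R t ** hat (W t)) ** snd \<delta>) - body_velocity \<delta> (v t) = N \<times> W t"
  proof -
    have "vee (transpose (R t ** hat (W t)) ** snd \<delta>) - body_velocity \<delta> (v t)
        = vee (- (hat (W t) ** hat N)) - vee (- (hat N ** hat (W t)))"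
      by (simp add: \<delta>_def body_velocity_def body(5)[OF t] tr)
    also have "\<dots> = vee (hat N ** hat (W t) - hat (W t) ** hat N)"
      by (simp add: linear_diff[OF linear_vee] linear_neg[OF linear_vee])
    finally show ?thesis by (simp add: hat_commutator)
  qed
  have kin: "\<mu> * k\<^sup>2 * (fst (w t) \<bullet> fst \<delta>) = \<mu> * b\<^sup>2 * (W' t \<bullet> N)"
  proof -
    have "fst (w t) \<bullet> fst \<delta> = (b / k)\<^sup>2 * ((W' t \<times> \<gamma> t - (W t \<bullet> W t * (1 - 1 / k)) *\<^sub>R \<gamma> t) \<bullet> (N \<times> \<gamma> t))"
      unfolding acceleration[OF t] \<delta>_def by (simp add: RD(6) power2_eq_square)
    also have "(W' t \<times> \<gamma> t - (W t \<bullet> W t * (1 - 1 / k)) *\<^sub>R \<gamma> t) \<bullet> (N \<times> \<gamma> t) = W' t \<bullet> N"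
      using N body(7)[OF t] by (simp add: inner_diff_left cross3_inner_cross dot_cross_self inner_commute[of "\<gamma> t" N])
    finally show ?thesis using k_nz by (simp add: power_divide)
  qed
  have "?d - frechet_derivative (\<lambda>y. rolling_lagrangian a b \<mu> A y (v t)) (at (x t)) \<delta>
      = \<mu> * b\<^sup>2 * (W' t \<bullet> N) + (A *v W t) \<bullet> (N \<times> W t) + (A *v W' t) \<bullet> N"
    unfolding lagrangian_position_derivative kin v1 v2[symmetric] W_def[symmetric]
    by (simp add: inner_diff_right)
  also have "\<dots> = (J (W' t) + W t \<times> J (W t)) \<bullet> N"
    using cross_triple[of "W t" "J (W t)" N]
    by (simp add: A_eq inner_diff_left inner_add_left dot_cross_self cross_triple inner_commute[of "J (W t)"])
  finally have eq: "?d - frechet_derivative (\<lambda>y. rolling_lagrangian a b \<mu> A y (v t)) (at (x t)) \<delta>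
      = (J (W' t) + W t \<times> J (W t)) \<bullet> N" .
  show ?thesis (is "?D \<longleftrightarrow> ?Z")
  proof
    assume ?D
    from DERIV_unique[OF der this] show ?Z using eq by simp
  next
    assume ?Z
    then have "?d = frechet_derivative (\<lambda>y. rolling_lagrangian a b \<mu> A y (v t)) (at (x t)) \<delta>" using eq by simp
    with der show ?D by (simp only:)
  qed
qed

end

context constrained_motion
begin

lemma reduced_curve_body:
  assumes t: "t \<in> T"
  shows "reduced_curve a b \<mu> A x t = (\<gamma> t, k *\<^sub>R (\<gamma> t \<times> J (W t)))"
proof -
  have v: "vector_derivative \<gamma> (at t) = (1/k) *\<^sub>R (\<gamma> t \<times> W t)" by (rule vector_derivative_at[OF \<gamma>'[OF t]])
  have 1: "\<gamma> t \<times> ((1/k) *\<^sub>R (\<gamma> t \<times> W t)) = - ((1/k) *\<^sub>R W t)"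
    using body(4,7)[OF t] by (simp add: cross_mult_right cross3_cross_right)
  have 2: "A *v (- ((1/k) *\<^sub>R W t)) = - ((1/k) *\<^sub>R (A *v W t))"
    by (simp add: A_eq J_simps algebra_simps)
  have "reduced_curve a b \<mu> A x t = (\<gamma> t, reduced_legendre a b \<mu> A (\<gamma> t) (vector_derivative \<gamma> (at t)))"
    by (simp add: reduced_curve_def \<gamma>_def[abs_def])
  also have "reduced_legendre a b \<mu> A (\<gamma> t) (vector_derivative \<gamma> (at t))
      = k\<^sup>2 *\<^sub>R ((\<mu> * b\<^sup>2 / k) *\<^sub>R (\<gamma> t \<times> W t) + (1/k) *\<^sub>R (\<gamma> t \<times> (A *v W t)))"
    unfolding v reduced_legendre_def 1 2 k_def[symmetric]
    using cross_skew[of "A *v W t" "\<gamma> t"] by (simp add: cross_mult_left)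
  also have "\<dots> = k *\<^sub>R (\<gamma> t \<times> J (W t))"
    using k_nz by (simp add: A_eq power2_eq_square cross_mult_right Cross3.right_diff_distrib algebra_simps)
  finally show ?thesis .
qed

lemma reduced_curve_derivative:
  assumes t: "t \<in> T" and dyn: "\<And>N. N \<bullet> \<gamma> t = 0 \<Longrightarrow> (J (W' t) + W t \<times> J (W t)) \<bullet> N = 0"
  shows "(reduced_curve a b \<mu> A x has_vector_derivative reduced_vf (reduced_curve a b \<mu> A x t)) (at t)"
proof -
  have "((\<lambda>s. (\<gamma> s, k *\<^sub>R (\<gamma> s \<times> J (W s)))) has_vector_derivative
      ((1/k) *\<^sub>R (\<gamma> t \<times> W t), k *\<^sub>R (\<gamma> t \<times> J (W' t) + ((1/k) *\<^sub>R (\<gamma> t \<times> W t)) \<times> J (W t)))) (at t)"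
    by (intro has_vector_derivative_Pair has_vector_derivative_linear[OF bounded_linear_scaleR_right]
        bounded_bilinear.has_vector_derivative[OF bounded_bilinear_cross3]
        has_vector_derivative_linear[OF bounded_linear_J] \<gamma>' W_derivative t)
  then have d: "(reduced_curve a b \<mu> A x has_vector_derivative
      ((1/k) *\<^sub>R (\<gamma> t \<times> W t), k *\<^sub>R (\<gamma> t \<times> J (W' t) + ((1/k) *\<^sub>R (\<gamma> t \<times> W t)) \<times> J (W t)))) (at t)"
    by (rule has_vector_derivative_transform_within_open[OF _ T t]) (simp add: reduced_curve_body)
  have orth: "\<gamma> t \<bullet> W t = 0" by (rule body(4)[OF t])
  define Y where "Y = J (W' t) + W t \<times> J (W t)"
  \<comment> \<open>The tangential part of \<open>Y\<close> is itself an admissible test vector, so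
    it vanishes: \<open>Y\<close> is a multiple of \<gamma>, the reaction to the no-twist
    constraint.\<close>
  define N where "N = Y - (Y \<bullet> \<gamma> t) *\<^sub>R \<gamma> t"
  have "N \<bullet> \<gamma> t = 0" using body(7)[OF t] by (simp add: N_def inner_diff_left)
  moreover from dyn[OF this] have "Y \<bullet> N = 0" by (simp add: Y_def)
  ultimately have "N \<bullet> N = 0"
    by (metis N_def inner_commute inner_diff_left inner_scaleR_left mult_zero_right diff_zero)
  then have "Y = (Y \<bullet> \<gamma> t) *\<^sub>R \<gamma> t" by (simp add: N_def)
  then have "\<gamma> t \<times> Y = 0" by (metis cross_mult_right cross_refl scaleR_zero_right)
  then have y: "\<gamma> t \<times> J (W' t) = \<gamma> t \<times> (J (W t) \<times> W t)"
    using cross_skew[of "W t" "J (W t)"] by (simp add: Y_def cross_add_right Cross3.right_diff_distrib)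
  have "k *\<^sub>R (\<gamma> t \<times> J (W' t) + ((1/k) *\<^sub>R (\<gamma> t \<times> W t)) \<times> J (W t))
      = (\<gamma> t \<times> W t) \<times> J (W t) + k *\<^sub>R (\<gamma> t \<times> (J (W t) \<times> W t))"
    using k_nz by (simp add: y cross_mult_left algebra_simps)
  also have "\<dots> = ((1 - k) * (\<gamma> t \<bullet> J (W t))) *\<^sub>R W t - (W t \<bullet> J (W t)) *\<^sub>R \<gamma> t"
    by (rule momentum_identity[OF orth])
  finally have p: "k *\<^sub>R (\<gamma> t \<times> J (W' t) + ((1/k) *\<^sub>R (\<gamma> t \<times> W t)) \<times> J (W t))
      = ((1 - k) * (\<gamma> t \<bullet> J (W t))) *\<^sub>R W t - (W t \<bullet> J (W t)) *\<^sub>R \<gamma> t" .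
  \<comment> \<open>An ambient point of spin 0 over the reduced one; \<open>notwist_project\<close>
    then shows that \<open>J (W t)\<close> is recovered from the momentum.\<close>
  define z where "z = (\<gamma> t, J (W t))"
  have "z \<in> punctured" using body(3)[OF t] by (auto simp: z_def punctured_def)
  moreover have "project z = (\<gamma> t, k *\<^sub>R (\<gamma> t \<times> J (W t)))"
    unfolding z_def project_def fst_conv snd_conv body(3)[OF t] by simp
  moreover have "notwist (fst z) (snd z) = J (W t)"
    using orth by (simp add: z_def notwist_def spin_def)
  ultimately have "notwist (\<gamma> t) ((1/k) *\<^sub>R ((k *\<^sub>R (\<gamma> t \<times> J (W t))) \<times> \<gamma> t)) = J (W t)"
    using notwist_project[of z] by simp
  then have "reduced_vf (\<gamma> t, k *\<^sub>R (\<gamma> t \<times> J (W t)))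
      = ((1/k) *\<^sub>R (\<gamma> t \<times> W t), ((1 - k) * (\<gamma> t \<bullet> J (W t))) *\<^sub>R W t - (W t \<bullet> J (W t)) *\<^sub>R \<gamma> t)"
    by (simp only: reduced_vf_def prod.case Let_def BJ)
  with d show ?thesis by (simp only: p reduced_curve_body[OF t])
qed

end

section \<open>Reconstruction of rolling motions and identification of the reduced field\<close>

context rubber_rolling
begin

lemma rubber_motion_reduced_derivative:
  assumes m: "rubber_motion a b \<mu> A T x v" and t: "t \<in> T"
  shows "(reduced_curve a b \<mu> A x has_vector_derivative reduced_vf (reduced_curve a b \<mu> A x t)) (at t)"
proof -
  obtain w where w: "\<And>t. t \<in> T \<Longrightarrow> (v has_vector_derivative w t) (at t)"
    using m unfolding rubber_motion_def by blast
  interpret constrained_motion a b \<mu> I\<^sub>1 I\<^sub>2 I\<^sub>3 T x v w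
    using m w by unfold_locales (auto simp: rubber_motion_def)
  show ?thesis
  proof (rule reduced_curve_derivative[OF t])
    fix N assume N: "N \<bullet> \<gamma> t = 0"
    have "x t = (a *\<^sub>R (R t *v \<gamma> t), R t)" using body(2)[OF t] by (simp add: R_def prod_eq_iff)
    then have "((b / k) *\<^sub>R (R t *v (N \<times> \<gamma> t)), R t ** hat N) \<in> rubber_distribution a b (x t)"
      using body_distribution[OF body(1)[OF t] N] by simp
    then show "(J (W' t) + W t \<times> J (W t)) \<bullet> N = 0"
      using m t lagrange_dalembert_body[OF t N] unfolding rubber_motion_def lagrange_dalembert_def by blast
  qed
qed

text \<open>Ambient point and attitude are solved together as one autonomous system, with a cutoff
  near the initial point. A short interval is enough, because the reduced field is read off at time
  0.\<close>

lemma attitude_exists: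
  assumes e: "e \<in> punctured"
  obtains \<epsilon> R where "\<epsilon> > 0" "R 0 = mat 1"
    "\<And>t. t \<in> ball 0 \<epsilon> \<Longrightarrow> (R has_vector_derivative R t ** hat (\<Omega> (amb.\<Phi> t e))) (at t)"
proof -
  define X where "X z = (ambient (fst z), snd z ** hat (\<Omega> (fst z)))" for z :: "phase \<times> (real^3^3)"
  let ?U = "fst -` punctured :: (phase \<times> (real^3^3)) set"
  have U: "open ?U" by (intro open_vimage open_punctured continuous_intros)
  have c\<Omega>: "C1_on punctured \<Omega>"
  proof (rule C1_onI[OF \<Omega>_derivative])
    show "continuous_on punctured (\<lambda>z. B (nt' z u))" for u
      unfolding nt'_def mult'_def
      by (intro continuous_intros D_derivative[THEN has_derivative_imp_continuous_on_open]
          mult_derivative[THEN has_derivative_imp_continuous_on_open]) (simp_all add: Dz)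
  qed
  have f: "C1_on ?U fst" by (rule C1_on_linear[OF bounded_linear_fst C1_on_id])
  have "C1_on ?U X"
    unfolding X_def
    by (intro C1_on_Pair C1_on_compose[OF f amb.C1] C1_on_bilinear[OF bounded_bilinear_matrix_mult]
        C1_on_linear[OF bounded_linear_snd C1_on_id] C1_on_linear[OF bounded_linear_hat]
        C1_on_compose[OF f c\<Omega>]) auto
  then obtain Y L bd V where Y: "L-lipschitz_on UNIV Y" and V: "open V" "{(e, mat 1)} \<subseteq> V" "V \<subseteq> ?U"
    and YX: "\<And>z. z \<in> V \<Longrightarrow> Y z = X z"
    by (rule C1_lipschitz_cutoff[OF U _ compact_sing[of "(e, mat 1)"]]) (use e in auto)
  obtain y where y: "y 0 = (e, mat 1)" "\<And>t. (y has_vector_derivative Y (y t)) (at t)"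
    by (rule picard_global[OF Y]) (rule that)
  have "continuous_on UNIV y"
    using y(2) has_vector_derivative_continuous continuous_at_imp_continuous_on by blast
  then have "open (y -` V)" by (rule open_vimage[OF V(1)])
  moreover have "0 \<in> y -` V" using V(2) y(1) by simp
  ultimately obtain \<epsilon> where \<epsilon>: "\<epsilon> > 0" "ball 0 \<epsilon> \<subseteq> y -` V" using open_contains_ball by blast
  have yX: "(y has_vector_derivative X (y t)) (at t)" "fst (y t) \<in> punctured" if "t \<in> ball 0 \<epsilon>" for t
  proof -
    have yV: "y t \<in> V" using \<epsilon>(2) that by blast
    then show "(y has_vector_derivative X (y t)) (at t)" using y(2)[of t] YX by simp
    show "fst (y t) \<in> punctured" using yV V(3) by blast
  qed
  have fst_y: "fst (y t) = amb.\<Phi> t e" if t: "t \<in> ball 0 \<epsilon>" for t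
  proof -
    have "fst (y t) = amb.\<Phi> t (fst (y 0))"
    proof (rule amb.\<Phi>_unique[OF _ _ t, where y="\<lambda>s. fst (y s)"])
      show "is_interval (ball (0::real) \<epsilon>)" by (simp add: is_interval_convex_1)
      show "fst (y s) \<in> punctured \<and> ((\<lambda>s. fst (y s)) has_vector_derivative ambient (fst (y s))) (at s)"
        if "s \<in> ball 0 \<epsilon>" for s
        using bounded_linear.has_vector_derivative[OF bounded_linear_fst yX(1)[OF that]] yX(2)[OF that]
        by (simp add: X_def)
    qed (use \<epsilon> in simp)
    then show ?thesis by (simp add: y(1))
  qed
  show ?thesis
  proof (rule that[OF \<epsilon>(1)])
    show "snd (y 0) = mat 1" by (simp add: y(1))
    show "((\<lambda>t. snd (y t)) has_vector_derivative snd (y t) ** hat (\<Omega> (amb.\<Phi> t e))) (at t)" if "t \<in> ball 0 \<epsilon>" for t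
      using bounded_linear.has_vector_derivative[OF bounded_linear_snd yX(1)[OF that]] fst_y[OF that]
      by (simp add: X_def)
  qed
qed

text \<open>Reconstruction: the ambient flow from \<open>embed z\<close> prescribes \<gamma> and
  \<Omega>, the attitude is integrated from the identity, and the contact point is
  \<open>a R \<gamma>\<close>. The Lagrange-d'Alembert condition holds because
  \<open>J W' + W \<times> J W\<close> is \<open>lam\<close> times \<gamma>.\<close>

lemma rubber_motion_exists:
  assumes z: "z \<in> cotangent_sphere"
  obtains T x v where "rubber_motion a b \<mu> A T x v" "0 \<in> T" "reduced_curve a b \<mu> A x 0 = z"
proof -
  have e: "embed z \<in> punctured" by (rule embed_in[OF z])
  obtain \<epsilon> R where \<epsilon>: "\<epsilon> > 0" and R0: "R 0 = mat 1"
    and R': "\<And>t. t \<in> ball 0 \<epsilon> \<Longrightarrow> (R has_vector_derivative R t ** hat (\<Omega> (amb.\<Phi> t (embed z)))) (at t)"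
    by (rule attitude_exists[OF e]) (rule that)
  let ?T = "ball 0 \<epsilon> :: real set"
  define y where "y t = amb.\<Phi> t (embed z)" for t
  define g where "g t = fst (y t)" for t
  define W where "W t = \<Omega> (y t)" for t
  \<comment> \<open>The rolling equation solved for the angular acceleration; at spin 0
    \<open>snd (y t)\<close> is \<open>J (W t)\<close>.\<close>
  define W' where "W' t = B (snd (y t) \<times> W t + lam (y t) *\<^sub>R g t)" for t
  have yp: "y t \<in> punctured" for t unfolding y_def by (rule amb.\<Phi>_in[OF e])
  have rot: "rotation_matrix (R t)" if "t \<in> ?T" for t by (rule attitude_rotation[OF R0 R' that])
  have z1: "norm (fst z) = 1" using z by (auto simp: cotangent_sphere_def)
  have int: "integrals (y t) = integrals (embed z)" for t unfolding y_def by (rule amb.first_integral[OF e])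
  have g1: "norm (g t) = 1" for t
    using int[of t] z1 by (simp add: integrals_def g_def embed_def norm_eq_sqrt_inner)
  have "fst z \<noteq> 0" using z1 by auto
  then have sp: "spin (fst (y t)) (snd (y t)) = 0" for t
    using int[of t] by (simp add: integrals_def embed_def spin_def notwist_orth)
  then have nt: "notwist (fst (y t)) (snd (y t)) = snd (y t)" and mz: "mult (y t) = 0" for t
    by (simp_all add: notwist_def mult_def)
  have W: "W t = B (snd (y t))" for t by (simp add: W_def \<Omega>_def nt)
  have gW: "g t \<bullet> W t = 0" for t using sp[of t] by (simp add: W g_def spin_def)
  have yd: "(y has_vector_derivative ambient (y t)) (at t)" for t
    unfolding y_def by (rule amb.\<Phi>_derivative[OF e])
  have g': "(g has_vector_derivative (1/k) *\<^sub>R (g t \<times> W t)) (at t)" for t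
    using bounded_linear.has_vector_derivative[OF bounded_linear_fst yd[of t]]
    by (simp add: ambient_def g_def[abs_def] W_def)
  have Wd: "(W has_vector_derivative W' t) (at t)" for t
  proof -
    have "((\<lambda>t. \<Omega> (y t)) has_derivative (\<lambda>h. B (nt' (y t) (h *\<^sub>R ambient (y t))))) (at t)"
      by (rule has_derivative_compose[OF yd[unfolded has_vector_derivative_def] \<Omega>_derivative[OF yp]])
    moreover have "B (nt' (y t) (h *\<^sub>R ambient (y t))) = h *\<^sub>R W' t" for h
      using linear_cmul[OF has_derivative_linear[OF nt_derivative[OF yp[of t]]], of h "ambient (y t)"]
      by (simp add: notwist_rate[OF yp] nt B_simps W'_def W_def g_def)
    ultimately show ?thesis by (simp add: has_vector_derivative_def W_def[abs_def])
  qed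
  define x where "x t = (a *\<^sub>R (R t *v g t), R t)" for t
  define v where "v t = ((b / k) *\<^sub>R (R t *v (W t \<times> g t)), R t ** hat (W t))" for t
  \<comment> \<open>The acceleration is written out by the product rule because its continuity is
    part of \<open>rubber_motion\<close>.\<close>
  define w where "w t = ((b / k) *\<^sub>R (R t *v (W t \<times> ((1/k) *\<^sub>R (g t \<times> W t)) + W' t \<times> g t) + (R t ** hat (W t)) *v (W t \<times> g t)),
      R t ** hat (W' t) + (R t ** hat (W t)) ** hat (W t))" for t
  have RT: "(R has_vector_derivative R t ** hat (W t)) (at t)" if "t \<in> ?T" for t
    using R'[OF that] by (simp add: W_def y_def)
  have pos: "reduced_position a (x t) = g t" if "t \<in> ?T" for t
    unfolding reduced_position_def x_def prod.case rotation_matrixD(3)[OF rot[OF that]]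
    using a rotation_matrixD(4)[OF rot[OF that], of "g t"]
    by (simp only: matrix_vector_mult_scaleR) simp
  have vel: "body_velocity (x t) (v t) = W t" if "t \<in> ?T" for t
    unfolding body_velocity_def x_def v_def snd_conv matrix_mul_assoc rotation_matrixD(1)[OF rot[OF that]]
    by (simp add: vee_hat)
  have kin: "constrained_motion a b \<mu> I\<^sub>1 I\<^sub>2 I\<^sub>3 ?T x v w"
  proof unfold_locales
    fix t assume t: "t \<in> ?T"
    show "x t \<in> config_space a"
      using rotation_matrixD(6)[OF rot[OF t], of "g t" "g t"] g1[of t] a rot[OF t]
      by (simp add: config_space_def x_def norm_eq_sqrt_inner)
    show "(v has_vector_derivative w t) (at t)"
      unfolding v_def w_def
      by (intro has_vector_derivative_Pair bounded_linear.has_vector_derivative[OF bounded_linear_scaleR_right]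
          bounded_bilinear.has_vector_derivative[OF bounded_bilinear_matrix_vector_mult]
          bounded_bilinear.has_vector_derivative[OF bounded_bilinear_matrix_mult]
          bounded_linear.has_vector_derivative[OF bounded_linear_hat]
          bounded_bilinear.has_vector_derivative[OF bounded_bilinear_cross3] RT t g' Wd)
    show "v t \<in> rubber_distribution a b (x t)"
      unfolding v_def x_def by (rule body_distribution[OF rot[OF t]], subst inner_commute, rule gW)
    have "(x has_vector_derivative (a *\<^sub>R (R t *v ((1/k) *\<^sub>R (g t \<times> W t)) + (R t ** hat (W t)) *v g t), R t ** hat (W t))) (at t)"
      unfolding x_def
      by (intro has_vector_derivative_Pair bounded_linear.has_vector_derivative[OF bounded_linear_scaleR_right]
          bounded_bilinear.has_vector_derivative[OF bounded_bilinear_matrix_vector_mult] RT t g')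
    moreover have "a *\<^sub>R (R t *v ((1/k) *\<^sub>R (g t \<times> W t)) + (R t ** hat (W t)) *v g t) = (b / k) *\<^sub>R (R t *v (W t \<times> g t))"
    proof -
      have "R t *v ((1/k) *\<^sub>R (g t \<times> W t)) + (R t ** hat (W t)) *v g t = R t *v ((1/k) *\<^sub>R (g t \<times> W t) + W t \<times> g t)"
        by (simp only: matrix_vector_mul_assoc[symmetric] hat_mult matrix_vector_right_distrib)
      also have "(1/k) *\<^sub>R (g t \<times> W t) + W t \<times> g t = (1 - 1/k) *\<^sub>R (W t \<times> g t)"
        using cross_skew[of "g t" "W t"] by (simp add: algebra_simps)
      finally have "a *\<^sub>R (R t *v ((1/k) *\<^sub>R (g t \<times> W t)) + (R t ** hat (W t)) *v g t)
          = (a * (1 - 1/k)) *\<^sub>R (R t *v (W t \<times> g t))" by (simp only: matrix_vector_mult_scaleR scaleR_scaleR)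
      moreover have "a * (1 - 1/k) = b / k"
      proof -
        have "a * (k - 1) / k = b / k" using a by (simp add: k_def)
        then show ?thesis using k_nz by (simp add: right_diff_distrib diff_divide_distrib)
      qed
      ultimately show ?thesis by simp
    qed
    ultimately show "(x has_vector_derivative v t) (at t)" by (simp add: v_def)
  qed simp
  interpret m: constrained_motion a b \<mu> I\<^sub>1 I\<^sub>2 I\<^sub>3 ?T x v w by (rule kin)
  have mg: "m.\<gamma> t = g t" and mW: "m.W t = W t" and mR: "m.R t = R t" if "t \<in> ?T" for t
    using pos[OF that] vel[OF that] by (simp_all add: m.\<gamma>_def m.W_def m.R_def x_def)
  have mW': "m.W' t = W' t" if t: "t \<in> ?T" for t
  proof -
    have "(W has_vector_derivative m.W' t) (at t)"
      by (rule has_vector_derivative_transform_within_open[OF m.W_derivative[OF t] open_ball t]) (rule mW)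
    then show ?thesis using Wd vector_derivative_unique_at by blast
  qed
  have lda: "lagrange_dalembert (rolling_lagrangian a b \<mu> A) (rubber_distribution a b) ?T x v"
    unfolding lagrange_dalembert_def
  proof (intro ballI)
    fix t \<delta> assume t: "t \<in> ?T" and \<delta>: "\<delta> \<in> rubber_distribution a b (x t)"
    define N where "N = body_velocity (x t) \<delta>"
    note cb = constraint_body[OF m.config[OF t] \<delta>]
    have N: "N \<bullet> m.\<gamma> t = 0" using cb(4) by (simp add: N_def m.\<gamma>_def inner_commute)
    have \<delta>_eq: "\<delta> = ((b / k) *\<^sub>R (m.R t *v (N \<times> m.\<gamma> t)), m.R t ** hat N)"
      using cb(5,6) by (simp add: N_def m.\<gamma>_def m.R_def prod_eq_iff)
    have "J (m.W' t) + m.W t \<times> J (m.W t) = lam (y t) *\<^sub>R g t"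
      using cross_skew[of "B (snd (y t))" "snd (y t)"] by (simp add: mW'[OF t] mW[OF t] W'_def W)
    then have "(J (m.W' t) + m.W t \<times> J (m.W t)) \<bullet> N = 0"
      using N by (simp add: mg[OF t] inner_commute)
    then show "((\<lambda>s. frechet_derivative (rolling_lagrangian a b \<mu> A (x s)) (at (v s)) \<delta>) has_real_derivative
        frechet_derivative (\<lambda>y. rolling_lagrangian a b \<mu> A y (v t)) (at (x t)) \<delta>) (at t)"
      unfolding \<delta>_eq using m.lagrange_dalembert_body[OF t N] by blast
  qed
  have cw: "continuous_on ?T w"
  proof -
    have cR: "continuous_on ?T R"
      by (intro continuous_at_imp_continuous_on ballI has_vector_derivative_continuous[OF RT])
    have cW: "continuous_on ?T W" and cg: "continuous_on ?T g" and cy: "continuous_on ?T y"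
      by (intro continuous_at_imp_continuous_on ballI has_vector_derivative_continuous[OF Wd]
          has_vector_derivative_continuous[OF g'] has_vector_derivative_continuous[OF yd])+
    have cl: "continuous_on punctured lam"
      by (rule has_derivative_imp_continuous_on_open, erule lam_derivative)
    have "continuous_on ?T W'"
      unfolding W'_def
      by (intro continuous_intros continuous_on_cross cW cg cy continuous_on_compose2[OF cl cy]) (use yp in auto)
    then show ?thesis
      unfolding w_def
      by (intro continuous_intros continuous_on_cross cW cg cR
          bounded_bilinear.continuous_on[OF bounded_bilinear_matrix_vector_mult]
          bounded_bilinear.continuous_on[OF bounded_bilinear_matrix_mult])
  qed
  have "rubber_motion a b \<mu> A ?T x v"
    unfolding rubber_motion_def
    using m.config m.x' m.v' m.constraint lda cw by (auto simp: is_interval_convex_1)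
  moreover have zT: "0 \<in> ?T" using \<epsilon> by simp
  moreover have "reduced_curve a b \<mu> A x 0 = z"
  proof -
    have "reduced_curve a b \<mu> A x 0 = (g 0, k *\<^sub>R (g 0 \<times> snd (y 0)))"
      by (simp add: m.reduced_curve_body[OF zT] mg[OF zT] mW[OF zT] W)
    also have "\<dots> = project (y 0)" using g1[of 0] by (simp add: project_def g_def)
    also have "\<dots> = z" by (simp add: y_def amb.\<Phi>_0[OF e] project_embed[OF z])
    finally show ?thesis .
  qed
  ultimately show ?thesis by (rule that)
qed

text \<open>A motion passes through every phase point, and every such motion has velocity
  \<open>reduced_vf\<close> there; both facts are needed for the definite description to denote this
  vector.\<close>

lemma reduced_field_eq:
  assumes z: "z \<in> cotangent_sphere"
  shows "reduced_field a b \<mu> A z = reduced_vf z"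
  unfolding reduced_field_def
proof (rule the_equality)
  obtain T x v where m: "rubber_motion a b \<mu> A T x v" "0 \<in> T" "reduced_curve a b \<mu> A x 0 = z"
    by (rule rubber_motion_exists[OF z])
  then show "\<exists>T x v. rubber_motion a b \<mu> A T x v \<and> 0 \<in> T \<and> reduced_curve a b \<mu> A x 0 = z \<and>
      (reduced_curve a b \<mu> A x has_vector_derivative reduced_vf z) (at 0)"
    using rubber_motion_reduced_derivative[OF m(1,2)] by auto
next
  fix d
  assume "\<exists>T x v. rubber_motion a b \<mu> A T x v \<and> 0 \<in> T \<and> reduced_curve a b \<mu> A x 0 = z \<and>
      (reduced_curve a b \<mu> A x has_vector_derivative d) (at 0)"
  then obtain T x v where m: "rubber_motion a b \<mu> A T x v" "0 \<in> T" "reduced_curve a b \<mu> A x 0 = z"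
    "(reduced_curve a b \<mu> A x has_vector_derivative d) (at 0)" by blast
  then show "d = reduced_vf z"
    using rubber_motion_reduced_derivative[OF m(1,2)] vector_derivative_unique_at by force
qed

lemma flow_reduced_field:
  "flow cotangent_sphere (reduced_field a b \<mu> A) t = {(z, project (amb.\<Phi> t (embed z))) | z. z \<in> cotangent_sphere}"
proof -
  have "flow cotangent_sphere (reduced_field a b \<mu> A) t = flow cotangent_sphere reduced_vf t"
    by (rule flow_cong) (rule reduced_field_eq)
  moreover have "c \<in> flow cotangent_sphere reduced_vf t \<longleftrightarrow>
      c \<in> {(z, project (amb.\<Phi> t (embed z))) | z. z \<in> cotangent_sphere}" for c
    using flow_reduced_vf[of "fst c" "snd c" t] unfolding mem_Collect_eq prod.collapse
    by (metis fst_conv snd_conv prod.collapse)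
  ultimately show ?thesis by blast
qed

end

section \<open>The stereographic chart\<close>

definition stereo' :: "real^2 \<Rightarrow> real^2 \<Rightarrow> real^3" where
  "stereo' x h = inverse (1 + x \<bullet> x) *\<^sub>R ((2 * h$1) *\<^sub>R axis 1 1 + (2 * h$2) *\<^sub>R axis 2 1 + (2 * (x \<bullet> h)) *\<^sub>R axis 3 1)
     - (2 * (x \<bullet> h) * inverse (1 + x \<bullet> x)) *\<^sub>R stereographic x"

text \<open>Conformal factor of the inverse stereographic projection: its derivative is
  \<open>conf x\<close> times an isometry onto the tangent plane.\<close>

definition conf :: "real^2 \<Rightarrow> real" where "conf x = 2 / (1 + x \<bullet> x)"

lemma one_plus_pos: "1 + x \<bullet> x > (0::real)" "1 + x \<bullet> x \<noteq> (0::real)"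
  using inner_ge_zero[of x] by linarith+

lemma conf_pos: "conf x > 0"
  by (simp add: conf_def one_plus_pos)

lemma stereographic_eq:
  "stereographic x = inverse (1 + x \<bullet> x) *\<^sub>R ((2 * x$1) *\<^sub>R axis 1 1 + (2 * x$2) *\<^sub>R axis 2 1 + (x \<bullet> x - 1) *\<^sub>R axis 3 1)"
  by (simp add: stereographic_def vec_eq_iff forall_3 axis_def divide_inverse power2_norm_eq_inner)

lemma stereographic_derivative: "(stereographic has_derivative stereo' x) (at x)"
proof -
  have vn: "((\<lambda>x. x $ i) has_derivative (\<lambda>h. h $ i)) F" for i :: 2 and F :: "(real^2) filter"
    by (rule bounded_linear_imp_has_derivative[OF bounded_linear_vec_nth])
  have "((\<lambda>x. inverse (1 + x \<bullet> x) *\<^sub>R ((2 * x$1) *\<^sub>R axis 1 1 + (2 * x$2) *\<^sub>R axis 2 1 + (x \<bullet> x - 1) *\<^sub>R axis 3 1))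
      has_derivative stereo' x) (at x)"
    by (rule derivative_eq_intros vn one_plus_pos refl)+
      (simp add: fun_eq_iff stereo'_def stereographic_eq inner_commute algebra_simps)
  then show ?thesis by (simp add: stereographic_eq[abs_def])
qed

lemma linear_stereo': "linear (stereo' x)"
  using stereographic_derivative has_derivative_linear by blast

lemma frechet_stereographic: "frechet_derivative stereographic (at x) = stereo' x"
  using frechet_derivative_at[OF stereographic_derivative] by simp

lemma bundle_chart_eq: "bundle_chart w = (stereographic (fst w), stereo' (fst w) (snd w))"
  by (simp add: bundle_chart_def case_prod_beta frechet_stereographic)

lemma inner_2: "x \<bullet> y = x$1 * y$1 + x$2 * y$2" for x y :: "real^2"
  by (simp add: inner_vec_def sum_2)

lemma stereographic_unit: "stereographic x \<bullet> stereographic x = 1"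
proof -
  have "(2 * x$1)\<^sup>2 + (2 * x$2)\<^sup>2 + (x \<bullet> x - 1)\<^sup>2 = (1 + x \<bullet> x)\<^sup>2"
    by (simp add: inner_2 power2_eq_square algebra_simps)
  moreover have "stereographic x \<bullet> stereographic x = (inverse (1 + x \<bullet> x))\<^sup>2 * ((2 * x$1)\<^sup>2 + (2 * x$2)\<^sup>2 + (x \<bullet> x - 1)\<^sup>2)"
    by (simp add: stereographic_eq inner_vec_def[where 'b=3] sum_3 axis_def power2_eq_square algebra_simps)
  ultimately show ?thesis using one_plus_pos(2)[of x] by (simp add: power_inverse)
qed

lemma stereo'_orth: "stereographic x \<bullet> stereo' x h = 0"
  and stereo'_inner: "stereo' x h \<bullet> stereo' x g = (conf x)\<^sup>2 * (h \<bullet> g)"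
proof -
  \<comment> \<open>The derivative of the numerator; the remaining term of the quotient rule is
    radial and removes the component of \<open>H h\<close> along the sphere's normal.\<close>
  define H where "H h = (2 * h$1) *\<^sub>R axis 1 1 + (2 * h$2) *\<^sub>R axis 2 1 + (2 * (x \<bullet> h)) *\<^sub>R (axis 3 1 :: real^3)" for h
  let ?i = "inverse (1 + x \<bullet> x)"
  have eq: "stereo' x h = ?i *\<^sub>R H h - (2 * (x \<bullet> h) * ?i) *\<^sub>R stereographic x" for h
    by (simp add: stereo'_def H_def)
  have HH: "H h \<bullet> H g = 4 * (h \<bullet> g) + 4 * ((x \<bullet> h) * (x \<bullet> g))" for h g
    by (simp add: H_def inner_vec_def[where 'b=3] sum_3 axis_def inner_2[of h g])
  have HS: "H h \<bullet> stereographic x = 2 * (x \<bullet> h)" for h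
  proof -
    have "H h \<bullet> stereographic x = ?i * (4 * (x$1 * h$1 + x$2 * h$2) + 2 * (x \<bullet> h) * (x \<bullet> x - 1))"
      by (simp add: H_def stereographic_eq inner_vec_def[where 'b=3] sum_3 axis_def algebra_simps)
    also have "\<dots> = ?i * (1 + x \<bullet> x) * (2 * (x \<bullet> h))"
      by (simp only: inner_2[of x h, symmetric]) (simp add: algebra_simps)
    finally show ?thesis using one_plus_pos(2)[of x] by simp
  qed
  show "stereographic x \<bullet> stereo' x h = 0"
    by (simp add: eq inner_diff_right inner_commute[of "stereographic x"] HS stereographic_unit inner_diff_left)
  have "stereo' x h \<bullet> stereo' x g = ?i * ?i * (4 * (h \<bullet> g))"
    by (simp add: eq inner_diff_left inner_diff_right HH HS inner_commute[of "stereographic x" "H _"] stereographic_unit algebra_simps)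
  then show "stereo' x h \<bullet> stereo' x g = (conf x)\<^sup>2 * (h \<bullet> g)"
    by (simp add: conf_def power2_eq_square divide_inverse)
qed

lemma stereo'_axis:
  fixes x :: "real^2"
  defines "e \<equiv> \<lambda>i. stereo' x (axis i 1)" and "u \<equiv> stereographic x"
  shows "e 1 \<bullet> e 1 = (conf x)\<^sup>2" "e 2 \<bullet> e 2 = (conf x)\<^sup>2" "e 1 \<bullet> e 2 = 0" "e 2 \<bullet> e 1 = 0"
    "u \<bullet> e i = 0" "e i \<bullet> u = 0" "\<bar>e 1 \<bullet> (e 2 \<times> u)\<bar> = (conf x)\<^sup>2"
proof -
  show 1: "e 1 \<bullet> e 1 = (conf x)\<^sup>2" "e 2 \<bullet> e 2 = (conf x)\<^sup>2" "e 1 \<bullet> e 2 = 0" "e 2 \<bullet> e 1 = 0"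
    by (simp_all add: e_def stereo'_inner inner_axis_axis)
  show o: "u \<bullet> e i = 0" for i by (simp add: e_def u_def stereo'_orth)
  then show "e i \<bullet> u = 0" by (simp add: inner_commute)
  have u: "u \<bullet> u = 1" by (simp add: u_def stereographic_unit)
  define Y where "Y = e 2 \<times> u"
  have "Y \<bullet> Y = (conf x)\<^sup>2" by (simp add: Y_def cross3_inner_cross 1 u o inner_commute[of "e 2" u])
  moreover have "e 1 \<times> Y = 0" by (simp add: Y_def cross3_cross_right 1 o inner_commute[of "e 1" u])
  moreover have "(norm (e 1 \<times> Y))\<^sup>2 + (e 1 \<bullet> Y)\<^sup>2 = (norm (e 1) * norm Y)\<^sup>2" by (rule norm_cross_dot)
  ultimately have "(e 1 \<bullet> Y)\<^sup>2 = ((conf x)\<^sup>2)\<^sup>2"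
    by (simp add: power_mult_distrib power2_norm_eq_inner 1)
  then have "sqrt ((e 1 \<bullet> Y)\<^sup>2) = sqrt (((conf x)\<^sup>2)\<^sup>2)" by (simp only:)
  then have "\<bar>e 1 \<bullet> Y\<bar> = \<bar>(conf x)\<^sup>2\<bar>" by (simp only: real_sqrt_abs)
  then show "\<bar>e 1 \<bullet> (e 2 \<times> u)\<bar> = (conf x)\<^sup>2" by (simp add: Y_def)
qed

lemma C1_vec_nth: "C1_on U f \<Longrightarrow> C1_on U (\<lambda>x. f x $ i)"
  by (rule C1_on_linear[OF bounded_linear_vec_nth])

lemma C1_bundle_chart: "C1_on UNIV bundle_chart"
  unfolding bundle_chart_eq stereo'_def stereographic_eq
  by (intro C1_on_intros C1_vec_nth C1_on_inverse one_plus_pos)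

lemma bundle_chart_continuous: "continuous_on UNIV bundle_chart"
  by (rule C1_on_continuous_on[OF C1_bundle_chart])

text \<open>The fibre component of a derivative in a base direction involves second derivatives of
  the projection. It is left uncomputed, because the Liouville form does not see it.\<close>

lemma bundle_chart_derivative:
  defines "d \<equiv> \<lambda>w. frechet_derivative bundle_chart (at w)"
  shows "fst (d w v) = stereo' (fst w) (fst v)" "d w (0, h) = (0, stereo' (fst w) h)"
proof -
  obtain c where c: "(bundle_chart has_derivative c) (at w)"
    using C1_bundle_chart unfolding C1_on_def by blast
  have dc: "d w = c" using frechet_derivative_at[OF c] by (simp add: d_def)
  have "((\<lambda>w. fst (bundle_chart w)) has_derivative (\<lambda>v. fst (c v))) (at w)"
    by (rule has_derivative_fst[OF c])
  moreover have "((\<lambda>w. fst (bundle_chart w)) has_derivative (\<lambda>v. stereo' (fst w) (fst v))) (at w)"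
    unfolding bundle_chart_eq fst_conv
    by (rule has_derivative_compose[OF has_derivative_fst[OF has_derivative_ident] stereographic_derivative])
  ultimately have "(\<lambda>v. fst (c v)) = (\<lambda>v. stereo' (fst w) (fst v))" by (rule has_derivative_unique)
  then show "fst (d w v) = stereo' (fst w) (fst v)" unfolding dc by (rule fun_cong)
  have "((\<lambda>y. (fst w, y)) has_derivative (\<lambda>h. (0, h))) (at (snd w))"
    by (intro derivative_intros)
  from has_derivative_compose[OF this, of bundle_chart c] c
  have "((\<lambda>y. bundle_chart (fst w, y)) has_derivative (\<lambda>h. c (0, h))) (at (snd w))" by simp
  moreover have "((\<lambda>y. bundle_chart (fst w, y)) has_derivative (\<lambda>h. (0, stereo' (fst w) h))) (at (snd w))"
    unfolding bundle_chart_eq fst_conv snd_conv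
    by (intro derivative_intros linear_imp_has_derivative linear_stereo')
  ultimately have "(\<lambda>h. c (0, h)) = (\<lambda>h. (0, stereo' (fst w) h))" by (rule has_derivative_unique)
  then show "d w (0, h) = (0, stereo' (fst w) h)" unfolding dc by (rule fun_cong)
qed

text \<open>The unknown components \<alpha> enter only through the pairing of the two base
  directions, which is multiplied by the pairing of the two fibre directions, and that is 0. The
  surviving product of diagonal pairings occurs twice with sign -1.\<close>

lemma liouville_in_chart:
  defines "d \<equiv> \<lambda>w. frechet_derivative bundle_chart (at w)"
  shows "wedge omega_can omega_can (d w (axis 1 1, 0)) (d w (axis 2 1, 0)) (d w (0, axis 1 1)) (d w (0, axis 2 1))
    = - 2 * (conf (fst w)) ^ 4"
proof -
  let ?e = "\<lambda>i. stereo' (fst w) (axis i 1)"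
  have v: "d w (0, axis i 1) = (0, ?e i)" for i by (simp add: d_def bundle_chart_derivative)
  obtain \<alpha> where h: "d w (axis i 1, 0) = (?e i, \<alpha> i)" for i
  proof -
    have "d w (axis i 1, 0) = (?e i, snd (d w (axis i 1, 0)))" for i
      by (simp add: prod_eq_iff d_def bundle_chart_derivative)
    then show ?thesis by (rule that)
  qed
  show ?thesis
    unfolding v h wedge_def omega_can_def
    by (simp add: stereo'_axis)
qed

section \<open>Polar coordinates whose angular part is the stereographic chart\<close>

lemma det_matrix_3:
  fixes f :: "real^3 \<Rightarrow> real^3"
  shows "det (matrix f) = f (axis 1 1) \<bullet> (f (axis 2 1) \<times> f (axis 3 1))"
  by (simp add: matrix_def det_3 cross3_def inner_vec_def sum_3 algebra_simps)

definition base :: "real^3 \<Rightarrow> real^2" where "base w = vector [w$1, w$2]"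

lemma linear_base: "linear base"
  by (intro linearI) (simp_all add: base_def vec_eq_iff forall_2)

lemma base_axis: "base (axis 1 1) = axis 1 1" "base (axis 2 1) = axis 2 1" "base (axis 3 1) = 0"
  by (simp_all add: base_def vec_eq_iff forall_2 axis_def)

text \<open>The third coordinate is the radius and the first two are the stereographic coordinates
  of the direction, so the angular variables are those of \<open>bundle_chart\<close>.\<close>

definition polar :: "real^3 \<Rightarrow> real^3" where "polar w = (w$3) *\<^sub>R stereographic (base w)"

lemma polar_derivative:
  "(polar has_derivative (\<lambda>h. (h$3) *\<^sub>R stereographic (base w) + (w$3) *\<^sub>R stereo' (base w) (base h))) (at w)"
proof -
  have vn: "((\<lambda>x. x $ 3) has_derivative (\<lambda>h. h $ 3)) (at w)"
    by (rule bounded_linear_imp_has_derivative[OF bounded_linear_vec_nth])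
  have "((\<lambda>w. stereographic (base w)) has_derivative (\<lambda>h. stereo' (base w) (base h))) (at w)"
    by (rule has_derivative_compose[OF linear_imp_has_derivative[OF linear_base] stereographic_derivative])
  from has_derivative_scaleR[OF vn this] show ?thesis
    by (simp add: polar_def[abs_def] add.commute)
qed

lemma polar_det:
  "\<bar>det (matrix (\<lambda>h. (h$3) *\<^sub>R stereographic (base w) + (w$3) *\<^sub>R stereo' (base w) (base h)))\<bar>
    = (w$3)\<^sup>2 * (conf (base w))\<^sup>2"
proof -
  have "det (matrix (\<lambda>h. (h$3) *\<^sub>R stereographic (base w) + (w$3) *\<^sub>R stereo' (base w) (base h)))
      = (w$3)\<^sup>2 * (stereo' (base w) (axis 1 1) \<bullet> (stereo' (base w) (axis 2 1) \<times> stereographic (base w)))"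
    unfolding det_matrix_3 base_axis
    by (simp add: linear_0[OF linear_stereo'] cross_mult_left power2_eq_square axis_def)
  then show ?thesis by (simp add: abs_mult stereo'_axis)
qed

lemma stereographic_components:
  "stereographic x $ 1 = conf x * x$1" "stereographic x $ 2 = conf x * x$2" "1 - stereographic x $ 3 = conf x"
proof -
  show "stereographic x $ 1 = conf x * x$1" "stereographic x $ 2 = conf x * x$2"
    by (simp_all add: stereographic_def conf_def power2_norm_eq_inner)
  have "1 - (x \<bullet> x - 1) / (1 + x \<bullet> x) = ((1 + x \<bullet> x) - (x \<bullet> x - 1)) / (1 + x \<bullet> x)"
    unfolding diff_divide_distrib[of "1 + x \<bullet> x"] using one_plus_pos(2)[of x] by simp
  then show "1 - stereographic x $ 3 = conf x"
    by (simp add: stereographic_def conf_def power2_norm_eq_inner)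
qed

lemma stereographic_norm: "norm (stereographic x) = 1"
  by (simp add: norm_eq_1 stereographic_unit)

lemma stereographic_surj:
  assumes u: "u \<bullet> u = 1" "u $ 3 \<noteq> 1"
  shows "stereographic (vector [u$1 / (1 - u$3), u$2 / (1 - u$3)]) = u"
proof -
  let ?x = "vector [u$1 / (1 - u$3), u$2 / (1 - u$3)] :: real^2" and ?t = "1 - u$3"
  have t: "?t \<noteq> 0" using u by simp
  have s: "u$1 * u$1 + u$2 * u$2 = 1 - u$3 * u$3" using u(1) by (simp add: inner_vec_def sum_3)
  have "?x \<bullet> ?x = (u$1 * u$1 + u$2 * u$2) / (?t * ?t)" by (simp add: inner_2 add_divide_distrib)
  also have "\<dots> = (1 + u$3) * ?t / (?t * ?t)" unfolding s by (simp add: algebra_simps)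
  finally have xx: "?x \<bullet> ?x = (1 + u$3) / ?t" using t by simp
  have "1 + ?x \<bullet> ?x = (?t + (1 + u$3)) / ?t" unfolding xx add_divide_distrib using t by simp
  then have "conf ?x = ?t" by (simp add: conf_def)
  then show ?thesis
    using stereographic_components[of ?x] t by (simp add: vec_eq_iff forall_3)
qed

lemma polar_inj: "inj_on polar {w. w$3 > 0}"
proof (rule inj_onI)
  fix v w assume vw: "v \<in> {w. w$3 > 0}" "w \<in> {w. w$3 > 0}" "polar v = polar w"
  have "norm (polar v) = norm (polar w)" using vw by simp
  then have 3: "v$3 = w$3" using vw by (simp add: polar_def stereographic_norm)
  then have s: "stereographic (base v) = stereographic (base w)" using vw by (simp add: polar_def)
  then have "conf (base v) = conf (base w)" using stereographic_components(3) by metis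
  then have "base v = base w"
    using s conf_pos[of "base w"] stereographic_components(1,2)[of "base v"] stereographic_components(1,2)[of "base w"]
    by (simp add: vec_eq_iff forall_2)
  then show "v = w" using 3 by (simp add: base_def vec_eq_iff forall_2 forall_3)
qed

text \<open>Missing are 0 and the ray through the pole of projection; the plane is a convenient null
  set containing them.\<close>

lemma polar_image: "- polar ` {w. w$3 > 0} \<subseteq> {\<gamma>. \<gamma>$1 = 0}"
proof
  fix \<gamma> assume n: "\<gamma> \<in> - polar ` {w. w$3 > 0}"
  show "\<gamma> \<in> {\<gamma>. \<gamma>$1 = 0}"
  proof (rule ccontr)
    assume "\<gamma> \<notin> {\<gamma>. \<gamma>$1 = 0}"
    then have g: "\<gamma>$1 \<noteq> 0" by simp
    then have r: "norm \<gamma> > 0" by auto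
    define u where "u = (1 / norm \<gamma>) *\<^sub>R \<gamma>"
    have "norm u = 1" using r by (simp add: u_def)
    then have u: "u \<bullet> u = 1" by (simp add: norm_eq_1)
    have u1: "u$1 * u$1 > 0" using g r by (simp add: u_def zero_less_mult_iff zero_less_divide_iff) linarith
    have "u$3 \<noteq> 1"
    proof
      assume "u$3 = 1"
      then show False using u u1 by (simp add: inner_vec_def sum_3)
    qed
    note st = stereographic_surj[OF u this]
    have "polar (vector [u$1 / (1 - u$3), u$2 / (1 - u$3), norm \<gamma>]) = \<gamma>"
      using r by (simp add: polar_def base_def st) (simp add: u_def)
    then have "\<gamma> \<in> polar ` {w. w$3 > 0}" using r by (intro image_eqI[of _ _ "vector [u$1 / (1 - u$3), u$2 / (1 - u$3), norm \<gamma>]"]) auto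
    then show False using n by simp
  qed
qed

definition join :: "(real^2) \<times> real \<Rightarrow> real^3" where
  "join p = vector [fst p $ 1, fst p $ 2, snd p]"

lemma join_components: "base (join p) = fst p" "join p $ 3 = snd p"
  by (simp_all add: join_def base_def vec_eq_iff forall_2)

lemma join_isometry: "linear join" "bij_betw join Basis Basis"
proof -
  show "linear join" by (intro linearI) (simp_all add: join_def vec_eq_iff forall_3)
  have 2: "(Basis :: (real^2) set) = {axis 1 1, axis 2 1}" by (auto simp: Basis_vec_def exhaust_2 UNIV_2)
  have 3: "(Basis :: (real^3) set) = {axis 1 1, axis 2 1, axis 3 1}" by (auto simp: Basis_vec_def UNIV_3)
  have j: "join (axis 1 1, 0) = axis 1 1" "join (axis 2 1, 0) = axis 2 1" "join (0, 1) = axis 3 1"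
    by (simp_all add: join_def vec_eq_iff forall_3 axis_def)
  have B: "(Basis :: ((real^2) \<times> real) set) = {(axis 1 1, 0), (axis 2 1, 0), (0, 1)}"
    by (auto simp: Basis_prod_def 2)
  show "bij_betw join Basis Basis"
    unfolding B 3 by (auto simp: bij_betw_def inj_on_def j axis_eq_axis)
qed

section \<open>The Liouville measure as a slice of the ambient measure\<close>

context rubber_rolling
begin

lemma cross_J: "J v \<times> J w = (j$1 * j$2 * j$3) *\<^sub>R B (v \<times> w)"
  by (simp add: J_def B_def vec_eq_iff forall_3 cross3_def) (simp add: algebra_simps)

text \<open>On the plane orthogonal to \<gamma> the map is \<open>k\<^sup>2\<close> times
  \<open>J\<close> conjugated by the quarter turn about \<gamma>, so its determinant is
  \<open>k ^ 4\<close> times the minor of \<open>J\<close> on that plane. By the cofactor formula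
  \<open>cross_J\<close> this minor is \<open>det J\<close> times
  \<open>\<gamma> \<bullet> B \<gamma>\<close>.\<close>

lemma plane_det_reduced_legendre:
  assumes \<gamma>: "\<gamma> \<bullet> \<gamma> = 1"
  shows "plane_det \<gamma> (reduced_legendre a b \<mu> A \<gamma>) = k ^ 4 * (j$1 * j$2 * j$3) * D \<gamma>"
proof -
  obtain y where y: "y \<noteq> 0" "orthogonal \<gamma> y"
    using orthogonal_to_vector_exists[of \<gamma>] by auto
  define e where "e = (1 / norm y) *\<^sub>R y"
  define f where "f = \<gamma> \<times> e"
  have ge: "\<gamma> \<bullet> e = 0" using y(2) by (simp add: e_def orthogonal_def)
  have "norm e = 1" using y by (simp add: e_def)
  then have ee: "e \<bullet> e = 1" by (simp add: norm_eq_1)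
  have gf: "\<gamma> \<bullet> f = 0" and ef: "e \<bullet> f = 0" by (simp_all add: f_def dot_cross_self)
  have ff: "f \<bullet> f = 1" by (simp add: f_def cross3_inner_cross \<gamma> ee ge)
  have gxe: "\<gamma> \<times> e = f" and gxf: "\<gamma> \<times> f = - e" by (simp_all add: f_def cross3_cross_right \<gamma> ge)
  have exf: "e \<times> f = \<gamma>" by (simp add: f_def cross3_cross_right ee ge inner_commute[of e \<gamma>])
  have L: "linear (reduced_legendre a b \<mu> A \<gamma>)"
    unfolding reduced_legendre_def
    by (intro linearI) (simp_all add: A_eq J_simps cross_add_left cross_add_right cross_mult_left cross_mult_right
        Cross3.left_diff_distrib algebra_simps)
  have Lv: "reduced_legendre a b \<mu> A \<gamma> v = k\<^sup>2 *\<^sub>R (J (\<gamma> \<times> v) \<times> \<gamma>)" if "\<gamma> \<bullet> v = 0" for v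
  proof -
    have "(\<gamma> \<times> v) \<times> \<gamma> = v" using that by (simp add: cross3_cross_left \<gamma> inner_commute[of v])
    then show ?thesis
      by (simp add: reduced_legendre_def k_def[symmetric] A_eq Cross3.left_diff_distrib cross_mult_left)
  qed
  have in_cross: "w \<bullet> (M \<times> \<gamma>) = M \<bullet> (\<gamma> \<times> w)" for w M by (metis cross_triple inner_commute)
  have "plane_det \<gamma> (reduced_legendre a b \<mu> A \<gamma>)
      = (e \<bullet> reduced_legendre a b \<mu> A \<gamma> e) * (f \<bullet> reduced_legendre a b \<mu> A \<gamma> f)
        - (e \<bullet> reduced_legendre a b \<mu> A \<gamma> f) * (f \<bullet> reduced_legendre a b \<mu> A \<gamma> e)"
    by (rule plane_det_orthonormal_basis[OF L]) (simp_all add: norm_eq_1 \<gamma> ee ff ef ge gf)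
  also have "\<dots> = k ^ 4 * ((J e \<bullet> e) * (J f \<bullet> f) - (J e \<bullet> f) * (J f \<bullet> e))"
    unfolding Lv[OF ge] Lv[OF gf]
    by (simp add: in_cross gxe gxf J_simps) (simp add: power2_eq_square power4_eq_xxxx algebra_simps)
  also have "(J e \<bullet> e) * (J f \<bullet> f) - (J e \<bullet> f) * (J f \<bullet> e) = (J e \<times> J f) \<bullet> (e \<times> f)"
    by (simp add: cross3_inner_cross)
  also have "\<dots> = (j$1 * j$2 * j$3) * D \<gamma>"
    unfolding cross_J exf by (simp add: D_def inner_commute)
  finally show ?thesis by simp
qed

definition p :: real where "p = (1/2) * (b / a - 1)"

definition liouville :: "phase measure" where
  "liouville = volume_measure (\<lambda>(\<gamma>, q) u\<^sub>1 u\<^sub>2 u\<^sub>3 u\<^sub>4.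
     plane_det \<gamma> (reduced_legendre a b \<mu> A \<gamma>) powr p * wedge omega_can omega_can u\<^sub>1 u\<^sub>2 u\<^sub>3 u\<^sub>4)"

text \<open>The constants of the chart density: 2 from the square of the canonical form, the rest
  from the constant multiple in the determinant of the Legendre transform.\<close>

definition chart_factor :: real where "chart_factor = 2 * (k ^ 4 * (j$1 * j$2 * j$3)) powr p"

lemma chart_factor_pos: "chart_factor > 0"
  using k_nz by (simp add: chart_factor_def)

lemma D_continuous: "continuous_on S f \<Longrightarrow> continuous_on S (\<lambda>x. D (f x))"
  unfolding D_def by (intro continuous_intros)

lemma D_chart_pos: "D (stereographic x) > 0"
  by (rule D_pos) (use stereographic_norm[of x] in auto)

definition chart_density :: "real^2 \<Rightarrow> real" where
  "chart_density x = D (stereographic x) powr p * conf x ^ 4"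

lemma stereographic_continuous: "continuous_on S stereographic"
  by (rule has_derivative_continuous_on[OF has_derivative_at_withinI[OF stereographic_derivative]])

lemma chart_density_measurable [measurable]: "chart_density \<in> borel_measurable borel"
proof -
  have "continuous_on UNIV chart_density"
    unfolding chart_density_def conf_def
    by (intro continuous_intros D_continuous stereographic_continuous)
      (simp_all add: one_plus_pos D_chart_pos less_imp_neq[OF D_chart_pos, symmetric])
  then show ?thesis by (rule borel_measurable_continuous_onI)
qed

lemma cotangent_sphere_closed: "closed cotangent_sphere"
proof -
  have eq: "cotangent_sphere = {z. norm (fst z) = 1} \<inter> {z. fst z \<bullet> snd z = 0}"
    by (auto simp: cotangent_sphere_def)
  show ?thesis unfolding eq by (intro closed_Int closed_Collect_eq continuous_intros)
qed

lemma bundle_chart_in: "bundle_chart w \<in> cotangent_sphere"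
  by (simp add: bundle_chart_eq cotangent_sphere_def stereographic_norm stereo'_orth)

lemma sets_liouville: "sets liouville = sets (restrict_space borel cotangent_sphere)"
  by (simp add: liouville_def volume_measure_def)

lemma borel_of_sets_liouville: "E \<in> sets liouville \<longleftrightarrow> E \<in> sets borel \<and> E \<subseteq> cotangent_sphere"
  using cotangent_sphere_closed by (auto simp: sets_liouville sets_restrict_space_iff)

lemma emeasure_liouville:
  assumes E: "E \<in> sets borel" "E \<subseteq> cotangent_sphere"
  shows "emeasure liouville E = ennreal chart_factor *
    (\<integral>\<^sup>+x. ennreal (chart_density x) * (\<integral>\<^sup>+y. indicator E (bundle_chart (x, y)) \<partial>lborel) \<partial>lborel)"
proof -
  let ?d = "\<lambda>w. frechet_derivative bundle_chart (at w)"
  have m: "bundle_chart \<in> borel_measurable borel"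
    by (rule borel_measurable_continuous_onI[OF bundle_chart_continuous])
  have mr: "bundle_chart \<in> measurable lborel (restrict_space borel cotangent_sphere)"
    using m bundle_chart_in by (intro measurable_restrict_space2) auto
  have mE: "(\<lambda>w. indicator E (bundle_chart w) :: ennreal) \<in> borel_measurable borel"
    by (rule measurable_compose[OF m borel_measurable_indicator[OF E(1)]])
  have md [measurable]: "(\<lambda>w :: (real^2) \<times> (real^2). chart_density (fst w)) \<in> borel_measurable borel"
    unfolding borel_prod[symmetric] by measurable
  have "(\<lambda>w :: (real^2) \<times> (real^2). ennreal (chart_density (fst w))) \<in> borel_measurable lborel"
    using md by simp
  then have fm: "(\<lambda>w. ennreal (chart_density (fst w)) * indicator E (bundle_chart w)) \<in> borel_measurable lborel"
    by (rule borel_measurable_times_ennreal) (use mE in simp)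
  have dens: "\<bar>(case bundle_chart w of (\<gamma>, q) \<Rightarrow> \<lambda>u\<^sub>1 u\<^sub>2 u\<^sub>3 u\<^sub>4.
       plane_det \<gamma> (reduced_legendre a b \<mu> A \<gamma>) powr p * wedge omega_can omega_can u\<^sub>1 u\<^sub>2 u\<^sub>3 u\<^sub>4)
       (?d w (axis 1 1, 0)) (?d w (axis 2 1, 0)) (?d w (0, axis 1 1)) (?d w (0, axis 2 1))\<bar> = chart_factor * chart_density (fst w)" for w
  proof -
    have "(k ^ 4 * (j$1 * j$2 * j$3) * D (stereographic (fst w))) powr p
        = (k ^ 4 * (j$1 * j$2 * j$3)) powr p * D (stereographic (fst w)) powr p"
      by (rule powr_mult)
    then show ?thesis
      unfolding bundle_chart_eq[of w] prod.case liouville_in_chart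
        plane_det_reduced_legendre[OF stereographic_unit]
      by (simp add: chart_factor_def chart_density_def abs_mult)
  qed
  have "emeasure liouville E = emeasure (density lborel (\<lambda>w. ennreal (chart_factor * chart_density (fst w)))) (bundle_chart -` E)"
    unfolding liouville_def volume_measure_def Let_def dens
    using E mr cotangent_sphere_closed
    by (subst emeasure_distr) (auto simp: sets_restrict_space_iff)
  also have "\<dots> = (\<integral>\<^sup>+w. ennreal (chart_factor * chart_density (fst w)) * indicator (bundle_chart -` E) w \<partial>lborel)"
    using measurable_sets[OF m E(1)] by (intro emeasure_density) auto
  also have "\<dots> = (\<integral>\<^sup>+w. ennreal chart_factor * (ennreal (chart_density (fst w)) * indicator E (bundle_chart w)) \<partial>lborel)"
    using chart_factor_pos by (intro nn_integral_cong) (auto simp: indicator_def ennreal_mult' mult.assoc)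
  also have "\<dots> = ennreal chart_factor * (\<integral>\<^sup>+w. ennreal (chart_density (fst w)) * indicator E (bundle_chart w) \<partial>lborel)"
    by (rule nn_integral_cmult[OF fm])
  also have "(\<integral>\<^sup>+w. ennreal (chart_density (fst w)) * indicator E (bundle_chart w) \<partial>lborel)
      = (\<integral>\<^sup>+x. \<integral>\<^sup>+y. ennreal (chart_density x) * indicator E (bundle_chart (x, y)) \<partial>lborel \<partial>lborel)"
  proof -
    have "(\<lambda>w. ennreal (chart_density (fst w)) * indicator E (bundle_chart w))
        \<in> borel_measurable ((lborel :: (real^2) measure) \<Otimes>\<^sub>M (lborel :: (real^2) measure))"
      unfolding lborel_prod by (rule fm)
    from lborel.nn_integral_fst[OF this, symmetric] show ?thesis by (simp add: lborel_prod)
  qed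
  also have "\<dots> = (\<integral>\<^sup>+x. ennreal (chart_density x) * (\<integral>\<^sup>+y. indicator E (bundle_chart (x, y)) \<partial>lborel) \<partial>lborel)"
  proof (rule nn_integral_cong)
    fix x :: "real^2"
    have "(\<lambda>y. indicator E (bundle_chart (x, y)) :: ennreal) \<in> borel_measurable lborel"
      using measurable_compose[OF _ mE, of "\<lambda>y. (x, y)" lborel] by simp
    then show "(\<integral>\<^sup>+y. ennreal (chart_density x) * indicator E (bundle_chart (x, y)) \<partial>lborel)
      = ennreal (chart_density x) * (\<integral>\<^sup>+y. indicator E (bundle_chart (x, y)) \<partial>lborel)"
      by (intro nn_integral_cmult) auto
  qed
  finally show ?thesis .
qed

text \<open>Preimage under \<^const>\<open>project\<close>, cut down to one unit in each of the two invariant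
  directions \<open>\<bar>\<gamma>\<bar>\<close> and \<open>spin / \<bar>\<gamma>\<bar>\<close> that \<^const>\<open>project\<close> forgets.\<close>

definition thicken :: "phase set \<Rightarrow> phase set" where
  "thicken E = {z. fst z \<noteq> 0 \<and> project z \<in> E \<and> 1 \<le> norm (fst z) \<and> norm (fst z) \<le> 2
     \<and> 0 \<le> spin (fst z) (snd z) \<and> spin (fst z) (snd z) \<le> norm (fst z)}"

lemma B_continuous: "continuous_on UNIV B"
  by (rule linear_continuous_on[OF bounded_linear_B])

lemma B_measurable [measurable]: "B \<in> borel_measurable borel"
  by (rule borel_measurable_continuous_onI[OF B_continuous])

lemma project_measurable [measurable]: "project \<in> borel_measurable borel"
  unfolding project_def[abs_def] borel_prod[symmetric] by measurable

lemma thicken_measurable: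
  assumes "E \<in> sets borel"
  shows "thicken E \<in> sets borel"
proof -
  have "{z \<in> space borel. fst z \<noteq> 0 \<and> project z \<in> E \<and> 1 \<le> norm (fst z) \<and> norm (fst z) \<le> 2
     \<and> 0 \<le> fst z \<bullet> B (snd z) \<and> fst z \<bullet> B (snd z) \<le> norm (fst z)} \<in> sets borel"
    using assms project_measurable unfolding borel_prod[symmetric] by measurable
  then show ?thesis by (simp add: thicken_def spin_def)
qed

lemma thicken_subset: "thicken E \<subseteq> punctured"
  by (auto simp: thicken_def punctured_def)

text \<open>Linear coordinates on the momenta \<open>K\<close> over a fixed direction: the first two
  are the chart coordinates of \<open>p\<close>, the third is the spin with respect to the unit
  vector \<open>stereographic x\<close>.\<close>

definition fibre :: "real^2 \<Rightarrow> real^3 \<Rightarrow> real^3" where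
  "fibre x w = notwist (stereographic x) ((1/k) *\<^sub>R (stereo' x (base w) \<times> stereographic x))
     + (w$3 / D (stereographic x)) *\<^sub>R stereographic x"

lemma linear_fibre: "linear (fibre x)"
  unfolding fibre_def notwist_def spin_def
  by (intro linearI)
    (simp_all add: linear_add[OF linear_base] linear_cmul[OF linear_base] linear_add[OF linear_stereo']
      linear_cmul[OF linear_stereo'] B_simps cross_add_left cross_mult_left inner_add_right
      add_divide_distrib scaleR_add_left scaleR_add_right algebra_simps)

text \<open>The spin column is \<open>1 / D\<close> times the unit normal, since spin grows at rate
  \<open>D\<close> along it; this is the power of \<open>D\<close> lost in slicing. The other
  columns are, up to radial parts, the chart's tangent vectors turned by a right angle and divided
  by \<open>k\<close>.\<close>

lemma fibre_det: "\<bar>det (matrix (fibre x))\<bar> = (conf x)\<^sup>2 / (k\<^sup>2 * D (stereographic x))"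
proof -
  let ?u = "stereographic x" and ?e = "\<lambda>i. stereo' x (axis i 1)"
  let ?c = "\<lambda>i. spin ?u ((1/k) *\<^sub>R (?e i \<times> ?u)) / D ?u"
  have f3: "fibre x (axis 3 1) = (1 / D ?u) *\<^sub>R ?u"
    by (simp add: fibre_def base_axis linear_0[OF linear_stereo'] notwist_def spin_def B_simps)
  have ax: "axis 1 1 $ (3::3) = (0::real)" "axis 2 1 $ (3::3) = (0::real)" by (simp_all add: axis_def)
  have f12: "fibre x (axis 1 1) = (1/k) *\<^sub>R (?e 1 \<times> ?u) - ?c 1 *\<^sub>R ?u"
    "fibre x (axis 2 1) = (1/k) *\<^sub>R (?e 2 \<times> ?u) - ?c 2 *\<^sub>R ?u"
    using ax by (simp_all add: fibre_def base_axis notwist_def)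
  have x2: "fibre x (axis 2 1) \<times> fibre x (axis 3 1) = (- 1 / (k * D ?u)) *\<^sub>R ?e 2"
    unfolding f12 f3
    by (simp add: cross_mult_left cross_mult_right Cross3.left_diff_distrib cross3_cross_left stereographic_unit stereo'_axis)
  have "fibre x (axis 1 1) \<bullet> ?e 2 = (1/k) * ((?e 1 \<times> ?u) \<bullet> ?e 2)"
    unfolding f12 by (simp add: inner_diff_left stereo'_axis)
  also have "(?e 1 \<times> ?u) \<bullet> ?e 2 = - (?e 1 \<bullet> (?e 2 \<times> ?u))"
    by (simp add: cross3_simps)
  finally have "det (matrix (fibre x)) = (1 / (k\<^sup>2 * D ?u)) * (?e 1 \<bullet> (?e 2 \<times> ?u))"
    unfolding det_matrix_3 x2 by (simp add: power2_eq_square)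
  then show ?thesis
    using D_chart_pos[of x] by (simp add: abs_mult stereo'_axis)
qed

lemma fibre_range: "range (fibre x) = UNIV" "inj (fibre x)"
proof -
  have "det (matrix (fibre x)) \<noteq> 0"
    using fibre_det[of x] conf_pos[of x] D_chart_pos[of x] k_nz by auto
  then show "inj (fibre x)" using det_nz_iff_inj[OF linear_fibre] by blast
  then show "range (fibre x) = UNIV" using linear_injective_imp_surjective[OF linear_fibre] by blast
qed

text \<open>Spin scales with the norm of \<gamma>. Measured against that norm in
  \<open>thicken\<close>, it confines \<open>w$3\<close> to the same unit interval for every radius,
  so the thickened set becomes a product.\<close>

lemma fibre_thicken:
  assumes r: "r > 0"
  shows "(r *\<^sub>R stereographic x, fibre x w) \<in> thicken E
    \<longleftrightarrow> bundle_chart (x, base w) \<in> E \<and> r \<in> {1..2} \<and> w$3 \<in> {0..1}"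
proof -
  let ?u = "stereographic x"
  have u: "norm ?u = 1" "?u \<noteq> 0" "?u \<bullet> ?u = 1"
    using stereographic_norm[of x] stereographic_unit[of x] by auto
  have "spin ?u (fibre x w) = w$3"
    using notwist_orth[OF u(2)] D_chart_pos[of x]
    by (simp add: spin_def fibre_def B_simps inner_add_right D_def[symmetric])
  then have s: "spin (r *\<^sub>R ?u) (fibre x w) = r * w$3" by (simp add: spin_def)
  have "?u \<times> fibre x w = ?u \<times> ((1/k) *\<^sub>R (stereo' x (base w) \<times> ?u))"
    by (simp add: fibre_def notwist_def cross_add_right Cross3.right_diff_distrib cross_mult_right)
  also have "\<dots> = (1/k) *\<^sub>R stereo' x (base w)"
    by (simp add: cross_mult_right cross3_cross_right u stereo'_orth)
  finally have "project (r *\<^sub>R ?u, fibre x w) = bundle_chart (x, base w)"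
    using r u k_nz by (simp add: project_def bundle_chart_eq)
  then show ?thesis
    using r u by (auto simp: thicken_def s zero_le_mult_iff)
qed

lemma fibre_integral:
  assumes E: "E \<in> sets borel" and r: "r > 0"
  shows "(\<integral>\<^sup>+K. indicator (thicken E) (r *\<^sub>R stereographic x, K) \<partial>lborel)
    = indicator {1..2} r * ennreal ((conf x)\<^sup>2 / (k\<^sup>2 * D (stereographic x)))
      * (\<integral>\<^sup>+y. indicator E (bundle_chart (x, y)) \<partial>lborel)"
proof -
  let ?c = "(conf x)\<^sup>2 / (k\<^sup>2 * D (stereographic x))"
  have mE: "(\<lambda>y. indicator E (bundle_chart (x, y)) :: ennreal) \<in> borel_measurable borel"
  proof -
    have [measurable]: "bundle_chart \<in> borel_measurable borel" "E \<in> sets borel"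
      using borel_measurable_continuous_onI[OF bundle_chart_continuous] E by auto
    show ?thesis by measurable
  qed
  have [measurable]: "base \<in> borel_measurable borel"
    using linear_base by (intro borel_measurable_continuous_onI) (simp add: linear_continuous_on linear_linear)
  have m1: "(\<lambda>w. indicator E (bundle_chart (x, base w)) :: ennreal) \<in> borel_measurable borel"
    by (rule measurable_compose[OF \<open>base \<in> borel_measurable borel\<close> mE])
  have m2: "(\<lambda>w :: real^3. indicator {0..1} (w$3) :: ennreal) \<in> borel_measurable borel" by measurable
  have mT: "(\<lambda>K. indicator (thicken E) (r *\<^sub>R stereographic x, K) :: ennreal) \<in> borel_measurable borel"
    using thicken_measurable[OF E] by measurable
  have "(\<integral>\<^sup>+K. indicator (thicken E) (r *\<^sub>R stereographic x, K) \<partial>lborel)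
      = (\<integral>\<^sup>+K. indicator (thicken E) (r *\<^sub>R stereographic x, K) * indicator (fibre x ` UNIV) K \<partial>lborel)"
    by (simp add: fibre_range)
  also have "\<dots> = (\<integral>\<^sup>+w. indicator (thicken E) (r *\<^sub>R stereographic x, fibre x w) * ennreal (indicator UNIV w * \<bar>det (matrix (fibre x))\<bar>) \<partial>lborel)"
  proof (rule nn_integral_change_of_variables_cart)
    show "(fibre x has_derivative fibre x) (at w)" for w by (rule linear_imp_has_derivative[OF linear_fibre])
    show "inj_on (fibre x) UNIV" by (rule fibre_range)
    show "fibre x ` UNIV \<in> sets borel" by (simp add: fibre_range)
    show "(\<lambda>K. indicator (thicken E) (r *\<^sub>R stereographic x, K) :: ennreal) \<in> borel_measurable borel" by (rule mT)
  qed simp_all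
  also have "\<dots> = (\<integral>\<^sup>+w. (indicator {1..2} r * ennreal ?c) * (indicator E (bundle_chart (x, base w)) * indicator {0..1} (w$3)) \<partial>lborel)"
    by (intro nn_integral_cong) (auto simp: fibre_det fibre_thicken[OF r] indicator_def)
  also have "\<dots> = (indicator {1..2} r * ennreal ?c) * (\<integral>\<^sup>+w. indicator E (bundle_chart (x, base w)) * indicator {0..1} (w$3) \<partial>lborel)"
    using m1 m2 by (intro nn_integral_cmult borel_measurable_times_ennreal) simp_all
  also have "(\<integral>\<^sup>+w. indicator E (bundle_chart (x, base w)) * indicator {0..1} (w$3) \<partial>lborel)
      = (\<integral>\<^sup>+q. indicator E (bundle_chart (x, base (join q))) * indicator {0..1} (join q $ 3) \<partial>lborel :: ennreal)"
    using m1 m2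
    by (intro nn_integral_lborel_basis_isometry[OF join_isometry, symmetric] borel_measurable_times_ennreal) simp_all
  also have "\<dots> = (\<integral>\<^sup>+q. indicator E (bundle_chart (x, fst q)) * indicator {0..1::real} (snd q) \<partial>(lborel \<Otimes>\<^sub>M lborel))"
    by (simp add: join_components lborel_prod)
  also have "\<dots> = (\<integral>\<^sup>+y. \<integral>\<^sup>+s. indicator E (bundle_chart (x, y)) * indicator {0..1::real} s \<partial>lborel \<partial>lborel)"
  proof -
    have "(\<lambda>q. indicator E (bundle_chart (x, fst q)) * indicator {0..1::real} (snd q) :: ennreal)
        \<in> borel_measurable ((lborel :: (real^2) measure) \<Otimes>\<^sub>M (lborel :: real measure))"
      by (intro borel_measurable_times_ennreal measurable_compose[OF measurable_fst, of _ _ lborel]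
          measurable_compose[OF measurable_snd, of _ _ lborel]) (use mE in simp_all)
    from lborel.nn_integral_fst[OF this, symmetric] show ?thesis by simp
  qed
  also have "\<dots> = (\<integral>\<^sup>+y. indicator E (bundle_chart (x, y)) \<partial>lborel)"
    by (intro nn_integral_cong) (simp add: nn_integral_cmult)
  finally show ?thesis .
qed

lemma weight_scale: "r > 0 \<Longrightarrow> weight (r *\<^sub>R u) = r powr k * weight u"
proof -
  assume r: "r > 0"
  have D: "D (r *\<^sub>R u) = r powr 2 * D u" using r by (simp add: D_def B_simps power2_eq_square)
  have "(r powr 2 * D u) powr (k / 2) = (r powr 2) powr (k / 2) * D u powr (k / 2)"
    by (rule powr_mult)
  also have "(r powr 2) powr (k / 2) = r powr k" by (simp add: powr_powr)
  finally show ?thesis by (simp only: weight_def D)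
qed

text \<open>\<open>r powr k\<close> comes from the homogeneity of the weight,
  \<open>r\<^sup>2\<close> from the polar Jacobian and \<open>1 / k\<^sup>2\<close> from the fibre
  Jacobian. Its value is immaterial beyond being positive and finite.\<close>

definition radial_factor :: ennreal where "radial_factor = (\<integral>\<^sup>+r. indicator {1..2} r * ennreal (r powr k * r\<^sup>2 / k\<^sup>2) \<partial>lborel)"

text \<open>In polar and fibre coordinates the integral factorizes. The Jacobians supply
  \<open>conf\<^sup>2\<close> each and one factor \<open>1 / D\<close>, so the weight
  \<open>D powr (k / 2)\<close> turns into \<open>D powr p\<close> and what remains is the chart
  integral of the Liouville measure.\<close>

lemma emeasure_thicken:
  assumes E: "E \<in> sets borel"
  shows "emeasure ambient_measure (thicken E) =
    radial_factor * (\<integral>\<^sup>+x. ennreal (chart_density x) * (\<integral>\<^sup>+y. indicator E (bundle_chart (x, y)) \<partial>lborel) \<partial>lborel)"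
proof -
  let ?T = "thicken E"
  let ?S = "{w :: real^3. w$3 > 0}"
  define I where "I x = (\<integral>\<^sup>+y. indicator E (bundle_chart (x, y)) \<partial>lborel :: ennreal)" for x
  define G where "G \<gamma> = (\<integral>\<^sup>+K. ennreal (weight \<gamma>) * indicator ?T (\<gamma>, K) \<partial>lborel)" for \<gamma>
  have T: "?T \<in> sets borel" by (rule thicken_measurable[OF E])
  have wm: "weight \<in> borel_measurable borel"
    unfolding weight_def[abs_def] D_def by measurable
  have [measurable]: "bundle_chart \<in> borel_measurable borel" "E \<in> sets borel" "?T \<in> sets borel"
    using borel_measurable_continuous_onI[OF bundle_chart_continuous] E T by auto
  note wm[measurable]
  have Im: "I \<in> borel_measurable borel"
  proof -
    have "(\<lambda>w. indicator E (bundle_chart w) :: ennreal) \<in> borel_measurable (lborel \<Otimes>\<^sub>M lborel)"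
      unfolding lborel_prod by measurable
    then have "(\<lambda>(x, y). indicator E (bundle_chart (x, y)) :: ennreal) \<in> borel_measurable (lborel \<Otimes>\<^sub>M lborel)"
      by (simp add: case_prod_beta')
    from lborel.borel_measurable_nn_integral[OF this] have "I \<in> borel_measurable lborel"
      by (simp add: I_def[abs_def])
    then show ?thesis by simp
  qed
  have Fm: "(\<lambda>(\<gamma>, K). ennreal (weight \<gamma>) * indicator ?T (\<gamma>, K)) \<in> borel_measurable (lborel \<Otimes>\<^sub>M lborel)"
  proof -
    have [measurable]: "?T \<in> sets (lborel \<Otimes>\<^sub>M lborel)" using T unfolding borel_prod[symmetric] by simp
    have "(\<lambda>z. ennreal (weight (fst z)) * indicator ?T z) \<in> borel_measurable (lborel \<Otimes>\<^sub>M lborel)"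
      by measurable
    then show ?thesis by (simp add: case_prod_beta')
  qed
  have Gm: "G \<in> borel_measurable borel"
    using lborel.borel_measurable_nn_integral[OF Fm] by (simp add: G_def[abs_def])
  have "emeasure ambient_measure ?T = (\<integral>\<^sup>+z. ennreal (indicator punctured z * weight (fst z)) * indicator ?T z \<partial>lborel)"
    unfolding ambient_measure_def
  proof (rule emeasure_density)
    have "(\<lambda>z :: phase. weight (fst z)) \<in> borel_measurable borel"
      unfolding borel_prod[symmetric] by measurable
    moreover have "(indicator punctured :: phase \<Rightarrow> real) \<in> borel_measurable borel"
      using open_punctured by (intro borel_measurable_indicator) simp
    ultimately show "(\<lambda>z. ennreal (indicator punctured z * weight (fst z))) \<in> borel_measurable lborel"
      by simp
    show "?T \<in> sets lborel" using T by simp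
  qed
  also have "\<dots> = (\<integral>\<^sup>+z. (case z of (\<gamma>, K) \<Rightarrow> ennreal (weight \<gamma>) * indicator ?T (\<gamma>, K)) \<partial>(lborel \<Otimes>\<^sub>M lborel))"
    unfolding lborel_prod
    by (intro nn_integral_cong) (use thicken_subset in \<open>auto simp: indicator_def split: prod.splits\<close>)
  also have "\<dots> = (\<integral>\<^sup>+\<gamma>. G \<gamma> \<partial>lborel)"
    unfolding G_def using lborel.nn_integral_fst[OF Fm] by simp
  also have "\<dots> = (\<integral>\<^sup>+\<gamma>. G \<gamma> * indicator (polar ` ?S) \<gamma> \<partial>lborel)"
  proof (rule nn_integral_cong_AE)
    have "negligible {\<gamma> :: real^3. \<gamma> $ 1 = 0}"
      using negligible_hyperplane[of "axis 1 1 :: real^3" 0] by (simp add: inner_axis' axis_eq_0_iff)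
    then have "negligible (- polar ` ?S)" by (rule negligible_subset[OF _ polar_image])
    then have "AE \<gamma> in lebesgue. \<gamma> \<notin> - polar ` ?S"
      by (intro AE_not_in) (simp add: negligible_iff_null_sets)
    then have "AE \<gamma> in lborel. \<gamma> \<in> polar ` ?S" by (simp add: AE_completion_iff)
    then show "AE \<gamma> in lborel. G \<gamma> = G \<gamma> * indicator (polar ` ?S) \<gamma>" by (rule AE_mp) (simp add: indicator_def)
  qed
  also have "\<dots> = (\<integral>\<^sup>+w. G (polar w) * ennreal (indicator ?S w * \<bar>det (matrix
      (\<lambda>h. (h$3) *\<^sub>R stereographic (base w) + (w$3) *\<^sub>R stereo' (base w) (base h)))\<bar>) \<partial>lborel)"
  proof (rule nn_integral_change_of_variables_cart)
    have oS: "open ?S" by (intro open_Collect_less continuous_intros)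
    then show "?S \<in> sets borel" by simp
    show "(polar has_derivative (\<lambda>h. (h$3) *\<^sub>R stereographic (base w) + (w$3) *\<^sub>R stereo' (base w) (base h))) (at w within ?S)" for w
      by (rule has_derivative_at_withinI[OF polar_derivative])
    show "inj_on polar ?S" by (rule polar_inj)
    have cb: "continuous_on UNIV base" using linear_base by (simp add: linear_continuous_on linear_linear)
    have "continuous_on UNIV (\<lambda>w. (w$3)\<^sup>2 * (conf (base w))\<^sup>2)"
      unfolding conf_def by (intro continuous_intros cb) (simp add: one_plus_pos)
    then have [measurable]: "(\<lambda>w. (w$3)\<^sup>2 * (conf (base w))\<^sup>2) \<in> borel_measurable borel"
      by (rule borel_measurable_continuous_onI)
    have [measurable]: "?S \<in> sets borel" using oS by simp
    show "(\<lambda>w. indicator ?S w * \<bar>det (matrix (\<lambda>h. (h$3) *\<^sub>R stereographic (base w) + (w$3) *\<^sub>R stereo' (base w) (base h)))\<bar>)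
        \<in> borel_measurable borel"
      unfolding polar_det by measurable
    have "continuous_on ?S polar"
      by (rule has_derivative_continuous_on[OF has_derivative_at_withinI[OF polar_derivative]])
    then have "open (polar ` ?S)" using invariance_of_domain oS polar_inj by blast
    then show "polar ` ?S \<in> sets borel" by simp
    show "G \<in> borel_measurable borel" by (rule Gm)
  qed
  also have "\<dots> = (\<integral>\<^sup>+w. (ennreal (chart_density (base w)) * I (base w)) *
      (indicator {1..2} (w$3) * ennreal ((w$3) powr k * (w$3)\<^sup>2 / k\<^sup>2)) \<partial>lborel)"
  proof (rule nn_integral_cong)
    fix w :: "real^3"
    show "G (polar w) * ennreal (indicator ?S w * \<bar>det (matrix
      (\<lambda>h. (h$3) *\<^sub>R stereographic (base w) + (w$3) *\<^sub>R stereo' (base w) (base h)))\<bar>)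
      = (ennreal (chart_density (base w)) * I (base w)) * (indicator {1..2} (w$3) * ennreal ((w$3) powr k * (w$3)\<^sup>2 / k\<^sup>2))"
    proof (cases "w$3 > 0")
      case True
      let ?r = "w$3" and ?x = "base w"
      let ?u = "stereographic ?x"
      have Dp: "D ?u > 0" by (rule D_chart_pos)
      have G: "G (polar w) = ennreal (weight (?r *\<^sub>R ?u)) * (indicator {1..2} ?r * ennreal ((conf ?x)\<^sup>2 / (k\<^sup>2 * D ?u)) * I ?x)"
        unfolding G_def polar_def I_def fibre_integral[OF E True, symmetric]
        by (intro nn_integral_cmult) measurable
      \<comment> \<open>The one place where the exponent of the ambient weight meets the exponent in
        the theorem.\<close>
      have "k / 2 = p + 1" using a by (simp add: k_def p_def field_simps)
      then have wD: "weight ?u = D ?u powr p * D ?u"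
        unfolding weight_def by (simp only:) (use Dp in \<open>simp add: powr_add\<close>)
      have prd: "weight (?r *\<^sub>R ?u) * ((conf ?x)\<^sup>2 / (k\<^sup>2 * D ?u)) * (?r\<^sup>2 * (conf ?x)\<^sup>2)
          = chart_density ?x * (?r powr k * ?r\<^sup>2 / k\<^sup>2)"
        using Dp k_nz by (simp add: weight_scale[OF True] wD chart_density_def power2_eq_square power4_eq_xxxx field_simps)
      have "weight (?r *\<^sub>R ?u) \<ge> 0" "chart_density ?x \<ge> 0" "(conf ?x)\<^sup>2 / (k\<^sup>2 * D ?u) \<ge> 0"
        using Dp by (auto simp: weight_def chart_density_def)
      have "ennreal (weight (?r *\<^sub>R ?u)) * ennreal ((conf ?x)\<^sup>2 / (k\<^sup>2 * D ?u)) * ennreal (?r\<^sup>2 * (conf ?x)\<^sup>2)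
          = ennreal (chart_density ?x) * ennreal (?r powr k * ?r\<^sup>2 / k\<^sup>2)"
      proof -
        have "ennreal s * ennreal t * ennreal u = ennreal v * ennreal w"
          if "s * t * u = v * w" "0 \<le> s" "0 \<le> t" "0 \<le> u" "0 \<le> v" "0 \<le> w" for s t u v w :: real
          using that by (simp add: ennreal_mult[symmetric])
        from this[OF prd] show ?thesis
          using \<open>weight (?r *\<^sub>R ?u) \<ge> 0\<close> \<open>chart_density ?x \<ge> 0\<close>
            \<open>(conf ?x)\<^sup>2 / (k\<^sup>2 * D ?u) \<ge> 0\<close> by simp
      qed
      then have "G (polar w) * ennreal (?r\<^sup>2 * (conf ?x)\<^sup>2)
          = (ennreal (chart_density ?x) * ennreal (?r powr k * ?r\<^sup>2 / k\<^sup>2)) * (indicator {1..2} ?r * I ?x)"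
        unfolding G by (simp only: mult_ac)
      then show ?thesis using True by (simp add: polar_det mult_ac)
    next
      case False
      then show ?thesis by (simp add: indicator_def)
    qed
  qed
  also have "\<dots> = (\<integral>\<^sup>+q. (ennreal (chart_density (base (join q))) * I (base (join q))) *
      (indicator {1..2} (join q $ 3) * ennreal ((join q $ 3) powr k * (join q $ 3)\<^sup>2 / k\<^sup>2)) \<partial>lborel)"
  proof (rule nn_integral_lborel_basis_isometry[OF join_isometry, symmetric])
    have [measurable]: "base \<in> borel_measurable borel"
      using linear_base by (intro borel_measurable_continuous_onI) (simp add: linear_continuous_on linear_linear)
    note Im[measurable]
    show "(\<lambda>w. (ennreal (chart_density (base w)) * I (base w)) *
      (indicator {1..2} (w$3) * ennreal ((w$3) powr k * (w$3)\<^sup>2 / k\<^sup>2))) \<in> borel_measurable borel" by measurable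
  qed
  also have "\<dots> = (\<integral>\<^sup>+q. (ennreal (chart_density (fst q)) * I (fst q)) *
      (indicator {1..2} (snd q) * ennreal ((snd q) powr k * (snd q)\<^sup>2 / k\<^sup>2)) \<partial>(lborel \<Otimes>\<^sub>M lborel))"
    by (simp add: join_components lborel_prod)
  also have "\<dots> = (\<integral>\<^sup>+x. \<integral>\<^sup>+r. (ennreal (chart_density x) * I x) * (indicator {1..2} r * ennreal (r powr k * r\<^sup>2 / k\<^sup>2)) \<partial>lborel \<partial>lborel)"
  proof -
    have f: "(\<lambda>x. ennreal (chart_density x) * I x) \<in> borel_measurable lborel"
      using Im by simp
    have g: "(\<lambda>r :: real. indicator {1..2} r * ennreal (r powr k * r\<^sup>2 / k\<^sup>2)) \<in> borel_measurable lborel"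
      by measurable
    have "(\<lambda>q. (ennreal (chart_density (fst q)) * I (fst q)) *
        (indicator {1..2} (snd q) * ennreal ((snd q) powr k * (snd q)\<^sup>2 / k\<^sup>2))) \<in> borel_measurable (lborel \<Otimes>\<^sub>M lborel)"
      by (rule borel_measurable_times_ennreal[OF measurable_compose[OF measurable_fst f] measurable_compose[OF measurable_snd g]])
    from lborel.nn_integral_fst[OF this, symmetric] show ?thesis by simp
  qed
  also have "\<dots> = (\<integral>\<^sup>+x. (ennreal (chart_density x) * I x) * radial_factor \<partial>lborel)"
    unfolding radial_factor_def by (intro nn_integral_cong nn_integral_cmult) measurable
  also have "\<dots> = (\<integral>\<^sup>+x. (ennreal (chart_density x) * I x) \<partial>lborel) * radial_factor"
    using Im by (intro nn_integral_multc) measurable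
  finally show ?thesis by (simp add: I_def mult.commute)
qed

end

section \<open>Invariance\<close>

context rubber_rolling
begin

lemma radial_factor_pos_finite: "0 < radial_factor" "radial_factor < \<infinity>"
proof -
  let ?f = "\<lambda>r :: real. r powr k * r\<^sup>2 / k\<^sup>2"
  have c: "continuous_on {1..2} ?f" using k_nz by (intro continuous_intros) auto
  have pos: "?f r > 0" if "r \<in> {1..2}" for r using that k_nz by simp
  have radial_factor: "radial_factor = (\<integral>\<^sup>+r. ennreal (?f r) * indicator {1..2} r \<partial>lborel)"
    by (simp add: radial_factor_def mult.commute)
  obtain m where m: "m \<in> {1..2}" "\<And>r. r \<in> {1..2} \<Longrightarrow> ?f m \<le> ?f r"
    using continuous_attains_inf[OF _ _ c] by auto
  obtain M where M: "M \<in> {1..2}" "\<And>r. r \<in> {1..2} \<Longrightarrow> ?f r \<le> ?f M"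
    using continuous_attains_sup[OF _ _ c] by auto
  have e: "(\<integral>\<^sup>+r. ennreal q * indicator {1..2::real} r \<partial>lborel) = ennreal q" for q
    by (simp add: nn_integral_cmult_indicator)
  have "(\<integral>\<^sup>+r. ennreal (?f m) * indicator {1..2::real} r \<partial>lborel) \<le> radial_factor"
    unfolding radial_factor
    by (intro nn_integral_mono) (use m(2) in \<open>auto simp: indicator_def intro!: ennreal_leI\<close>)
  then have "ennreal (?f m) \<le> radial_factor" by (simp only: e)
  then show "0 < radial_factor" using pos[OF m(1)] by (intro less_le_trans[of 0 "ennreal (?f m)" radial_factor]) simp_all
  have "radial_factor \<le> (\<integral>\<^sup>+r. ennreal (?f M) * indicator {1..2::real} r \<partial>lborel)"
    unfolding radial_factor
    by (intro nn_integral_mono) (use M(2) in \<open>auto simp: indicator_def intro!: ennreal_leI\<close>)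
  then have "radial_factor \<le> ennreal (?f M)" by (simp only: e)
  then show "radial_factor < \<infinity>" by (rule le_less_trans) simp
qed

text \<open>Both measures are constant multiples of the same chart integral; the cross-multiplied
  form avoids division in \<open>ennreal\<close>.\<close>

lemma emeasure_liouville_thicken:
  assumes E: "E \<in> sets liouville"
  shows "radial_factor * emeasure liouville E = ennreal chart_factor * emeasure ambient_measure (thicken E)"
  using emeasure_liouville[of E] emeasure_thicken[of E] E
  by (simp add: borel_of_sets_liouville mult_ac)

definition reduced_flow :: "real \<Rightarrow> phase \<Rightarrow> phase" where
  "reduced_flow t z = project (amb.\<Phi> t (embed z))"

text \<open>The projection intertwines the flows from every ambient point, not just from the image
  of \<open>embed\<close>, by uniqueness of reduced solutions; \<open>thicken\<close> meets all
  these levels.\<close>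

lemma project_flow:
  assumes w: "w \<in> punctured"
  shows "project (amb.\<Phi> t w) = reduced_flow t (project w)"
proof -
  have "(project w, project (amb.\<Phi> t w)) \<in> flow cotangent_sphere reduced_vf t"
    unfolding flow_def
    by (auto intro!: exI[of _ UNIV] exI[of _ "\<lambda>s. project (amb.\<Phi> s w)"]
        project_in amb.\<Phi>_in w project_ambient_flow simp: amb.\<Phi>_0[OF w])
  then show ?thesis by (simp add: flow_reduced_vf reduced_flow_def)
qed

lemma reduced_flow_in: "z \<in> cotangent_sphere \<Longrightarrow> reduced_flow t z \<in> cotangent_sphere"
  unfolding reduced_flow_def by (intro project_in amb.\<Phi>_in embed_in)

lemma reduced_flow_inverse:
  assumes z: "z \<in> cotangent_sphere"
  shows "reduced_flow (- t) (reduced_flow t z) = z"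
proof -
  have e: "embed z \<in> punctured" by (rule embed_in[OF z])
  have "reduced_flow (- t) (reduced_flow t z) = project (amb.\<Phi> (- t) (amb.\<Phi> t (embed z)))"
    unfolding project_flow[OF amb.\<Phi>_in[OF e]] by (simp add: reduced_flow_def)
  then show ?thesis by (simp add: amb.\<Phi>_inverse[OF e] project_embed[OF z])
qed

lemma reduced_flow_inverse': "z \<in> cotangent_sphere \<Longrightarrow> reduced_flow t (reduced_flow (- t) z) = z"
  using reduced_flow_inverse[of z "- t"] by simp

lemma reduced_flow_continuous: "continuous_on cotangent_sphere (reduced_flow t)"
proof -
  have "D (fst z) \<noteq> 0" if "z \<in> cotangent_sphere" for z
    using Dz(2) cotangent_subset_punctured that by blast
  then have "continuous_on cotangent_sphere embed"
    unfolding embed_def[abs_def] notwist_def spin_def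
    by (intro continuous_intros continuous_on_cross D_continuous) simp
  then have ce: "continuous_on cotangent_sphere (\<lambda>z. amb.\<Phi> t (embed z))"
    by (rule continuous_on_compose2[OF amb.\<Phi>_continuous]) (use embed_in in blast)
  have cp: "continuous_on punctured project"
    unfolding project_def[abs_def]
    by (intro continuous_intros continuous_on_cross) (auto simp: punctured_def)
  show ?thesis
    unfolding reduced_flow_def[abs_def]
    by (rule continuous_on_compose2[OF cp ce]) (use embed_in amb.\<Phi>_in in blast)
qed

lemma reduced_flow_image_sets:
  assumes E: "E \<in> sets liouville"
  shows "reduced_flow t ` E \<in> sets liouville"
proof -
  have Eb: "E \<in> sets borel" "E \<subseteq> cotangent_sphere" using E by (auto simp: borel_of_sets_liouville)
  define F where "F z = (if z \<in> cotangent_sphere then reduced_flow (- t) z else 0)" for z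
  have cs: "cotangent_sphere \<in> sets borel" using cotangent_sphere_closed by simp
  have F: "F \<in> borel_measurable borel"
    unfolding F_def by (rule borel_measurable_continuous_on_if[OF cs reduced_flow_continuous continuous_on_const])
  have "reduced_flow t ` E = cotangent_sphere \<inter> F -` E"
  proof (intro subset_antisym subsetI)
    fix z assume "z \<in> reduced_flow t ` E"
    then obtain y where y: "y \<in> E" "z = reduced_flow t y" by blast
    then have "y \<in> cotangent_sphere" using Eb(2) by blast
    then show "z \<in> cotangent_sphere \<inter> F -` E"
      using y by (simp add: F_def reduced_flow_in reduced_flow_inverse)
  next
    fix z assume z: "z \<in> cotangent_sphere \<inter> F -` E"
    then have "z = reduced_flow t (reduced_flow (- t) z)" by (simp add: reduced_flow_inverse')
    moreover have "reduced_flow (- t) z \<in> E" using z by (auto simp: F_def split: if_splits)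
    ultimately show "z \<in> reduced_flow t ` E" by (rule image_eqI)
  qed
  moreover have "cotangent_sphere \<inter> F -` E \<in> sets borel"
    using cs measurable_sets[OF F Eb(1)] by auto
  ultimately show ?thesis
    using Eb(2) reduced_flow_in by (auto simp: borel_of_sets_liouville)
qed

text \<open>Norm and spin are conserved and the projection intertwines the flows, so each defining
  condition of \<open>thicken\<close> is transported; the reverse inclusion is the forward one at
  time \<open>- t\<close>.\<close>

lemma flow_thicken:
  assumes E: "E \<subseteq> cotangent_sphere"
  shows "amb.\<Phi> t ` thicken E = thicken (reduced_flow t ` E)"
proof -
  have inv: "norm (fst (amb.\<Phi> t w)) = norm (fst w)" "spin (fst (amb.\<Phi> t w)) (snd (amb.\<Phi> t w)) = spin (fst w) (snd w)"
    if "w \<in> punctured" for w t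
    using amb.first_integral[OF that, of t] by (simp_all add: integrals_def norm_eq_sqrt_inner)
  have fwd: "amb.\<Phi> t w \<in> thicken (reduced_flow t ` F)" if w: "w \<in> thicken F" for w t F
  proof -
    have p: "w \<in> punctured" using w thicken_subset by blast
    have "fst (amb.\<Phi> t w) \<noteq> 0" using amb.\<Phi>_in[OF p, of t] by (auto simp: punctured_def)
    then show ?thesis using w by (auto simp: thicken_def inv[OF p] project_flow[OF p])
  qed
  show ?thesis
  proof (intro subset_antisym subsetI)
    fix w assume "w \<in> amb.\<Phi> t ` thicken E"
    then show "w \<in> thicken (reduced_flow t ` E)" using fwd by blast
  next
    fix w assume w: "w \<in> thicken (reduced_flow t ` E)"
    have p: "w \<in> punctured" using w thicken_subset by blast
    have "reduced_flow (- t) ` reduced_flow t ` E = (\<lambda>z. z) ` E"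
      unfolding image_image by (rule image_cong) (use E reduced_flow_inverse in auto)
    then have "amb.\<Phi> (- t) w \<in> thicken E" using fwd[OF w, of "- t"] by simp
    then show "w \<in> amb.\<Phi> t ` thicken E"
      by (intro image_eqI[of _ _ "amb.\<Phi> (- t) w"]) (simp_all add: amb.\<Phi>_inverse[OF p])
  qed
qed

lemma liouville_invariant: "flow_invariant cotangent_sphere (reduced_field a b \<mu> A) liouville"
  unfolding flow_invariant_def
proof (intro allI ballI impI)
  fix t E assume E: "E \<in> sets liouville"
  have Eb: "E \<in> sets borel" "E \<subseteq> cotangent_sphere" using E by (auto simp: borel_of_sets_liouville)
  have im: "flow cotangent_sphere (reduced_field a b \<mu> A) t `` E = reduced_flow t ` E"
    unfolding flow_reduced_field using Eb(2) by (auto simp: reduced_flow_def Image_def image_def)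
  have FE: "reduced_flow t ` E \<in> sets liouville" by (rule reduced_flow_image_sets[OF E])
  have "radial_factor * emeasure liouville (reduced_flow t ` E) = ennreal chart_factor * emeasure ambient_measure (amb.\<Phi> t ` thicken E)"
    unfolding emeasure_liouville_thicken[OF FE] flow_thicken[OF Eb(2)] ..
  also have "\<dots> = radial_factor * emeasure liouville E"
    unfolding emeasure_liouville_thicken[OF E] ambient_flow_invariant(2)[OF thicken_measurable[OF Eb(1)] thicken_subset] ..
  \<comment> \<open>The common factor may be cancelled because it is neither 0 nor infinite, even
    when the measure of \<open>E\<close> is infinite.\<close>
  finally have "emeasure liouville (reduced_flow t ` E) = emeasure liouville E"
    using radial_factor_pos_finite by (auto simp: ennreal_mult_cancel_left)
  then show "flow cotangent_sphere (reduced_field a b \<mu> A) t `` E \<in> sets liouville \<and>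
      emeasure liouville (flow cotangent_sphere (reduced_field a b \<mu> A) t `` E) = emeasure liouville E"
    unfolding im using FE by blast
qed

end

theorem mainTheorem3:
  fixes a b \<mu> I\<^sub>1 I\<^sub>2 I\<^sub>3 :: real
  assumes "a > 0" and "b \<noteq> 0" and "b \<noteq> - a" and "\<mu> > 0"
    and "I\<^sub>1 > 0" and "I\<^sub>2 > 0" and "I\<^sub>3 > 0"
  shows "flow_invariant cotangent_sphere (reduced_field a b \<mu> (diag3 I\<^sub>1 I\<^sub>2 I\<^sub>3))
    (volume_measure (\<lambda>(\<gamma>, p) u\<^sub>1 u\<^sub>2 u\<^sub>3 u\<^sub>4.
       plane_det \<gamma> (reduced_legendre a b \<mu> (diag3 I\<^sub>1 I\<^sub>2 I\<^sub>3) \<gamma>) powr ((1/2) * (b/a - 1))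
       * wedge omega_can omega_can u\<^sub>1 u\<^sub>2 u\<^sub>3 u\<^sub>4))"
proof -
  interpret rubber_rolling a b \<mu> I\<^sub>1 I\<^sub>2 I\<^sub>3 using assms by unfold_locales
  show ?thesis using liouville_invariant unfolding liouville_def p_def .
qed

end
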